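(* Let $\mathcal H$ be an infinite-dimensional Hilbert space. If $\mathcal H$ is complex, then $\mathrm{Aut}(\mathfrak u_2(\mathcal H))\cong \mathrm{PAU}(\mathcal H)$; if $\mathcal H$ is real, then $\mathrm{Aut}(\mathfrak o_2(\mathcal H))\cong \mathrm O(\mathcal H)/\{\pm\mathbf 1\}$; if $\mathcal H$ is quaternionic, then $\mathrm{Aut}(\mathfrak{sp}_2(\mathcal H))\cong\mathrm{Sp}(\mathcal H)/\{\pm\mathbf 1\}$. In each case the isomorphism is induced by $g\mapsto (x\mapsto gxg^{-1})$.
   Context: For a Hilbert space $\mathcal H$ over $\mathbb K\in\{\mathbb R,\mathbb C,\mathbb H\}$, $\mathfrak u_2(\mathcal H)=\{x\in B_2(\mathcal H):x^*=-x\}$ (skew-hermitian Hilbert–Schmidt operators) with scalar product $\langle x,y\rangle=\mathrm{tr}_{\mathbb R}(xy^* )$; it is denoted $\mathfrak o_2(\mathcal H)$ for real and $\mathfrak{sp}_2(\mathcal H)$ for quaternionic $\mathcal H$; $\mathrm O(\mathcal H)$, $\mathrm{Sp}(\mathcal H)$ are the full unitary groups in the real/quaternionic case. $\mathrm{Aut}$ denotes Lie algebra automorphisms preserving the scalar product. $\mathrm{AU}(\mathcal H)$ is the group of unitary or antiunitary operators on the complex Hilbert space $\mathcal H$, and $\mathrm{PAU}(\mathcal H)=\mathrm{AU}(\mathcal H)/\mathbb T\mathbf 1$. *)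

theory Defs
  imports "HOL-Analysis.Analysis"
begin

text \<open>A Hilbert space over K in {R, C, H} is encoded as a real Hilbert space
  (type class real_inner + complete_space) together with a family Js of
  orthogonal operators generating the K-structure: Js = [] (real),
  Js = [J] with J o J = -id (complex), Js = [I, J] with I, J anticommuting
  complex structures (quaternionic).  K-linear means commuting with all of Js.\<close>

definition orth_op :: "('h::real_inner \<Rightarrow> 'h) \<Rightarrow> bool" where
  "orth_op g \<longleftrightarrow> bij g \<and> linear g \<and> (\<forall>u v. inner (g u) (g v) = inner u v)"

definition complex_structure :: "('h::real_inner \<Rightarrow> 'h) \<Rightarrow> bool" where
  "complex_structure J \<longleftrightarrow> orth_op J \<and> (\<forall>u. J (J u) = - u)"

definition quaternionic_structure :: "('h::real_inner \<Rightarrow> 'h) \<Rightarrow> ('h \<Rightarrow> 'h) \<Rightarrow> bool" where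
  "quaternionic_structure I J \<longleftrightarrow> complex_structure I \<and> complex_structure J
     \<and> (\<forall>u. I (J u) = - J (I u))"

definition K_linear :: "('h \<Rightarrow> 'h) list \<Rightarrow> ('h \<Rightarrow> 'h) \<Rightarrow> bool" where
  "K_linear Js x \<longleftrightarrow> (\<forall>J\<in>set Js. x \<circ> J = J \<circ> x)"

definition infinite_dimensional :: "'h::real_vector itself \<Rightarrow> bool" where
  "infinite_dimensional _ \<longleftrightarrow> \<not> (\<exists>S::'h set. finite S \<and> span S = UNIV)"

definition orthonormal_basis :: "'h::real_inner set \<Rightarrow> bool" where
  "orthonormal_basis B \<longleftrightarrow> (\<forall>e\<in>B. norm e = 1) \<and> pairwise orthogonal B
     \<and> closure (span B) = UNIV"

definition hilbert_schmidt :: "('h::real_inner \<Rightarrow> 'h) \<Rightarrow> bool" where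
  "hilbert_schmidt x \<longleftrightarrow> bounded_linear x \<and>
     (\<exists>B. orthonormal_basis B \<and> (\<lambda>e. (norm (x e))\<^sup>2) summable_on B)"

definition hs_inner :: "('h::real_inner \<Rightarrow> 'h) \<Rightarrow> ('h \<Rightarrow> 'h) \<Rightarrow> real" where
  "hs_inner x y = infsum (\<lambda>e. inner (x e) (y e)) (SOME B. orthonormal_basis B)"

definition u2 :: "('h::real_inner \<Rightarrow> 'h) list \<Rightarrow> ('h \<Rightarrow> 'h) set" where
  "u2 Js = {x. hilbert_schmidt x \<and> K_linear Js x \<and> (\<forall>u v. inner (x u) v = - inner u (x v))}"

definition lie_bracket :: "('h::real_vector \<Rightarrow> 'h) \<Rightarrow> ('h \<Rightarrow> 'h) \<Rightarrow> ('h \<Rightarrow> 'h)" where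
  "lie_bracket x y = (\<lambda>u. x (y u) - y (x u))"

text \<open>Aut: Lie algebra automorphisms of u2 Js preserving the scalar product
  (only the values on u2 Js are relevant).\<close>
definition Aut :: "('h::real_inner \<Rightarrow> 'h) list \<Rightarrow> (('h \<Rightarrow> 'h) \<Rightarrow> ('h \<Rightarrow> 'h)) set" where
  "Aut Js = {\<phi>. bij_betw \<phi> (u2 Js) (u2 Js)
     \<and> (\<forall>x\<in>u2 Js. \<forall>y\<in>u2 Js. \<phi> (\<lambda>u. x u + y u) = (\<lambda>u. \<phi> x u + \<phi> y u))
     \<and> (\<forall>x\<in>u2 Js. \<forall>c::real. \<phi> (\<lambda>u. c *\<^sub>R x u) = (\<lambda>u. c *\<^sub>R \<phi> x u))
     \<and> (\<forall>x\<in>u2 Js. \<forall>y\<in>u2 Js. \<phi> (lie_bracket x y) = lie_bracket (\<phi> x) (\<phi> y))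
     \<and> (\<forall>x\<in>u2 Js. \<forall>y\<in>u2 Js. hs_inner (\<phi> x) (\<phi> y) = hs_inner x y)}"

definition unitary_group :: "('h::real_inner \<Rightarrow> 'h) list \<Rightarrow> ('h \<Rightarrow> 'h) set" where
  "unitary_group Js = {g. orth_op g \<and> K_linear Js g}"

definition AU :: "('h::real_inner \<Rightarrow> 'h) \<Rightarrow> ('h \<Rightarrow> 'h) set" where
  "AU J = {g. orth_op g \<and> (g \<circ> J = J \<circ> g \<or> g \<circ> J = (\<lambda>u. - J (g u)))}"

definition Ad :: "('h \<Rightarrow> 'h) \<Rightarrow> ('h \<Rightarrow> 'h) \<Rightarrow> ('h \<Rightarrow> 'h)" where
  "Ad g x = g \<circ> x \<circ> inv g"

text \<open>The map g |-> Ad g induces an isomorphism G / N = Aut Js: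
  it lands in Aut, is surjective onto Aut, and its kernel is exactly N.\<close>
definition induces_iso :: "('h::real_inner \<Rightarrow> 'h) list \<Rightarrow> ('h \<Rightarrow> 'h) set \<Rightarrow> ('h \<Rightarrow> 'h) set \<Rightarrow> bool" where
  "induces_iso Js G N \<longleftrightarrow>
     (\<forall>g\<in>G. \<forall>h\<in>G. \<forall>x\<in>u2 Js. Ad (g \<circ> h) x = Ad g (Ad h x))
   \<and> (\<forall>g\<in>G. Ad g \<in> Aut Js)
   \<and> (\<forall>\<phi>\<in>Aut Js. \<exists>g\<in>G. \<forall>x\<in>u2 Js. \<phi> x = Ad g x)
   \<and> (\<forall>g\<in>G. (\<forall>x\<in>u2 Js. Ad g x = x) \<longleftrightarrow> g \<in> N)"

end

(*
  Let T_0 = 1, T_1, ... be the standard basis of the scalars K, and write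
  wedge u w = u w* - w u* for the K-linear skew operators of minimal rank.  They test the whole of
  u_2(H), as <x, wedge u w> is a multiple of <x w, u>, and they satisfy
  [x, wedge u w] = wedge (x u) w + wedge u (x w).

  If x^3 = -x then ad x is annihilated by p(t) = t (t^2 + 1) (t^2 + 4).  Conversely p(ad x) = 0
  implies p(x) = 0: apply p(ad x) (wedge u e_n) to e_n for an orthonormal sequence e_n and use
  x e_n -> 0, which is where infinite dimension enters.  As an automorphism phi is isometric, it
  therefore permutes the solutions of x^3 = -x of minimal Hilbert-Schmidt norm; no spectral theorem
  is needed.

  If K is C or H, such an element x lives on a single K-line K v, and {c. (ad x)^2 c = -c} is
  {wedge u v. u orthogonal to K v}.  If K is R, one uses two such elements wedge p v and wedge q v and
  recovers {wedge u v} from commutation and orthogonality relations.  In each case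
  phi (wedge u v) = wedge (g u) v' for a linear isometry g between the complements of the two lines,
  and g extends to an (anti)unitary operator with g v = v'.  Then phi and Ad g agree on the wedges
  with v, hence by brackets on all wedges, hence everywhere.
*)
theory Submission
  imports Defs
begin

section \<open>Orthonormal bases and skew Hilbert--Schmidt operators\<close>

text \<open>The roots of \<open>p\<close> are the differences of the roots of
  \<open>t^3 + t\<close>: \<open>ad x\<close> is left minus right multiplication by
  \<open>x\<close>, and the two commute. Passing from \<open>p(ad x) = 0\<close> back to
  \<open>p(x) = 0\<close> fails in finite dimension, where \<open>u(n)\<close> contains the
  multiples of \<open>i 1\<close>, on which \<open>ad\<close> vanishes. The roots \<open>2 i\<close>
  and \<open>- 2 i\<close> that \<open>x\<close> might still have are excluded by size: such an
  eigenvector costs \<open>4 d\<close> in \<open>hs_inner x x\<close>, where \<open>d\<close> is the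
  real dimension of the scalars, while the elements used have the value \<open>d\<close> (one line
  over C or H) or 2 (the least value of a nonzero solution over R, where finite-rank skew operators
  have even rank). This even rank is why R needs another route: \<open>(ad x)^2 c = -c\<close> does
  not single out a line in the plane of \<open>x\<close>, and a second element has to break the
  symmetry. Over C the line determines \<open>x\<close> up to a sign, which separates unitary from
  antiunitary. Over H the automorphisms of the scalars are inner, and a suitable choice of the
  vector within its line absorbs them.\<close>

definition orthonormal :: "'a::real_inner set \<Rightarrow> bool" where
  "orthonormal B \<longleftrightarrow> (\<forall>e\<in>B. norm e = 1) \<and> pairwise orthogonal B"

lemma orthonormal_subset: "orthonormal B \<Longrightarrow> A \<subseteq> B \<Longrightarrow> orthonormal A"
  by (auto simp: orthonormal_def intro: pairwise_subset)

lemma orthonormal_inner: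
  assumes "orthonormal B" "e \<in> B" "f \<in> B"
  shows "inner e f = (if e = f then 1 else 0)"
  using assms by (auto simp: orthonormal_def pairwise_def orthogonal_def norm_eq_1)

lemma orthonormal_basis_orthonormal: "orthonormal_basis B \<Longrightarrow> orthonormal B"
  by (simp add: orthonormal_basis_def orthonormal_def)

section \<open>Projections onto finite orthonormal sets, Bessel and Parseval\<close>

definition proj :: "'a::real_inner set \<Rightarrow> 'a \<Rightarrow> 'a" where
  "proj F u = (\<Sum>e\<in>F. inner u e *\<^sub>R e)"

lemma proj_in_span: "proj F u \<in> span F"
  unfolding proj_def by (intro span_sum span_scale span_base)

lemma inner_proj:
  assumes "orthonormal F" "finite F" "e \<in> F"
  shows "inner (proj F u) e = inner u e"
proof -
  have "inner (proj F u) e = (\<Sum>f\<in>F. inner u f * inner f e)"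
    by (simp add: proj_def inner_sum_left)
  also have "\<dots> = (\<Sum>f\<in>F. if f = e then inner u f else 0)"
    by (rule sum.cong) (auto simp: orthonormal_inner[OF assms(1) _ assms(3)])
  finally show ?thesis using assms by simp
qed

lemma residual_orthogonal_span:
  assumes "orthonormal F" "finite F" "s \<in> span F"
  shows "inner (u - proj F u) s = 0"
  using assms(3)
proof (induction rule: span_induct_alt)
  case base then show ?case by simp
next
  case (step c x y)
  then show ?case using inner_proj[OF assms(1,2)] by (simp add: inner_right_distrib inner_diff_left)
qed

lemma norm_residual:
  assumes "orthonormal F" "finite F"
  shows "(norm (u - proj F u))\<^sup>2 = (norm u)\<^sup>2 - (\<Sum>e\<in>F. (inner u e)\<^sup>2)"
proof -
  have "inner u (proj F u) = (\<Sum>e\<in>F. (inner u e)\<^sup>2)"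
    by (simp add: proj_def inner_sum_right power2_eq_square)
  moreover have "inner (u - proj F u) (proj F u) = 0"
    by (rule residual_orthogonal_span[OF assms proj_in_span])
  ultimately show ?thesis
    by (simp add: power2_norm_eq_inner inner_diff_left inner_diff_right inner_commute)
qed

lemma Bessel_finite:
  assumes "orthonormal F" "finite F"
  shows "(\<Sum>e\<in>F. (inner u e)\<^sup>2) \<le> (norm u)\<^sup>2"
  using norm_residual[OF assms, of u] zero_le_power2[of "norm (u - proj F u)"] by linarith

lemma Bessel_summable:
  assumes "orthonormal B"
  shows "(\<lambda>e. (inner u e)\<^sup>2) summable_on B"
proof (rule nonneg_bdd_above_summable_on)
  show "bdd_above (sum (\<lambda>e. (inner u e)\<^sup>2) ` {F. F \<subseteq> B \<and> finite F})"
    by (rule bdd_aboveI[of _ "(norm u)\<^sup>2"]) (auto intro: Bessel_finite orthonormal_subset[OF assms])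
qed simp

lemma best_approximation:
  assumes "orthonormal F" "finite F" "s \<in> span F"
  shows "norm (u - proj F u) \<le> norm (u - s)"
proof -
  have "inner (u - proj F u) (proj F u - s) = 0"
    by (rule residual_orthogonal_span[OF assms(1,2)]) (intro span_diff proj_in_span assms(3))
  then have "(norm (u - s))\<^sup>2 = (norm (u - proj F u))\<^sup>2 + (norm (proj F u - s))\<^sup>2"
    unfolding power2_norm_eq_inner by (simp add: inner_diff_left inner_diff_right inner_commute)
  then have "(norm (u - proj F u))\<^sup>2 \<le> (norm (u - s))\<^sup>2" by simp
  then show ?thesis by (rule power2_le_imp_le) simp
qed

lemma Parseval:
  assumes "orthonormal_basis B"
  shows "infsum (\<lambda>e. (inner u e)\<^sup>2) B = (norm u)\<^sup>2"
proof (rule antisym)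
  have on: "orthonormal B" using assms by (rule orthonormal_basis_orthonormal)
  show "infsum (\<lambda>e. (inner u e)\<^sup>2) B \<le> (norm u)\<^sup>2"
    by (rule infsum_le_finite_sums[OF Bessel_summable[OF on]])
      (auto intro: Bessel_finite orthonormal_subset[OF on])
  show "(norm u)\<^sup>2 \<le> infsum (\<lambda>e. (inner u e)\<^sup>2) B"
  proof (rule field_le_epsilon)
    fix \<epsilon> :: real assume "\<epsilon> > 0"
    have "u \<in> closure (span B)" using assms by (simp add: orthonormal_basis_def)
    then obtain s where s: "s \<in> span B" "dist s u < sqrt \<epsilon>"
      using \<open>\<epsilon> > 0\<close> by (metis closure_approachable real_sqrt_gt_zero)
    \<comment> \<open>A vector of the span involves finitely many basis vectors, so finite best
      approximation applies to it.\<close>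
    obtain F where F: "finite F" "F \<subseteq> B" "s \<in> span F"
      using s(1) unfolding span_explicit by (auto intro!: span_sum span_scale span_base)
    have onF: "orthonormal F" using orthonormal_subset[OF on F(2)] .
    have "norm (u - proj F u) \<le> norm (u - s)" by (rule best_approximation[OF onF F(1,3)])
    also have "\<dots> < sqrt \<epsilon>" using s(2) by (simp add: dist_norm norm_minus_commute)
    finally have "(norm (u - proj F u))\<^sup>2 < (sqrt \<epsilon>)\<^sup>2"
      by (intro power_strict_mono) auto
    then have "(norm u)\<^sup>2 \<le> (\<Sum>e\<in>F. (inner u e)\<^sup>2) + \<epsilon>"
      using norm_residual[OF onF F(1), of u] \<open>\<epsilon> > 0\<close> by simp
    also have "(\<Sum>e\<in>F. (inner u e)\<^sup>2) \<le> infsum (\<lambda>e. (inner u e)\<^sup>2) B"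
      by (rule finite_sum_le_infsum[OF Bessel_summable[OF on] F(1,2)]) simp
    finally show "(norm u)\<^sup>2 \<le> infsum (\<lambda>e. (inner u e)\<^sup>2) B + \<epsilon>" by simp
  qed
qed

lemma inner_polarization:
  fixes a b :: "'a::real_inner"
  shows "inner a b = ((norm (a + b))\<^sup>2 - (norm a)\<^sup>2 - (norm b)\<^sup>2) / 2"
  by (simp add: power2_norm_eq_inner inner_add_left inner_add_right inner_commute)

lemma Parseval_inner:
  assumes "orthonormal_basis B"
  shows "((\<lambda>e. inner u e * inner w e) has_sum inner u w) B"
proof -
  have on: "orthonormal B" using assms by (rule orthonormal_basis_orthonormal)
  have hs: "((\<lambda>e. (inner v e)\<^sup>2) has_sum (norm v)\<^sup>2) B" for v
    using Parseval[OF assms] Bessel_summable[OF on] by (metis has_sum_infsum)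
  have "((\<lambda>e. (inner (u + w) e)\<^sup>2 + (- ((inner u e)\<^sup>2 + (inner w e)\<^sup>2)))
      has_sum ((norm (u + w))\<^sup>2 + - ((norm u)\<^sup>2 + (norm w)\<^sup>2))) B"
    by (intro has_sum_add has_sum_uminusI hs)
  then have "((\<lambda>e. ((inner (u + w) e)\<^sup>2 + (- ((inner u e)\<^sup>2 + (inner w e)\<^sup>2))) * (1/2))
      has_sum ((norm (u + w))\<^sup>2 + - ((norm u)\<^sup>2 + (norm w)\<^sup>2)) * (1/2)) B"
    by (rule has_sum_cmult_left)
  moreover have "((norm (u + w))\<^sup>2 + - ((norm u)\<^sup>2 + (norm w)\<^sup>2)) * (1/2) = inner u w"
    by (simp add: inner_polarization[of u w] diff_divide_distrib add_divide_distrib)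
  moreover have "((inner (u + w) e)\<^sup>2 + (- ((inner u e)\<^sup>2 + (inner w e)\<^sup>2))) * (1/2) = inner u e * inner w e" for e
    by (simp add: inner_add_left power2_eq_square algebra_simps)
  ultimately show ?thesis by simp
qed

text \<open>\<open>hs_inner\<close> sums over a chosen basis, so it has content only once a basis
  exists. A maximal orthonormal set is total: completeness gives each \<open>u\<close> a projection
  \<open>a\<close> onto the closed span, and a nonzero \<open>u - a\<close> could be normalized and
  added to the set.\<close>

lemma orthonormal_basis_exists: "\<exists>B :: 'a::{real_inner,complete_space} set. orthonormal_basis B"
proof -
  let ?A = "{B :: 'a set. orthonormal B}"
  have "\<exists>M\<in>?A. \<forall>X\<in>?A. M \<subseteq> X \<longrightarrow> X = M"
  proof (rule subset_Zorn_nonempty)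
    show "?A \<noteq> {}" by (auto simp: orthonormal_def intro: exI[of _ "{}"])
    fix \<C> assume C: "\<C> \<noteq> {}" "subset.chain ?A \<C>"
    have "orthogonal x y" if "X \<in> \<C>" "Y \<in> \<C>" "x \<in> X" "y \<in> Y" "x \<noteq> y" for X Y x y
    proof -
      have "X \<subseteq> Y \<or> Y \<subseteq> X" using C that by (auto simp: subset.chain_def)
      then have "\<exists>Z\<in>\<C>. x \<in> Z \<and> y \<in> Z" using that by (elim disjE) auto
      then obtain Z where "Z \<in> \<C>" "x \<in> Z" "y \<in> Z" by blast
      moreover from this have "pairwise orthogonal Z"
        using C(2) by (auto simp: subset.chain_def orthonormal_def)
      ultimately show ?thesis using \<open>x \<noteq> y\<close> by (simp add: pairwiseD)
    qed
    moreover have "norm e = 1" if "X \<in> \<C>" "e \<in> X" for X e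
    proof -
      have "orthonormal X" using C(2) that by (auto simp: subset.chain_def)
      then show ?thesis using that by (simp add: orthonormal_def)
    qed
    ultimately show "\<Union>\<C> \<in> ?A"
      unfolding mem_Collect_eq orthonormal_def pairwise_def by blast
  qed
  then obtain B :: "'a set" where B: "orthonormal B" "\<And>X. orthonormal X \<Longrightarrow> B \<subseteq> X \<Longrightarrow> X = B"
    by auto
  have "u \<in> closure (span B)" for u
  proof -
    let ?f = "\<lambda>e. (inner u e)\<^sup>2"
    define \<sigma> where "\<sigma> = infsum ?f B"
    have fin_le: "sum ?f F \<le> \<sigma>" if "finite F" "F \<subseteq> B" for F
      unfolding \<sigma>_def by (rule finite_sum_le_infsum[OF Bessel_summable[OF B(1)] that]) simp
    have "\<exists>F. finite F \<and> F \<subseteq> B \<and> sum ?f F > \<sigma> - inverse (real (Suc n))" for n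
    proof (rule ccontr)
      assume "\<nexists>F. finite F \<and> F \<subseteq> B \<and> sum ?f F > \<sigma> - inverse (real (Suc n))"
      then have "infsum ?f B \<le> \<sigma> - inverse (real (Suc n))"
        by (intro infsum_le_finite_sums[OF Bessel_summable[OF B(1)]]) (meson not_le)
      then show False by (simp add: \<sigma>_def)
    qed
    then obtain F where F: "\<And>n. finite (F n)" "\<And>n. F n \<subseteq> B"
        "\<And>n. sum ?f (F n) > \<sigma> - inverse (real (Suc n))" by metis
    have onF: "orthonormal (F n)" for n using orthonormal_subset[OF B(1) F(2)] .
    let ?S = "\<lambda>n. proj (F n) u"
    \<comment> \<open>The sets \<open>F n\<close> need not be nested, so two projections are
      compared through the projection onto their union, of which \<open>F n\<close> misses at most
      \<open>inverse (Suc n)\<close> in square norm.\<close>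
    have union: "(norm (proj (F m \<union> F n) u - ?S n))\<^sup>2 \<le> inverse (real (Suc n))" for m n
    proof -
      let ?G = "F m \<union> F n"
      have G: "finite ?G" "?G \<subseteq> B" using F by auto
      have onG: "orthonormal ?G" using orthonormal_subset[OF B(1) G(2)] .
      have "inner (u - proj ?G u) (proj ?G u - ?S n) = 0"
        by (rule residual_orthogonal_span[OF onG G(1)])
          (meson Un_upper2 proj_in_span span_diff span_mono subsetD)
      then have "(norm (u - ?S n))\<^sup>2 = (norm (u - proj ?G u))\<^sup>2 + (norm (proj ?G u - ?S n))\<^sup>2"
        unfolding power2_norm_eq_inner by (simp add: inner_diff_left inner_diff_right inner_commute)
      then have "(norm (proj ?G u - ?S n))\<^sup>2 = sum ?f ?G - sum ?f (F n)"
        using norm_residual[OF onG G(1), of u] norm_residual[OF onF F(1), of u n] by simp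
      then show ?thesis using fin_le[OF G] F(3)[of n] by linarith
    qed
    have union': "norm (proj (F m \<union> F n) u - ?S n) \<le> sqrt (inverse (real (Suc n)))" for m n
      using union real_le_rsqrt by blast
    have lim0: "(\<lambda>n. sqrt (inverse (real (Suc n)))) \<longlonglongrightarrow> 0"
      using tendsto_real_sqrt[OF LIMSEQ_inverse_real_of_nat] by simp
    have "Cauchy ?S"
    proof (rule CauchyI)
      fix \<epsilon> :: real assume "\<epsilon> > 0"
      then obtain N where N: "\<And>n. n \<ge> N \<Longrightarrow> sqrt (inverse (real (Suc n))) < \<epsilon> / 2"
        using order_tendstoD(2)[OF lim0, of "\<epsilon>/2"] by (auto simp: eventually_sequentially)
      have "norm (?S m - ?S n) < \<epsilon>" if "m \<ge> N" "n \<ge> N" for m n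
      proof -
        have "norm (?S m - ?S n) \<le> norm (proj (F m \<union> F n) u - ?S n) + norm (proj (F n \<union> F m) u - ?S m)"
          by (metis Un_commute add.commute dist_norm dist_triangle3)
        also have "\<dots> < \<epsilon> / 2 + \<epsilon> / 2"
          using union'[of m n] union'[of n m] N[OF that(1)] N[OF that(2)] by linarith
        finally show ?thesis by simp
      qed
      then show "\<exists>M. \<forall>m\<ge>M. \<forall>n\<ge>M. norm (?S m - ?S n) < \<epsilon>" by blast
    qed
    then obtain a where a: "?S \<longlonglongrightarrow> a" using Cauchy_convergent convergent_def by blast
    have orth: "inner (u - a) e = 0" if "e \<in> B" for e
    proof -
      have "(\<lambda>n. (inner (u - ?S n) e)\<^sup>2) \<longlonglongrightarrow> (inner (u - a) e)\<^sup>2"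
        by (intro tendsto_intros a)
      \<comment> \<open>If \<open>e\<close> is outside \<open>F n\<close>, adding it would raise the
        finite sum by \<open>(inner u e)^2\<close>, but less than \<open>inverse (Suc n)\<close> is
        left below \<sigma>.\<close>
      moreover have "(inner (u - ?S n) e)\<^sup>2 \<le> inverse (real (Suc n))" for n
      proof (cases "e \<in> F n")
        case True then show ?thesis using inner_proj[OF onF F(1)] by (simp add: inner_diff_left)
      next
        case False
        have "inner (?S n) e = (\<Sum>f\<in>F n. inner u f * inner f e)"
          by (simp add: proj_def inner_sum_left)
        also have "\<dots> = 0"
          using False F(2)[of n] that
          by (intro sum.neutral ballI) (metis mult_zero_right orthonormal_inner[OF B(1)] subsetD)
        finally have "(inner (u - ?S n) e)\<^sup>2 = ?f e" by (simp add: inner_diff_left)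
        moreover have "?f e + sum ?f (F n) \<le> \<sigma>"
          using fin_le[of "insert e (F n)"] False F that by simp
        ultimately show ?thesis using F(3)[of n] by linarith
      qed
      ultimately have "(inner (u - a) e)\<^sup>2 \<le> 0"
        by (intro LIMSEQ_le[OF _ LIMSEQ_inverse_real_of_nat]) auto
      then show ?thesis by simp
    qed
    have "u = a"
    proof (rule ccontr)
      assume ne: "u \<noteq> a"
      let ?e = "(u - a) /\<^sub>R norm (u - a)"
      have 0: "inner ?e e = 0" if "e \<in> B" for e using orth[OF that] by simp
      have 1: "norm ?e = 1" using ne by simp
      have "orthonormal (insert ?e B)"
        using B(1) 1 0 unfolding orthonormal_def pairwise_insert
        by (auto simp: orthogonal_def inner_commute)
      then have "?e \<in> B" using B(2) by blast
      then have "inner ?e ?e = 0" by (rule 0)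
      then show False using 1 by (metis inner_eq_zero_iff norm_zero zero_neq_one)
    qed
    moreover have "a \<in> closure (span B)"
      unfolding closure_sequential
      by (rule exI[of _ ?S]) (use a F(2) span_mono proj_in_span in blast)
    ultimately show ?thesis by simp
  qed
  then show ?thesis using B(1) by (auto simp: orthonormal_basis_def orthonormal_def)
qed

abbreviation std_basis :: "'a::{real_inner,complete_space} set" where
  "std_basis \<equiv> (SOME B. orthonormal_basis B)"

lemma std_basis: "orthonormal_basis (std_basis :: 'a::{real_inner,complete_space} set)"
  using orthonormal_basis_exists by (rule someI_ex)

text \<open>Over a finite basis Parseval makes every residual vanish, so the basis would span
  algebraically.\<close>

lemma orthonormal_basis_infinite:
  assumes "infinite_dimensional TYPE('a::real_inner)" "orthonormal_basis (B::'a set)"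
  shows "infinite B"
proof
  assume fin: "finite B"
  have on: "orthonormal B" using assms by (simp add: orthonormal_basis_orthonormal)
  have "u \<in> span B" for u
  proof -
    have "(norm (u - proj B u))\<^sup>2 = 0"
      using norm_residual[OF on fin, of u] Parseval[OF assms(2), of u] fin by simp
    then have "u = proj B u" by simp
    then show ?thesis using proj_in_span by metis
  qed
  then show False using assms(1) fin by (auto simp: infinite_dimensional_def)
qed

section \<open>Skew Hilbert--Schmidt operators and independence of the basis\<close>

definition skew :: "('a::real_inner \<Rightarrow> 'a) \<Rightarrow> bool" where
  "skew x \<longleftrightarrow> (\<forall>u v. inner (x u) v = - inner u (x v))"

lemma skewD: "skew x \<Longrightarrow> inner (x u) v = - inner u (x v)"
  by (auto simp: skew_def)

lemma skew_inner_self: "skew x \<Longrightarrow> inner (x u) u = 0"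
  using skewD[of x u u] by (simp add: inner_commute)

text \<open>Transposing the matrix of a skew \<open>x\<close> only changes signs, so the sum over
  \<open>F\<close> can be computed from the columns \<open>x e\<close>, each of which obeys Bessel.
  As \<open>F\<close> and \<open>B\<close> are unrelated, this frees the Hilbert--Schmidt condition
  from its basis.\<close>

lemma skew_Bessel:
  assumes x: "skew x" and B: "orthonormal_basis B" "(\<lambda>e. (norm (x e))\<^sup>2) summable_on B"
    and F: "orthonormal F" "finite F"
  shows "(\<Sum>f\<in>F. (norm (x f))\<^sup>2) \<le> infsum (\<lambda>e. (norm (x e))\<^sup>2) B"
proof -
  have on: "orthonormal B" using B(1) by (rule orthonormal_basis_orthonormal)
  have eq: "(inner (x f) e)\<^sup>2 = (inner (x e) f)\<^sup>2" for e f
    using skewD[OF x, of f e] by (simp add: inner_commute)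
  have summ: "(\<lambda>e. (inner (x e) f)\<^sup>2) summable_on B" for f
    using Bessel_summable[OF on, of "x f"] by (simp add: eq)
  have "(\<Sum>f\<in>F. (norm (x f))\<^sup>2) = (\<Sum>f\<in>F. infsum (\<lambda>e. (inner (x e) f)\<^sup>2) B)"
    using Parseval[OF B(1)] by (simp add: eq[symmetric])
  also have "\<dots> = infsum (\<lambda>e. \<Sum>f\<in>F. (inner (x e) f)\<^sup>2) B"
    and "(\<lambda>e. \<Sum>f\<in>F. (inner (x e) f)\<^sup>2) summable_on B"
  proof -
    have "((\<lambda>e. \<Sum>f\<in>F. (inner (x e) f)\<^sup>2) has_sum (\<Sum>f\<in>F. infsum (\<lambda>e. (inner (x e) f)\<^sup>2) B)) B"
      using F(2) summ
    proof (induction F rule: finite_induct)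
      case (insert f F)
      then show ?case by (simp add: has_sum_add)
    qed simp
    then show "(\<Sum>f\<in>F. infsum (\<lambda>e. (inner (x e) f)\<^sup>2) B) = infsum (\<lambda>e. \<Sum>f\<in>F. (inner (x e) f)\<^sup>2) B"
      "(\<lambda>e. \<Sum>f\<in>F. (inner (x e) f)\<^sup>2) summable_on B"
      by (auto simp: infsumI has_sum_imp_summable)
  qed
  note this(1)
  also have "infsum (\<lambda>e. \<Sum>f\<in>F. (inner (x e) f)\<^sup>2) B \<le> infsum (\<lambda>e. (norm (x e))\<^sup>2) B"
    by (rule infsum_mono) (use \<open>(\<lambda>e. \<Sum>f\<in>F. (inner (x e) f)\<^sup>2) summable_on B\<close> B(2)
        Bessel_finite[OF F] in auto)
  finally show ?thesis .
qed

lemma skew_sum_basis_indep: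
  assumes x: "skew x" and B: "orthonormal_basis B" "(\<lambda>e. (norm (x e))\<^sup>2) summable_on B"
    and C: "orthonormal_basis C"
  shows "(\<lambda>e. (norm (x e))\<^sup>2) summable_on C"
    and "infsum (\<lambda>e. (norm (x e))\<^sup>2) C = infsum (\<lambda>e. (norm (x e))\<^sup>2) B"
proof -
  have onB: "orthonormal B" and onC: "orthonormal C"
    using B C by (simp_all add: orthonormal_basis_orthonormal)
  have le: "(\<Sum>f\<in>F. (norm (x f))\<^sup>2) \<le> infsum (\<lambda>e. (norm (x e))\<^sup>2) B" if "finite F" "F \<subseteq> C" for F
    by (rule skew_Bessel[OF x B orthonormal_subset[OF onC that(2)] that(1)])
  show sC: "(\<lambda>e. (norm (x e))\<^sup>2) summable_on C"
    by (rule nonneg_bdd_above_summable_on) (auto intro!: bdd_aboveI le)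
  have le': "(\<Sum>f\<in>F. (norm (x f))\<^sup>2) \<le> infsum (\<lambda>e. (norm (x e))\<^sup>2) C" if "finite F" "F \<subseteq> B" for F
    by (rule skew_Bessel[OF x C sC orthonormal_subset[OF onB that(2)] that(1)])
  show "infsum (\<lambda>e. (norm (x e))\<^sup>2) C = infsum (\<lambda>e. (norm (x e))\<^sup>2) B"
    by (intro antisym infsum_le_finite_sums sC B(2) le le')
qed

text \<open>This is the Lie algebra for K = R. \<open>u2 Js\<close> is its part commuting with the
  scalars, so the analytic closure properties are proved here once for all K.\<close>

definition skew_hs :: "('a::real_inner \<Rightarrow> 'a) set" where
  "skew_hs = {x. hilbert_schmidt x \<and> skew x}"

lemma skew_hsD:
  assumes "x \<in> skew_hs"
  shows "bounded_linear x" "skew x" "linear x"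
  using assms by (auto simp: skew_hs_def hilbert_schmidt_def bounded_linear.linear)

lemma skew_hs_summable:
  assumes "x \<in> skew_hs" "orthonormal_basis C"
  shows "(\<lambda>e. (norm (x e))\<^sup>2) summable_on C"
  using assms skew_sum_basis_indep(1)[of x _ C] by (auto simp: skew_hs_def hilbert_schmidt_def)

lemma skew_hsI:
  assumes "bounded_linear x" "skew x" "orthonormal_basis B" "(\<lambda>e. (norm (x e))\<^sup>2) summable_on B"
  shows "x \<in> skew_hs"
  using assms by (auto simp: skew_hs_def hilbert_schmidt_def)

lemma norm_add_square_le:
  fixes a b :: "'a::real_inner"
  shows "(norm (a + b))\<^sup>2 \<le> 2 * (norm a)\<^sup>2 + 2 * (norm b)\<^sup>2"
  using inner_ge_zero[of "a - b"]
  by (simp add: power2_norm_eq_inner inner_add_left inner_add_right inner_diff_left inner_diff_right inner_commute)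

lemma summable_square_add:
  fixes x y :: "'b \<Rightarrow> 'a::real_inner"
  assumes "(\<lambda>e. (norm (x e))\<^sup>2) summable_on B" "(\<lambda>e. (norm (y e))\<^sup>2) summable_on B"
  shows "(\<lambda>e. (norm (x e + y e))\<^sup>2) summable_on B"
  by (rule summable_on_comparison_test[where f = "\<lambda>e. 2 * (norm (x e))\<^sup>2 + 2 * (norm (y e))\<^sup>2"])
    (auto intro!: summable_on_add summable_on_cmult_right assms norm_add_square_le)

lemma skew_hs_add:
  fixes x y :: "'a::{real_inner,complete_space} \<Rightarrow> 'a"
  assumes "x \<in> skew_hs" "y \<in> skew_hs"
  shows "(\<lambda>u. x u + y u) \<in> skew_hs"
proof (rule skew_hsI[OF _ _ std_basis])
  show "bounded_linear (\<lambda>u. x u + y u)"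
    by (intro bounded_linear_add skew_hsD assms)
  show "skew (\<lambda>u. x u + y u)"
    using skewD[OF skew_hsD(2)[OF assms(1)]] skewD[OF skew_hsD(2)[OF assms(2)]]
    by (simp add: skew_def inner_add_left inner_add_right)
  show "(\<lambda>e. (norm (x e + y e))\<^sup>2) summable_on (std_basis :: 'a set)"
    by (intro summable_square_add skew_hs_summable std_basis assms)
qed

lemma skew_hs_scale:
  fixes x :: "'a::{real_inner,complete_space} \<Rightarrow> 'a"
  assumes "x \<in> skew_hs"
  shows "(\<lambda>u. c *\<^sub>R x u) \<in> skew_hs"
proof (rule skew_hsI[OF _ _ std_basis])
  show "bounded_linear (\<lambda>u. c *\<^sub>R x u)"
    by (intro bounded_linear_const_scaleR skew_hsD assms)
  show "skew (\<lambda>u. c *\<^sub>R x u)"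
    using skewD[OF skew_hsD(2)[OF assms(1)]] by (simp add: skew_def)
  show "(\<lambda>e. (norm (c *\<^sub>R x e))\<^sup>2) summable_on (std_basis :: 'a set)"
    using summable_on_cmult_right[OF skew_hs_summable[OF assms std_basis], of "c\<^sup>2"]
    by (simp add: power_mult_distrib)
qed

lemma summable_square_compose:
  assumes "bounded_linear x" "(\<lambda>e. (norm (y e))\<^sup>2) summable_on B"
  shows "(\<lambda>e. (norm (x (y e)))\<^sup>2) summable_on B"
proof -
  obtain K where K: "\<And>u. norm (x u) \<le> norm u * K" "K > 0"
    using bounded_linear.pos_bounded[OF assms(1)] by blast
  show ?thesis
  proof (rule summable_on_comparison_test)
    show "(\<lambda>e. K\<^sup>2 * (norm (y e))\<^sup>2) summable_on B"
      by (intro summable_on_cmult_right assms)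
    show "(norm (x (y e)))\<^sup>2 \<le> K\<^sup>2 * (norm (y e))\<^sup>2" for e
      using power_mono[OF K(1)[of "y e"], of 2] by (simp add: power_mult_distrib mult.commute)
  qed simp
qed

lemma skew_hs_bracket:
  fixes x y :: "'a::{real_inner,complete_space} \<Rightarrow> 'a"
  assumes "x \<in> skew_hs" "y \<in> skew_hs"
  shows "lie_bracket x y \<in> skew_hs"
proof (rule skew_hsI[OF _ _ std_basis])
  note b = skew_hsD(1)[OF assms(1)] skew_hsD(1)[OF assms(2)]
  note s = skewD[OF skew_hsD(2)[OF assms(1)]] skewD[OF skew_hsD(2)[OF assms(2)]]
  show "bounded_linear (lie_bracket x y)"
    unfolding lie_bracket_def
    by (intro bounded_linear_sub bounded_linear_compose[OF b(1) b(2)] bounded_linear_compose[OF b(2) b(1)])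
  show "skew (lie_bracket x y)"
    by (simp add: skew_def lie_bracket_def inner_diff_left inner_diff_right s)
  have "(\<lambda>e. (norm (x (y e) + - y (x e)))\<^sup>2) summable_on (std_basis :: 'a set)"
    by (rule summable_square_add)
      (simp_all add: summable_square_compose b skew_hs_summable assms std_basis)
  then show "(\<lambda>e. (norm (lie_bracket x y e))\<^sup>2) summable_on (std_basis :: 'a set)"
    by (simp add: lie_bracket_def)
qed

lemma hs_norm: "hs_inner x x = infsum (\<lambda>e. (norm (x e))\<^sup>2) std_basis"
  by (simp add: hs_inner_def power2_norm_eq_inner)

text \<open>Polarization reduces the basis independence of the scalar product to that of the square
  sums.\<close>

lemma hs_inner_basis:
  fixes x y :: "'a::{real_inner,complete_space} \<Rightarrow> 'a"
  assumes x: "x \<in> skew_hs" and y: "y \<in> skew_hs" and C: "orthonormal_basis C"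
  shows "((\<lambda>e. inner (x e) (y e)) has_sum hs_inner x y) C"
proof -
  define q where "q z = infsum (\<lambda>e. (norm (z e))\<^sup>2) (std_basis :: 'a set)" for z :: "'a \<Rightarrow> 'a"
  have q: "((\<lambda>e. (norm (z e))\<^sup>2) has_sum q z) C'" if "z \<in> skew_hs" "orthonormal_basis C'" for z C'
    unfolding q_def
    using skew_sum_basis_indep(2)[OF skew_hsD(2)[OF that(1)] std_basis skew_hs_summable[OF that(1) std_basis] that(2)]
      skew_hs_summable[OF that] by (metis has_sum_infsum)
  let ?q = "(q (\<lambda>u. x u + y u) + - (q x + q y)) * (1/2)"
  have gen: "((\<lambda>e. inner (x e) (y e)) has_sum ?q) C'" if "orthonormal_basis C'" for C'
  proof -
    have "((\<lambda>e. ((norm (x e + y e))\<^sup>2 + - ((norm (x e))\<^sup>2 + (norm (y e))\<^sup>2)) * (1/2)) has_sum ?q) C'"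
      by (intro has_sum_cmult_left has_sum_add has_sum_uminusI q skew_hs_add x y that)
    moreover have "((norm (x e + y e))\<^sup>2 + - ((norm (x e))\<^sup>2 + (norm (y e))\<^sup>2)) * (1/2) = inner (x e) (y e)" for e
      by (simp add: inner_polarization[of "x e"])
    ultimately show ?thesis by simp
  qed
  show ?thesis using gen[OF C] gen[OF std_basis] by (simp add: hs_inner_def infsumI)
qed

lemma hs_inner_add_left:
  fixes x y z :: "'a::{real_inner,complete_space} \<Rightarrow> 'a"
  assumes "x \<in> skew_hs" "y \<in> skew_hs" "z \<in> skew_hs"
  shows "hs_inner (\<lambda>u. x u + y u) z = hs_inner x z + hs_inner y z"
  using has_sum_add[OF hs_inner_basis[OF assms(1,3) std_basis] hs_inner_basis[OF assms(2,3) std_basis]]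
  by (simp add: hs_inner_def[of "\<lambda>u. x u + y u"] inner_add_left infsumI)

lemma hs_inner_scale_left: "hs_inner (\<lambda>u. c *\<^sub>R x u) y = c * hs_inner x y"
  by (simp add: hs_inner_def infsum_cmult_right')

lemma hs_inner_commute: "hs_inner x y = hs_inner y x"
  by (simp add: hs_inner_def inner_commute)

lemma hs_Bessel:
  fixes x :: "'a::{real_inner,complete_space} \<Rightarrow> 'a"
  assumes "x \<in> skew_hs" "orthonormal F" "finite F"
  shows "(\<Sum>f\<in>F. (norm (x f))\<^sup>2) \<le> hs_inner x x"
  unfolding hs_norm
  by (rule skew_Bessel[OF skew_hsD(2)[OF assms(1)] std_basis skew_hs_summable[OF assms(1) std_basis] assms(2,3)])

lemma hs_inner_eq_0:
  fixes x :: "'a::{real_inner,complete_space} \<Rightarrow> 'a"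
  assumes "x \<in> skew_hs" "hs_inner x x = 0"
  shows "x u = 0"
proof (cases "u = 0")
  case True
  then show ?thesis using linear_0[OF skew_hsD(3)[OF assms(1)]] by simp
next
  case False
  have "orthonormal {u /\<^sub>R norm u}" using False by (simp add: orthonormal_def)
  from hs_Bessel[OF assms(1) this] assms(2)
  have "x (u /\<^sub>R norm u) = 0" by simp
  then show ?thesis using False linear_scale[OF skew_hsD(3)[OF assms(1)]] by simp
qed

text \<open>\<open>T 0, \<dots>, T (d - 1)\<close> is the standard basis of the scalars over the reals.  The averaging
  axioms make the operator \<open>kk u w\<close> below, which is \<open>u w\<^sup>*\<close>, commute with scalars and satisfy
  \<open>(u t) (w t)\<^sup>* = u w\<^sup>*\<close> for \<open>t\<close> in the basis.\<close>

section \<open>The scalar structure\<close>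

locale K_structure =
  fixes Js :: "('h::{real_inner,complete_space} \<Rightarrow> 'h) list"
    and T :: "nat \<Rightarrow> 'h \<Rightarrow> 'h" and d :: nat
  assumes infinite_dim: "infinite_dimensional TYPE('h)"
    and d_pos: "0 < d"
    and T_0: "T 0 u = u"
    and T_orth_op: "i < d \<Longrightarrow> orth_op (T i)"
    and T_square: "0 < i \<Longrightarrow> i < d \<Longrightarrow> T i (T i u) = - u"
    and T_orthogonal: "i < d \<Longrightarrow> j < d \<Longrightarrow> i \<noteq> j \<Longrightarrow> inner (T i u) (T j u) = 0"
    and T_closed: "i < d \<Longrightarrow> j < d \<Longrightarrow> \<exists>k<d. \<exists>\<epsilon>. \<forall>u. T i (T j u) = \<epsilon> *\<^sub>R T k u"
    and K_linear_iff: "linear x \<Longrightarrow> K_linear Js x \<longleftrightarrow> (\<forall>i<d. \<forall>u. x (T i u) = T i (x u))"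
    and average_left: "i < d \<Longrightarrow>
      (\<Sum>j<d. inner (T j w) (T i z) *\<^sub>R T j u) = T i (\<Sum>j<d. inner (T j w) z *\<^sub>R T j u)"
    and average_right: "i < d \<Longrightarrow>
      (\<Sum>j<d. inner (T j (T i w)) z *\<^sub>R T j (T i u)) = (\<Sum>j<d. inner (T j w) z *\<^sub>R T j u)"
begin

lemma T_linear: "i < d \<Longrightarrow> linear (T i)"
  using T_orth_op by (simp add: orth_op_def)

lemma T_inner: "i < d \<Longrightarrow> inner (T i u) (T i v) = inner u v"
  using T_orth_op by (simp add: orth_op_def)

lemma norm_T: "i < d \<Longrightarrow> norm (T i u) = norm u"
  by (simp add: norm_eq_sqrt_inner T_inner)

lemma T_simps:
  assumes "i < d"
  shows "T i (u + v) = T i u + T i v" "T i (u - v) = T i u - T i v" "T i (c *\<^sub>R u) = c *\<^sub>R T i u"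
    "T i 0 = 0" "T i (- u) = - T i u"
  using T_linear[OF assms]
  by (simp_all add: linear_add linear_diff linear_scale linear_0 linear_neg)

text \<open>The adjoint of \<open>T i\<close> is \<open>sg i\<close> times \<open>T i\<close>: the
  sign records the conjugation of the basis scalars.\<close>

definition sg :: "nat \<Rightarrow> real" where "sg i = (if i = 0 then 1 else - 1)"

lemma sg_sq: "sg i * sg i = 1" by (simp add: sg_def)

lemma T_T: "i < d \<Longrightarrow> T i (T i u) = sg i *\<^sub>R u"
  by (simp add: sg_def T_0 T_square)

lemma T_adj: "i < d \<Longrightarrow> inner (T i u) v = sg i * inner u (T i v)"
proof -
  assume i: "i < d"
  have "inner (T i u) v = sg i * (sg i * inner (T i u) v)" using sg_sq by (simp add: mult.assoc[symmetric])
  also have "\<dots> = sg i * inner (T i u) (T i (T i v))" by (simp add: T_T i)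
  finally show ?thesis by (simp add: T_inner i)
qed

lemma T_orthogonal_self: "0 < i \<Longrightarrow> i < d \<Longrightarrow> inner (T i u) u = 0"
  using T_orthogonal[of i 0 u] by (simp add: T_0)

lemma inner_T_T: "i < d \<Longrightarrow> j < d \<Longrightarrow> inner (T i v) (T j v) = (if i = j then (norm v)\<^sup>2 else 0)"
  by (simp add: T_orthogonal T_inner power2_norm_eq_inner)

text \<open>Vanishing of the K-valued inner product, whose real components are the numbers
  \<open>inner (T i u) v\<close> up to sign.\<close>

definition korth :: "'h \<Rightarrow> 'h \<Rightarrow> bool" where
  "korth u v \<longleftrightarrow> (\<forall>i<d. inner (T i u) v = 0)"

lemma korthD: "korth u v \<Longrightarrow> i < d \<Longrightarrow> inner (T i u) v = 0"
  by (simp add: korth_def)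

lemma korth_inner: "korth u v \<Longrightarrow> inner u v = 0"
  using korthD[of u v 0] d_pos by (simp add: T_0)

lemma korth_sym: "korth u v \<Longrightarrow> korth v u"
  unfolding korth_def using T_adj by (metis inner_commute mult_zero_right)

lemma korth_T: "korth u v \<Longrightarrow> j < d \<Longrightarrow> korth (T j u) v"
  unfolding korth_def using T_closed by (metis inner_scaleR_left mult_zero_right)

lemma korth_T2: "korth u v \<Longrightarrow> j < d \<Longrightarrow> korth u (T j v)"
  using korth_T korth_sym by blast

lemma korth_TT: "korth u v \<Longrightarrow> i < d \<Longrightarrow> j < d \<Longrightarrow> inner (T i u) (T j v) = 0"
  using korth_T2 korthD by blast

lemma korth_scale: "korth u v \<Longrightarrow> korth u (c *\<^sub>R v)"
  by (simp add: korth_def)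

definition kk :: "'h \<Rightarrow> 'h \<Rightarrow> 'h \<Rightarrow> 'h" where
  "kk u w z = (\<Sum>i<d. inner (T i w) z *\<^sub>R T i u)"

lemma kk_add: 
  "kk (u + u') w z = kk u w z + kk u' w z"
  "kk u (w + w') z = kk u w z + kk u w' z"
  "kk u w (z + z') = kk u w z + kk u w z'"
  by (simp_all add: kk_def T_simps inner_add_left inner_add_right scaleR_add_left scaleR_add_right sum.distrib)

lemma kk_scale: 
  "kk (c *\<^sub>R u) w z = c *\<^sub>R kk u w z"
  "kk u (c *\<^sub>R w) z = c *\<^sub>R kk u w z"
  "kk u w (c *\<^sub>R z) = c *\<^sub>R kk u w z"
  by (simp_all add: kk_def T_simps scaleR_sum_right mult.commute)

lemma kk_linear: "linear (kk u w)"
  by (rule linearI) (simp_all add: kk_add kk_scale)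

lemma kk_diff: "kk u w (z - z') = kk u w z - kk u w z'"
  by (rule linear_diff[OF kk_linear])

lemma kk_bounded_linear: "bounded_linear (kk u w)"
  unfolding kk_def[abs_def]
  by (intro bounded_linear_sum bounded_linear_scaleR_const bounded_linear_inner_right)

lemma kk_0: "kk 0 w z = 0" "kk u 0 z = 0" "kk u w 0 = 0"
  using kk_scale(1)[of 0 0] kk_scale(2)[of u 0 0] kk_scale(3)[of u w 0 0] by simp_all

lemma kk_T: "i < d \<Longrightarrow> kk u w (T i z) = T i (kk u w z)"
  by (simp add: kk_def average_left)

lemma kk_TT: "i < d \<Longrightarrow> kk (T i u) (T i w) z = kk u w z"
  by (simp add: kk_def average_right)

text \<open>A scalar passes from one factor of \<open>u w^*\<close> to the other and gets
  conjugated, hence the sign.\<close>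

lemma kk_T_left: "i < d \<Longrightarrow> kk (T i u) w z = sg i *\<^sub>R kk u (T i w) z"
  using kk_TT[of i u "sg i *\<^sub>R T i w" z] by (simp add: kk_scale T_simps T_T sg_sq)

lemma kk_adj: "inner (kk u w z) v = inner z (kk w u v)"
  unfolding kk_def inner_sum_left inner_sum_right
  by (rule sum.cong) (simp_all add: inner_commute)

lemma kk_korth: "korth w z \<Longrightarrow> kk u w z = 0"
  by (simp add: kk_def korth_def)

lemma kk_self: "norm v = 1 \<Longrightarrow> kk u v v = u"
proof -
  assume v: "norm v = 1"
  have "kk u v v = (\<Sum>i<d. if i = 0 then u else 0)"
    unfolding kk_def using v
    by (intro sum.cong) (auto simp: T_0 T_orthogonal_self norm_eq_1)
  then show ?thesis using d_pos by simp
qed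

lemma inner_T_kk: "norm v = 1 \<Longrightarrow> i < d \<Longrightarrow> inner (T i v) (kk v v z) = inner (T i v) z"
proof -
  assume v: "norm v = 1" and i: "i < d"
  have "kk v v (T i v) = T i v" by (simp add: kk_T i kk_self v)
  then show ?thesis by (metis kk_adj)
qed

text \<open>For a unit vector \<open>v\<close> the vectors \<open>T i v\<close> are orthonormal, so
  \<open>kk v v\<close> is the orthogonal projection onto the line \<open>K v\<close>. The splitting
  of \<open>z\<close> into \<open>kk v v z\<close> and this residual is used throughout.\<close>

lemma korth_residual: "norm v = 1 \<Longrightarrow> korth v (z - kk v v z)"
  by (simp add: korth_def inner_diff_right inner_T_kk)

lemma kk_range: "korth v z \<Longrightarrow> inner (kk v w u) z = 0"
  by (metis inner_zero_right kk_adj kk_korth)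

lemma kk_range_korth: "korth v z \<Longrightarrow> korth z (kk v w u)"
  unfolding korth_def[of z] by (metis kk_range korth_T2 inner_commute)

text \<open>Double orthogonal complement of a line: the residual of \<open>u\<close> is orthogonal
  to \<open>u\<close> and to the line, hence to itself.\<close>

lemma kk_fixed_range:
  assumes "norm v = 1" "\<And>z. korth v z \<Longrightarrow> inner u z = 0"
  shows "kk v v u = u"
proof -
  let ?r = "u - kk v v u"
  have r: "korth v ?r" by (rule korth_residual[OF assms(1)])
  have "inner ?r ?r = inner u ?r - inner (kk v v u) ?r" by (simp add: inner_diff_left)
  also have "\<dots> = 0" using assms(2)[OF r] kk_range[OF r] by simp
  finally show ?thesis by simp
qed

definition wedge :: "'h \<Rightarrow> 'h \<Rightarrow> 'h \<Rightarrow> 'h" where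
  "wedge u w z = kk u w z - kk w u z"

lemma wedge_add:
  "wedge (u + u') w = (\<lambda>z. wedge u w z + wedge u' w z)"
  "wedge u (w + w') = (\<lambda>z. wedge u w z + wedge u w' z)"
  by (auto simp: wedge_def kk_add)

lemma wedge_scale:
  "wedge (c *\<^sub>R u) w = (\<lambda>z. c *\<^sub>R wedge u w z)"
  "wedge u (c *\<^sub>R w) = (\<lambda>z. c *\<^sub>R wedge u w z)"
  by (auto simp: wedge_def kk_scale scaleR_diff_right)

lemma wedge_minus_swap: "wedge u w z = - wedge w u z"
  by (simp add: wedge_def)

lemma wedge_0: "wedge 0 w = (\<lambda>z. 0)" "wedge u 0 = (\<lambda>z. 0)"
  by (auto simp: wedge_def kk_0)

lemma wedge_at:
  assumes "norm v = 1" "korth u v"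
  shows "wedge u v v = u"
  using assms by (simp add: wedge_def kk_self kk_korth)

lemma wedge_T_right: "i < d \<Longrightarrow> wedge u (T i w) z = sg i *\<^sub>R wedge (T i u) w z"
proof -
  assume i: "i < d"
  have 1: "kk u (T i w) z = sg i *\<^sub>R kk (T i u) w z" 
    using kk_T_left[OF i, of u w z] sg_sq by simp
  show ?thesis by (simp add: wedge_def 1 kk_T_left[OF i, of w u z] scaleR_diff_right)
qed

section \<open>The algebra \<open>u2 Js\<close> and its pairing with wedges\<close>

lemma u2_iff: "x \<in> u2 Js \<longleftrightarrow> x \<in> skew_hs \<and> (\<forall>i<d. \<forall>u. x (T i u) = T i (x u))"
  unfolding u2_def skew_hs_def skew_def using K_linear_iff
  by (auto simp: hilbert_schmidt_def bounded_linear.linear)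

lemma u2_skew_hs: "x \<in> u2 Js \<Longrightarrow> x \<in> skew_hs" by (simp add: u2_iff)
lemma u2_linear: "x \<in> u2 Js \<Longrightarrow> linear x" using skew_hsD u2_skew_hs by blast
lemma u2_bounded: "x \<in> u2 Js \<Longrightarrow> bounded_linear x" using skew_hsD u2_skew_hs by blast
lemma u2_skew: "x \<in> u2 Js \<Longrightarrow> skew x" using skew_hsD u2_skew_hs by blast
lemma u2_T: "x \<in> u2 Js \<Longrightarrow> i < d \<Longrightarrow> x (T i u) = T i (x u)" by (simp add: u2_iff)
lemma u2_inner: "x \<in> u2 Js \<Longrightarrow> inner (x u) v = - inner u (x v)"
  using u2_skew skewD by blast
lemma u2_inner_self: "x \<in> u2 Js \<Longrightarrow> inner (x u) u = 0"
  using u2_skew skew_inner_self by blast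
lemma u2_simps:
  assumes "x \<in> u2 Js"
  shows "x (u + v) = x u + x v" "x (u - v) = x u - x v" "x (c *\<^sub>R u) = c *\<^sub>R x u" "x 0 = 0" "x (- u) = - x u"
  using u2_linear[OF assms] by (simp_all add: linear_add linear_diff linear_scale linear_0 linear_neg)

lemma u2_add: "x \<in> u2 Js \<Longrightarrow> y \<in> u2 Js \<Longrightarrow> (\<lambda>u. x u + y u) \<in> u2 Js"
  by (simp add: u2_iff skew_hs_add T_simps)
lemma u2_scale: "x \<in> u2 Js \<Longrightarrow> (\<lambda>u. c *\<^sub>R x u) \<in> u2 Js"
  by (simp add: u2_iff skew_hs_scale T_simps)
lemma u2_bracket: "x \<in> u2 Js \<Longrightarrow> y \<in> u2 Js \<Longrightarrow> lie_bracket x y \<in> u2 Js"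
  unfolding u2_iff by (simp add: skew_hs_bracket) (simp add: T_simps lie_bracket_def)
lemma u2_diff: "x \<in> u2 Js \<Longrightarrow> y \<in> u2 Js \<Longrightarrow> (\<lambda>u. x u - y u) \<in> u2 Js"
  using u2_add[of x "\<lambda>u. (-1) *\<^sub>R y u"] u2_scale[of y "-1"] by simp

lemma u2_kk: "x \<in> u2 Js \<Longrightarrow> x (kk u w z) = kk (x u) w z"
  by (simp add: kk_def linear_sum[OF u2_linear] u2_simps u2_T)

lemma kk_u2: "x \<in> u2 Js \<Longrightarrow> kk u w (x z) = - kk u (x w) z"
proof -
  assume x: "x \<in> u2 Js"
  have "inner (T i w) (x z) = - inner (T i (x w)) z" if "i < d" for i
    using u2_inner[OF x, of "T i w" z] u2_T[OF x that] by simp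
  then show ?thesis by (simp add: kk_def sum_negf)
qed

lemma summable_square_sum:
  fixes f :: "nat \<Rightarrow> 'b \<Rightarrow> 'h"
  assumes "\<And>i. i < (n::nat) \<Longrightarrow> (\<lambda>e. (norm (f i e))\<^sup>2) summable_on B"
  shows "(\<lambda>e. (norm (\<Sum>i<n. f i e))\<^sup>2) summable_on B"
  using assms by (induction n) (auto intro: summable_square_add)

lemma kk_summable: "(\<lambda>e. (norm (kk u w e))\<^sup>2) summable_on (std_basis :: 'h set)"
proof -
  have "(\<lambda>e. (norm (inner (T i w) e *\<^sub>R T i u))\<^sup>2) summable_on (std_basis :: 'h set)" for i
    using summable_on_cmult_left[OF Bessel_summable[OF orthonormal_basis_orthonormal[OF std_basis]], of "T i w" "(norm (T i u))\<^sup>2"]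
    by (simp add: power_mult_distrib)
  then show ?thesis unfolding kk_def by (intro summable_square_sum)
qed

lemma wedge_in_u2: "wedge u w \<in> u2 Js"
  unfolding u2_iff
proof (intro conjI allI impI)
  show "wedge u w \<in> skew_hs"
  proof (rule skew_hsI[OF _ _ std_basis])
    show "bounded_linear (wedge u w)"
      unfolding wedge_def[abs_def] by (intro bounded_linear_sub kk_bounded_linear)
    show "skew (wedge u w)"
      by (simp add: skew_def wedge_def inner_diff_left inner_diff_right kk_adj)
    have "(\<lambda>e. (norm (kk u w e + - kk w u e))\<^sup>2) summable_on (std_basis :: 'h set)"
      by (rule summable_square_add) (simp_all add: kk_summable)
    then show "(\<lambda>e. (norm (wedge u w e))\<^sup>2) summable_on (std_basis :: 'h set)"
      by (simp add: wedge_def)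
  qed
  show "wedge u w (T i z) = T i (wedge u w z)" if "i < d" for i z
    by (simp add: wedge_def kk_T that T_simps)
qed

text \<open>Expanding \<open>kk u w e\<close> over the basis scalars gives \<open>d\<close> Parseval
  sums. Since \<open>x\<close> commutes with the orthogonal \<open>T i\<close>, each of them equals
  \<open>inner (x w) u\<close>.\<close>

lemma has_sum_kk:
  assumes x: "x \<in> u2 Js"
  shows "((\<lambda>e. inner (x e) (kk u w e)) has_sum real d * inner (x w) u) (std_basis :: 'h set)"
proof -
  have "((\<lambda>e. \<Sum>i<n. - (inner (T i w) e * inner (x (T i u)) e)) has_sum (\<Sum>i<n. inner (x w) u)) (std_basis :: 'h set)"
    if "n \<le> d" for n
    using that
  proof (induction n)
    case (Suc n)
    have "inner (T n w) (x (T n u)) = inner w (x u)" using Suc.prems by (simp add: u2_T[OF x] T_inner)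
    then have "((\<lambda>e. - (inner (T n w) e * inner (x (T n u)) e)) has_sum inner (x w) u) (std_basis :: 'h set)"
      using has_sum_uminusI[OF Parseval_inner[OF std_basis, of "T n w" "x (T n u)"]]
      by (simp add: u2_inner[OF x])
    then have "((\<lambda>e. (\<Sum>i<n. - (inner (T i w) e * inner (x (T i u)) e)) + - (inner (T n w) e * inner (x (T n u)) e))
        has_sum ((\<Sum>i<n. inner (x w) u) + inner (x w) u)) (std_basis :: 'h set)"
      using Suc by (intro has_sum_add) auto
    then show ?case by (simp only: sum.lessThan_Suc)
  qed simp
  from this[of d]
  have "((\<lambda>e. \<Sum>i<d. - (inner (T i w) e * inner (x (T i u)) e)) has_sum real d * inner (x w) u) (std_basis :: 'h set)"
    by simp
  moreover have "inner (x e) (kk u w e) = (\<Sum>i<d. - (inner (T i w) e * inner (x (T i u)) e))" for e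
    unfolding kk_def inner_sum_right
    by (rule sum.cong) (simp_all add: u2_inner[OF x] inner_commute)
  ultimately show ?thesis by simp
qed

text \<open>The factor \<open>d\<close> comes from the real trace, the factor 2 from the two halves
  of the wedge, which contribute equally because \<open>x\<close> is skew.\<close>

lemma hs_inner_wedge:
  assumes x: "x \<in> u2 Js"
  shows "hs_inner x (wedge u w) = 2 * real d * inner (x w) u"
proof -
  have "((\<lambda>e. inner (x e) (kk u w e) + - inner (x e) (kk w u e)) has_sum
    (real d * inner (x w) u + - (real d * inner (x u) w))) (std_basis :: 'h set)"
    by (intro has_sum_add has_sum_uminusI has_sum_kk x)
  moreover have "inner (x u) w = - inner (x w) u" using u2_inner[OF x, of u w] by (simp add: inner_commute)
  ultimately show ?thesis
    by (simp add: hs_inner_def wedge_def inner_diff_right infsumI)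
qed

lemma eq_0_if_orthogonal_wedges:
  assumes "y \<in> u2 Js" "\<And>u w. hs_inner y (wedge u w) = 0"
  shows "y u = 0"
proof -
  have "inner (y u) (y u) = 0" using assms(2)[of "y u" u] hs_inner_wedge[OF assms(1)] d_pos by simp
  then show ?thesis by simp
qed

lemma hs_inner_diff_left:
  assumes "x \<in> u2 Js" "y \<in> u2 Js" "z \<in> u2 Js"
  shows "hs_inner (\<lambda>u. x u - y u) z = hs_inner x z - hs_inner y z"
  using hs_inner_add_left[OF u2_skew_hs[OF assms(1)] u2_skew_hs[OF u2_scale[OF assms(2), of "-1"]] u2_skew_hs[OF assms(3)]]
    hs_inner_scale_left[of "-1" y z] by simp

text \<open>Expanding the square norm of \<open>x - y\<close> identifies two elements from values of
  the scalar product alone; the real case recognizes wedges in this way.\<close>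

lemma u2_eq_if_hs:
  assumes "x \<in> u2 Js" "y \<in> u2 Js" "hs_inner x x = hs_inner x y" "hs_inner y y = hs_inner x y"
  shows "x = y"
proof -
  let ?z = "\<lambda>u. x u - y u"
  have z: "?z \<in> u2 Js" by (intro u2_diff assms)
  have "hs_inner ?z ?z = hs_inner x ?z - hs_inner y ?z" by (rule hs_inner_diff_left[OF assms(1,2) z])
  also have "\<dots> = 0"
    using hs_inner_diff_left[OF assms(1,2) assms(1)] hs_inner_diff_left[OF assms(1,2) assms(2)] assms(3,4)
    by (simp add: hs_inner_commute)
  finally have "?z u = 0" for u using hs_inner_eq_0[OF u2_skew_hs[OF z]] by blast
  then show ?thesis by auto
qed

lemma bracket_wedge:
  assumes x: "x \<in> u2 Js"
  shows "lie_bracket x (wedge u w) = (\<lambda>z. wedge (x u) w z + wedge u (x w) z)"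
  by (rule ext) (simp add: lie_bracket_def wedge_def u2_simps[OF x] u2_kk[OF x] kk_u2[OF x])

text \<open>Gram--Schmidt over K: the lines through \<open>V\<close> span a finite-dimensional real
  space, so some vector lies outside it, and its residual is normalized.\<close>

lemma exists_unit_korth:
  assumes "finite V" "\<And>v. v \<in> V \<Longrightarrow> norm v = 1" "pairwise korth V"
  obtains z where "norm z = 1" "\<And>v. v \<in> V \<Longrightarrow> korth v z"
proof -
  let ?S = "(\<lambda>(i, v). T i v) ` ({..<d} \<times> V)"
  have "finite ?S" using assms(1) by simp
  then obtain u where u: "u \<notin> span ?S"
    using infinite_dim unfolding infinite_dimensional_def by blast
  let ?r = "\<Sum>v\<in>V. kk v v u"
  have "?r \<in> span ?S"
    unfolding kk_def by (intro span_sum span_scale span_base) auto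
  then have ne: "u - ?r \<noteq> 0" using u by auto
  have "korth v (u - ?r)" if v: "v \<in> V" for v
  proof -
    have "inner (T i v) ?r = inner (T i v) u" if i: "i < d" for i
    proof -
      have "inner (T i v) (kk v' v' u) = 0" if "v' \<in> V" "v' \<noteq> v" for v'
        using assms(3) v that i korth_T kk_range korth_sym
        by (metis pairwiseD inner_commute)
      then have "inner (T i v) ?r = (\<Sum>v'\<in>V. if v' = v then inner (T i v) u else 0)"
        unfolding inner_sum_right by (intro sum.cong) (auto simp: inner_T_kk i assms(2))
      then show ?thesis using v assms(1) by simp
    qed
    then show ?thesis by (simp add: korth_def inner_diff_right)
  qed
  then have "korth v ((u - ?r) /\<^sub>R norm (u - ?r))" if "v \<in> V" for v
    using that korth_scale by blast
  moreover have "norm ((u - ?r) /\<^sub>R norm (u - ?r)) = 1" using ne by simp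
  ultimately show ?thesis using that by blast
qed

text \<open>\<open>f\<close> enumerates distinct elements of the standard basis. Both limits come
  from terms of convergent series, by Bessel for a fixed \<open>a\<close> and by the
  Hilbert--Schmidt condition for \<open>x\<close>.\<close>

lemma weakly_null_sequence:
  obtains f :: "nat \<Rightarrow> 'h" where "\<And>n. norm (f n) = 1" "\<And>a. (\<lambda>n. inner a (f n)) \<longlonglongrightarrow> 0"
    "\<And>x. x \<in> u2 Js \<Longrightarrow> (\<lambda>n. x (f n)) \<longlonglongrightarrow> 0"
proof -
  let ?B = "std_basis :: 'h set"
  have "infinite ?B" by (rule orthonormal_basis_infinite[OF infinite_dim std_basis])
  then obtain f :: "nat \<Rightarrow> 'h" where f: "inj f" "range f \<subseteq> ?B"
    using infinite_countable_subset by blast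
  have on: "orthonormal ?B" by (rule orthonormal_basis_orthonormal[OF std_basis])
  have lim: "(\<lambda>n. q (f n)) \<longlonglongrightarrow> 0" if "q summable_on ?B" for q :: "'h \<Rightarrow> real"
  proof -
    have "q summable_on (range f)" using summable_on_subset[OF that f(2)] .
    then have "(q \<circ> f) summable_on UNIV" using summable_on_reindex[OF f(1)] by blast
    then show ?thesis using summable_on_imp_summable summable_LIMSEQ_zero by (fastforce simp: o_def)
  qed
  show ?thesis
  proof (rule that)
    show "norm (f n) = 1" for n using on f(2) by (auto simp: orthonormal_def)
    show "(\<lambda>n. inner a (f n)) \<longlonglongrightarrow> 0" for a
    proof -
      have "(\<lambda>n. sqrt ((inner a (f n))\<^sup>2)) \<longlonglongrightarrow> sqrt 0"
        by (intro tendsto_intros lim[OF Bessel_summable[OF on]])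
      then show ?thesis by (simp add: tendsto_rabs_zero_iff)
    qed
    show "(\<lambda>n. x (f n)) \<longlonglongrightarrow> 0" if "x \<in> u2 Js" for x
    proof -
      have "(\<lambda>n. sqrt ((norm (x (f n)))\<^sup>2)) \<longlonglongrightarrow> sqrt 0"
        by (intro tendsto_intros lim[OF skew_hs_summable[OF u2_skew_hs[OF that] std_basis]])
      then show ?thesis by (simp add: tendsto_norm_zero_iff)
    qed
  qed
qed

text \<open>With respect to the splitting into \<open>K v\<close> and its complement, both diagonal
  blocks of \<open>c\<close> vanish, and by skewness the off-diagonal blocks are determined by
  \<open>c v\<close>.\<close>

lemma wedge_characterization:
  assumes c: "c \<in> u2 Js" and v: "norm v = 1" "korth v (c v)"
    and z: "\<And>z r. korth v z \<Longrightarrow> korth v r \<Longrightarrow> inner (c z) r = 0"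
  shows "c = wedge (c v) v"
proof
  fix z
  let ?p = "kk v v z" and ?r = "z - kk v v z"
  have r: "korth v ?r" by (rule korth_residual[OF v(1)])
  have "c z = c ?p + c ?r" using u2_simps(1)[OF c, of ?p ?r] by simp
  also have "c ?p = kk (c v) v z" by (rule u2_kk[OF c])
  also have "c ?r = kk v v (c ?r)"
    using kk_fixed_range[OF v(1), of "c ?r"] z[OF r] by simp
  also have "\<dots> = - kk v (c v) ?r" by (rule kk_u2[OF c])
  also have "kk v (c v) ?r = kk v (c v) z" 
    using kk_korth[OF kk_range_korth[OF v(2)], of v v z] by (simp add: kk_diff)
  finally show "c z = wedge (c v) v z" by (simp add: wedge_def)
qed

section \<open>Automorphisms\<close>

lemma Aut_u2: "\<phi> \<in> Aut Js \<Longrightarrow> x \<in> u2 Js \<Longrightarrow> \<phi> x \<in> u2 Js"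
  by (auto simp: Aut_def bij_betw_def)
lemma Aut_surj: "\<phi> \<in> Aut Js \<Longrightarrow> y \<in> u2 Js \<Longrightarrow> \<exists>x\<in>u2 Js. y = \<phi> x"
  by (auto simp: Aut_def bij_betw_def)
lemma Aut_inj: "\<phi> \<in> Aut Js \<Longrightarrow> x \<in> u2 Js \<Longrightarrow> y \<in> u2 Js \<Longrightarrow> \<phi> x = \<phi> y \<longleftrightarrow> x = y"
  by (auto simp: Aut_def bij_betw_def inj_on_def)
lemma Aut_add: "\<phi> \<in> Aut Js \<Longrightarrow> x \<in> u2 Js \<Longrightarrow> y \<in> u2 Js \<Longrightarrow> \<phi> (\<lambda>u. x u + y u) = (\<lambda>u. \<phi> x u + \<phi> y u)"
  by (auto simp: Aut_def)
lemma Aut_scale: "\<phi> \<in> Aut Js \<Longrightarrow> x \<in> u2 Js \<Longrightarrow> \<phi> (\<lambda>u. c *\<^sub>R x u) = (\<lambda>u. c *\<^sub>R \<phi> x u)"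
  by (auto simp: Aut_def)
lemma Aut_bracket: "\<phi> \<in> Aut Js \<Longrightarrow> x \<in> u2 Js \<Longrightarrow> y \<in> u2 Js \<Longrightarrow> \<phi> (lie_bracket x y) = lie_bracket (\<phi> x) (\<phi> y)"
  by (auto simp: Aut_def)
lemma Aut_hs: "\<phi> \<in> Aut Js \<Longrightarrow> x \<in> u2 Js \<Longrightarrow> y \<in> u2 Js \<Longrightarrow> hs_inner (\<phi> x) (\<phi> y) = hs_inner x y"
  by (auto simp: Aut_def)
lemma Aut_uminus: "\<phi> \<in> Aut Js \<Longrightarrow> x \<in> u2 Js \<Longrightarrow> \<phi> (\<lambda>u. - x u) = (\<lambda>u. - \<phi> x u)"
  using Aut_scale[of \<phi> x "-1"] by simp
lemma Aut_zero: "\<phi> \<in> Aut Js \<Longrightarrow> \<phi> (\<lambda>u. 0) = (\<lambda>u. 0)"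
  using Aut_scale[OF _ wedge_in_u2, of \<phi> 0] by simp

text \<open>The signs \<open>s\<close> cover the unitary (all signs 1) and the antiunitary operators at once.\<close>

definition twisted :: "(nat \<Rightarrow> real) \<Rightarrow> ('h \<Rightarrow> 'h) \<Rightarrow> bool" where
  "twisted s g \<longleftrightarrow> orth_op g \<and> (\<forall>i<d. s i * s i = 1 \<and> (\<forall>u. g (T i u) = s i *\<^sub>R T i (g u)))"

lemma twisted_simps:
  assumes "twisted s g"
  shows "g (u + v) = g u + g v" "g (u - v) = g u - g v" "g (c *\<^sub>R u) = c *\<^sub>R g u" "inner (g u) (g v) = inner u v"
    "inv g (g u) = u" "g (inv g u) = u" "i < d \<Longrightarrow> g (T i u) = s i *\<^sub>R T i (g u)" "linear g" "bij g"
  using assms unfolding twisted_def orth_op_def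
  by (auto simp: linear_add linear_diff linear_scale bij_is_inj surj_f_inv_f bij_is_surj)

lemma twisted_inner_inv: "twisted s g \<Longrightarrow> inner (g u) v = inner u (inv g v)"
  using twisted_simps(4,6) by metis

lemma twisted_inv_linear: "twisted s g \<Longrightarrow> linear (inv g)"
proof -
  assume g: "twisted s g"
  have "inv g (u + v) = inv g u + inv g v" for u v
    using twisted_simps[OF g] by metis
  moreover have "inv g (c *\<^sub>R u) = c *\<^sub>R inv g u" for c u
    using twisted_simps[OF g] by metis
  ultimately show ?thesis by (rule linearI)
qed

lemma twisted_inv_norm: "twisted s g \<Longrightarrow> norm (inv g u) = norm u" "twisted s g \<Longrightarrow> norm (g u) = norm u"
  using twisted_simps(4,6) by (metis norm_eq_sqrt_inner)+

lemma twisted_inv_T: "twisted s g \<Longrightarrow> i < d \<Longrightarrow> inv g (T i u) = s i *\<^sub>R T i (inv g u)"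
proof -
  assume g: "twisted s g" and i: "i < d"
  have "g (s i *\<^sub>R T i (inv g u)) = T i u"
    using g i by (simp add: twisted_simps[OF g] twisted_def)
  then show ?thesis using twisted_simps(5)[OF g] by metis
qed

section \<open>Conjugation by twisted operators\<close>

lemma orthonormal_basis_image:
  assumes g: "twisted s g" and B: "orthonormal_basis (B :: 'h set)"
  shows "orthonormal_basis (g ` B)" "orthonormal_basis (inv g ` B)"
proof -
  have gen: "orthonormal_basis (h ` B)"
    if lin: "linear h" and inn: "\<And>u v. inner (h u) (h v) = inner u v" and surj: "surj h" for h
    unfolding orthonormal_basis_def
  proof (intro conjI)
    have nrm: "norm (h u) = norm u" for u by (simp add: norm_eq_sqrt_inner inn)
    show "\<forall>e\<in>h ` B. norm e = 1" using B by (auto simp: orthonormal_basis_def nrm)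
    show "pairwise orthogonal (h ` B)"
      using B by (auto simp: orthonormal_basis_def pairwise_def orthogonal_def inn)
    have "bounded_linear h"
      by (rule bounded_linear_intro[where K = 1]) (simp_all add: linear_add[OF lin] linear_scale[OF lin] nrm)
    then have "h ` closure (span B) \<subseteq> closure (h ` span B)"
      by (intro image_closure_subset) (auto simp: linear_continuous_on closure_subset)
    then show "closure (span (h ` B)) = UNIV"
      using B surj by (auto simp: orthonormal_basis_def linear_span_image[OF lin])
  qed
  show "orthonormal_basis (g ` B)"
    by (rule gen) (simp_all add: twisted_simps[OF g] bij_is_surj)
  show "orthonormal_basis (inv g ` B)"
    by (rule gen) (simp_all add: twisted_inv_linear[OF g] twisted_simps(9)[OF g] bij_is_inj inj_imp_surj_inv twisted_inner_inv[OF g, symmetric] twisted_simps[OF g])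
qed

lemma Ad_apply: "Ad g x u = g (x (inv g u))" by (simp add: Ad_def)

lemma Ad_in_u2:
  assumes g: "twisted s g" and x: "x \<in> u2 Js"
  shows "Ad g x \<in> u2 Js"
  unfolding u2_iff
proof (intro conjI allI impI)
  \<comment> \<open>\<open>inv g\<close> and \<open>g\<close> each contribute the sign
    \<open>s i\<close>, so conjugation by an antiunitary operator also preserves
    K-linearity.\<close>
  show "Ad g x (T i u) = T i (Ad g x u)" if "i < d" for i u
    using g that by (simp add: Ad_apply twisted_inv_T[OF g] u2_simps[OF x] u2_T[OF x] twisted_simps[OF g] twisted_def)
  let ?B = "std_basis :: 'h set"
  have lin: "linear (Ad g x)"
    unfolding Ad_def by (intro linear_compose twisted_inv_linear[OF g] u2_linear[OF x] twisted_simps[OF g])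
  obtain K where K: "\<And>u. norm (x u) \<le> norm u * K" using bounded_linear.bounded[OF u2_bounded[OF x]] by blast
  have nb: "norm (Ad g x u) \<le> norm u * K" for u
    using K[of "inv g u"] by (simp add: Ad_apply twisted_inv_norm[OF g])
  show "Ad g x \<in> skew_hs"
  \<comment> \<open>On the transported basis \<open>Ad g x (g e) = g (x e)\<close> has the norm of
    \<open>x e\<close>; \<open>hilbert_schmidt\<close> asks for summability over some basis
    only.\<close>
  proof (rule skew_hsI[OF _ _ orthonormal_basis_image(1)[OF g std_basis]])
    show "bounded_linear (Ad g x)"
      by (rule bounded_linear_intro[where K = K])
        (simp_all add: linear_add[OF lin] linear_scale[OF lin] nb)
    show "skew (Ad g x)"
    proof -
      have "inner (Ad g x u) v = - inner u (Ad g x v)" for u v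
      proof -
        have "inner (Ad g x u) v = - inner (inv g u) (x (inv g v))"
          by (simp add: Ad_apply twisted_inner_inv[OF g] u2_inner[OF x])
        also have "inner (inv g u) (x (inv g v)) = inner u (Ad g x v)"
          using twisted_inner_inv[OF g, of "x (inv g v)" u] by (simp add: Ad_apply inner_commute)
        finally show ?thesis .
      qed
      then show ?thesis by (simp add: skew_def)
    qed
    show "(\<lambda>e. (norm (Ad g x e))\<^sup>2) summable_on g ` ?B"
      using skew_hs_summable[OF u2_skew_hs[OF x] std_basis]
      by (subst summable_on_reindex) (auto simp: o_def Ad_apply twisted_simps[OF g] twisted_inv_norm[OF g] bij_is_inj[THEN inj_on_subset])
  qed
qed

text \<open>Evaluating \<open>hs_inner x y\<close> on the basis that \<open>g\<close> carries to
  \<open>std_basis\<close> makes the two sums agree term by term.\<close>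

lemma hs_inner_Ad:
  assumes g: "twisted s g" and x: "x \<in> u2 Js" and y: "y \<in> u2 Js"
  shows "hs_inner (Ad g x) (Ad g y) = hs_inner x y"
proof -
  have inj: "inj_on (inv g) A" for A
    using twisted_simps(9)[OF g] by (meson bij_imp_bij_inv bij_is_inj inj_on_subset subset_UNIV)
  have "((\<lambda>e. inner (x e) (y e)) has_sum hs_inner x y) (inv g ` std_basis)"
    by (rule hs_inner_basis[OF u2_skew_hs[OF x] u2_skew_hs[OF y] orthonormal_basis_image(2)[OF g std_basis]])
  then have "((\<lambda>e. inner (Ad g x e) (Ad g y e)) has_sum hs_inner x y) std_basis"
    by (subst (asm) has_sum_reindex[OF inj]) (simp add: o_def Ad_apply twisted_simps[OF g])
  then show ?thesis by (simp add: hs_inner_def[of "Ad g x"] infsumI)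
qed

lemma twisted_inv: "twisted s g \<Longrightarrow> twisted s (inv g)"
  unfolding twisted_def[of s "inv g"] orth_op_def
  by (auto simp: twisted_inv_T twisted_inv_linear bij_imp_bij_inv twisted_simps(9))
    (metis twisted_simps(4,6), simp add: twisted_def)

lemma Ad_inv: "twisted s g \<Longrightarrow> Ad g (Ad (inv g) x) = x" "twisted s g \<Longrightarrow> Ad (inv g) (Ad g x) = x"
  by (auto simp: Ad_apply fun_eq_iff twisted_simps inv_inv_eq[OF twisted_simps(9)])

lemma Ad_Aut:
  assumes g: "twisted s g"
  shows "Ad g \<in> Aut Js"
  unfolding Aut_def mem_Collect_eq
proof (intro conjI ballI allI)
  show "bij_betw (Ad g) (u2 Js) (u2 Js)"
    by (rule bij_betw_byWitness[where f' = "Ad (inv g)"])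
      (use Ad_inv[OF g] Ad_in_u2[OF g] Ad_in_u2[OF twisted_inv[OF g]] in auto)
qed (auto simp: Ad_apply fun_eq_iff twisted_simps[OF g] lie_bracket_def hs_inner_Ad[OF g])

text \<open>Each term of \<open>kk\<close> acquires \<open>s i\<close> twice, in the coefficient and
  in the vector, so antiunitary \<open>g\<close> obey the same formula.\<close>

lemma Ad_wedge:
  assumes g: "twisted s g"
  shows "Ad g (wedge u w) = wedge (g u) (g w)"
proof -
  have "g (kk u w (inv g z)) = kk (g u) (g w) z" for u w z
  proof -
    have "g (kk u w (inv g z)) = (\<Sum>i<d. inner (g (T i w)) z *\<^sub>R g (T i u))"
      by (simp add: kk_def linear_sum[OF twisted_simps(8)[OF g]] twisted_simps(3)[OF g] twisted_inner_inv[OF g])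
    also have "\<dots> = (\<Sum>i<d. inner (T i (g w)) z *\<^sub>R T i (g u))"
      using g by (intro sum.cong) (auto simp: twisted_simps(7)[OF g] twisted_def mult.left_commute)
    finally show ?thesis by (simp add: kk_def)
  qed
  then show ?thesis by (auto simp: Ad_apply wedge_def twisted_simps[OF g])
qed

end

section \<open>Elements annihilated by a polynomial in their adjoint\<close>

text \<open>The polynomial \<open>t^5 + 5 t^3 + 4 t = t (t^2 + 1) (t^2 + 4)\<close>, evaluated at
  \<open>ad x\<close>.\<close>

definition ad_poly :: "('h::real_vector \<Rightarrow> 'h) \<Rightarrow> ('h \<Rightarrow> 'h) \<Rightarrow> 'h \<Rightarrow> 'h" where
  "ad_poly x y = (\<lambda>u. (lie_bracket x ^^ 5) y u + (5 *\<^sub>R (lie_bracket x ^^ 3) y u + 4 *\<^sub>R lie_bracket x y u))"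

lemma ad_poly_tripotent:
  fixes x y :: "'a::real_vector \<Rightarrow> 'a"
  assumes x: "linear x" and y: "linear y" and tri: "\<And>u. x (x (x u)) = - x u"
  shows "ad_poly x y u = 0"
proof -
  note l = linear_add[OF x] linear_diff[OF x] linear_scale[OF x] linear_neg[OF x] linear_0[OF x]
    linear_add[OF y] linear_diff[OF y] linear_scale[OF y] linear_neg[OF y] linear_0[OF y]
  let ?b = "lie_bracket x"
  \<comment> \<open>Breaking numerals into sums lets \<open>algebra_simps\<close> cancel integer
    multiples of vectors.\<close>
  have bit0: "numeral (Num.Bit0 n) *\<^sub>R a = numeral n *\<^sub>R a + numeral n *\<^sub>R a" for n and a :: 'a
    by (simp only: numeral_Bit0 scaleR_left_distrib)
  have bit1: "numeral (Num.Bit1 n) *\<^sub>R a = numeral n *\<^sub>R a + numeral n *\<^sub>R a + a" for n and a :: 'a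
    by (simp only: numeral_Bit1 scaleR_left_distrib scaleR_one)
  \<comment> \<open>Powers of left minus right multiplication by \<open>x\<close>, expanded
    binomially and reduced by \<open>x^3 = -x\<close>; only words with at most two factors
    \<open>x\<close> on either side of \<open>y\<close> survive.\<close>
  have b3: "?b (?b (?b y)) = (\<lambda>u. - x (y u) + y (x u) - 3 *\<^sub>R x (x (y (x u))) + 3 *\<^sub>R x (y (x (x u))))"
    by (rule ext) (simp add: lie_bracket_def l tri, simp add: algebra_simps bit0 bit1)
  have b4: "?b (?b (?b (?b y))) = (\<lambda>u. - x (x (y u)) + 8 *\<^sub>R x (y (x u)) + 6 *\<^sub>R x (x (y (x (x u)))) - y (x (x u)))"
    unfolding b3 by (rule ext) (simp add: lie_bracket_def l tri, simp add: algebra_simps bit0 bit1)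
  have b5: "?b (?b (?b (?b (?b y)))) = (\<lambda>u. x (y u) - y (x u) + 15 *\<^sub>R x (x (y (x u))) - 15 *\<^sub>R x (y (x (x u))))"
    unfolding b4 by (rule ext) (simp add: lie_bracket_def l tri, simp add: algebra_simps bit0 bit1)
  show ?thesis
  proof -
    have "ad_poly x y u = (?b (?b (?b (?b (?b y))))) u + (5 *\<^sub>R (?b (?b (?b y))) u + 4 *\<^sub>R ?b y u)"
      by (simp add: ad_poly_def eval_nat_numeral)
    then show ?thesis
      by (simp only: b5, simp only: b3) (simp add: lie_bracket_def algebra_simps bit0 bit1)
  qed
qed

context K_structure
begin

lemma norm_kk_le: "norm (kk u w z) \<le> real d * norm u * norm w * norm z"
proof -
  have "norm (kk u w z) \<le> (\<Sum>i<d. norm (inner (T i w) z *\<^sub>R T i u))" unfolding kk_def by (rule norm_sum)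
  also have "\<dots> \<le> (\<Sum>i<d. norm u * norm w * norm z)"
  proof (rule sum_mono)
    fix i assume "i \<in> {..<d}"
    then have "\<bar>inner (T i w) z\<bar> * norm u \<le> (norm w * norm z) * norm u"
      using Cauchy_Schwarz_ineq2[of "T i w" z] by (intro mult_right_mono) (auto simp: norm_T)
    then show "norm (inner (T i w) z *\<^sub>R T i u) \<le> norm u * norm w * norm z"
      using \<open>i \<in> {..<d}\<close> by (simp add: norm_T mult_ac)
  qed
  finally show ?thesis by (simp add: mult_ac)
qed

text \<open>On a weakly null sequence the right multiplication in \<open>ad x\<close> is lost in the
  limit, so \<open>p(ad x)\<close> turns into left multiplication by \<open>p(x)\<close>.\<close>

lemma annihilating_poly:
  assumes x: "x \<in> u2 Js" and ann: "\<And>y. y \<in> u2 Js \<Longrightarrow> ad_poly x y = (\<lambda>u. 0)"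
  shows "x (x (x (x (x u)))) + (5 *\<^sub>R x (x (x u)) + 4 *\<^sub>R x u) = 0"
proof -
  obtain f :: "nat \<Rightarrow> 'h" where f: "\<And>n. norm (f n) = 1" "\<And>a. (\<lambda>n. inner a (f n)) \<longlonglongrightarrow> 0"
    "\<And>x. x \<in> u2 Js \<Longrightarrow> (\<lambda>n. x (f n)) \<longlonglongrightarrow> 0"
    using weakly_null_sequence by blast
  \<comment> \<open>Applying \<open>ad x\<close> keeps this property and replaces \<open>a\<close>
    by \<open>x a\<close>: the uniform bound sends \<open>Y n (x (f n))\<close> to 0, because
    \<open>x (f n)\<close> tends to 0.\<close>
  define P where "P Y a \<longleftrightarrow> (\<exists>K. \<forall>n u. norm (Y n u) \<le> K * norm u) \<and> (\<lambda>n. Y n (f n)) \<longlonglongrightarrow> a"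
    for Y :: "nat \<Rightarrow> 'h \<Rightarrow> 'h" and a
  obtain C where C: "\<And>u. norm (x u) \<le> norm u * C" "C > 0"
    using bounded_linear.pos_bounded[OF u2_bounded[OF x]] by blast
  have step: "P (\<lambda>n. lie_bracket x (Y n)) (x a)" if PY: "P Y a" for Y a
    unfolding P_def
  proof
    obtain K where K: "\<And>n u. norm (Y n u) \<le> K * norm u" using PY unfolding P_def by blast
    have K0: "K \<ge> 0"
      using order_trans[OF norm_ge_zero K[of 0 "f 0"]] f(1)[of 0] by simp
    have bd: "norm (lie_bracket x (Y n) u) \<le> (2 * K * C) * norm u" for n u
    proof -
      have "norm (x (Y n u)) \<le> K * norm u * C"
        using C K by (meson less_imp_le mult_right_mono order_trans)
      moreover have "norm (Y n (x u)) \<le> K * (norm u * C)"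
        using C K K0 by (meson mult_left_mono order_trans)
      ultimately show ?thesis
        using norm_triangle_ineq4[of "x (Y n u)" "Y n (x u)"] by (simp add: lie_bracket_def mult_ac)
    qed
    show "\<exists>K. \<forall>n u. norm (lie_bracket x (Y n) u) \<le> K * norm u" using bd by blast
    have "(\<lambda>n. Y n (x (f n))) \<longlonglongrightarrow> 0"
    proof (rule Lim_null_comparison)
      show "\<forall>\<^sub>F n in sequentially. norm (Y n (x (f n))) \<le> K * norm (x (f n))" using K by simp
      show "(\<lambda>n. K * norm (x (f n))) \<longlonglongrightarrow> 0"
        using tendsto_mult_left[OF tendsto_norm[OF f(3)[OF x]], of K] by simp
    qed
    moreover have "(\<lambda>n. x (Y n (f n))) \<longlonglongrightarrow> x a"
      using PY bounded_linear.tendsto[OF u2_bounded[OF x]] unfolding P_def by blast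
    ultimately show "(\<lambda>n. lie_bracket x (Y n) (f n)) \<longlonglongrightarrow> x a"
      unfolding lie_bracket_def using tendsto_diff by fastforce
  qed
  \<comment> \<open>\<open>kk u (f n)\<close> sends \<open>f n\<close> to \<open>u\<close>, and the
    other half of the wedge tends to 0 there.\<close>
  let ?Y = "\<lambda>n. wedge u (f n)"
  have P0: "P ?Y u" unfolding P_def
  proof
    have "norm (wedge u (f n) z) \<le> (2 * real d * norm u) * norm z" for n z
      using norm_triangle_ineq4[of "kk u (f n) z" "kk (f n) u z"] norm_kk_le[of u "f n" z] norm_kk_le[of "f n" u z]
      by (simp add: wedge_def f(1))
    then show "\<exists>K. \<forall>n z. norm (wedge u (f n) z) \<le> K * norm z" by blast
    have "(\<lambda>n. kk (f n) u (f n)) \<longlonglongrightarrow> 0"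
    proof (rule Lim_null_comparison)
      have "norm (kk (f n) u (f n)) \<le> (\<Sum>i<d. \<bar>inner (T i u) (f n)\<bar>)" for n
        unfolding kk_def by (rule order_trans[OF norm_sum]) (simp add: norm_T f(1))
      then show "\<forall>\<^sub>F n in sequentially. norm (kk (f n) u (f n)) \<le> (\<Sum>i<d. \<bar>inner (T i u) (f n)\<bar>)" by simp
      show "(\<lambda>n. \<Sum>i<d. \<bar>inner (T i u) (f n)\<bar>) \<longlonglongrightarrow> 0"
        by (intro tendsto_null_sum tendsto_rabs_zero f(2))
    qed
    then have "(\<lambda>n. u - kk (f n) u (f n)) \<longlonglongrightarrow> u - 0" by (intro tendsto_diff tendsto_const)
    then show "(\<lambda>n. wedge u (f n) (f n)) \<longlonglongrightarrow> u" by (simp add: wedge_def kk_self f(1))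
  qed
  note P1 = step[OF P0] note P3 = step[OF step[OF P1]] note P5 = step[OF step[OF P3]]
  have "(\<lambda>n. ad_poly x (?Y n) (f n)) \<longlonglongrightarrow> x (x (x (x (x u)))) + (5 *\<^sub>R x (x (x u)) + 4 *\<^sub>R x u)"
    unfolding ad_poly_def using P1 P3 P5 unfolding P_def
    by (intro tendsto_add tendsto_scaleR tendsto_const) (simp_all add: numeral_eq_Suc)
  moreover have "ad_poly x (?Y n) (f n) = 0" for n using ann[OF wedge_in_u2] by simp
  ultimately show ?thesis by (simp add: LIMSEQ_const_iff)
qed

text \<open>The vectors \<open>T i v\<close> form a real orthonormal set, and \<open>x\<close>
  commutes with the isometries \<open>T i\<close>, so Bessel counts each line \<open>d\<close>
  times.\<close>

lemma hs_lower_bound: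
  assumes x: "x \<in> u2 Js" and V: "finite V" "\<And>v. v \<in> V \<Longrightarrow> norm v = 1" "pairwise korth V"
  shows "real d * (\<Sum>v\<in>V. (norm (x v))\<^sup>2) \<le> hs_inner x x"
proof -
  let ?t = "\<lambda>(i, v). T i v"
  have inn: "inner (T i v) (T j w) = (if i = j \<and> v = w then 1 else 0)"
    if "i < d" "j < d" "v \<in> V" "w \<in> V" for i j v w
    using V that by (cases "v = w") (auto simp: inner_T_T korth_TT pairwise_def)
  have inj: "inj_on ?t ({..<d} \<times> V)"
  proof (rule inj_onI, clarsimp)
    fix i v j w assume a: "i < d" "v \<in> V" "j < d" "w \<in> V" "T i v = T j w"
    then show "i = j \<and> v = w" using inn[of i i v v] inn[of i j v w] by (auto split: if_splits)
  qed
  have "orthonormal (?t ` ({..<d} \<times> V))"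
    unfolding orthonormal_def pairwise_def orthogonal_def
    using V(2) inn by (auto simp: norm_T)
  from hs_Bessel[OF u2_skew_hs[OF x] this] V(1)
  have "(\<Sum>f\<in>?t ` ({..<d} \<times> V). (norm (x f))\<^sup>2) \<le> hs_inner x x" by simp
  also have "(\<Sum>f\<in>?t ` ({..<d} \<times> V). (norm (x f))\<^sup>2) = (\<Sum>(i, v)\<in>{..<d} \<times> V. (norm (x v))\<^sup>2)"
    by (subst sum.reindex[OF inj]) (auto simp: u2_T[OF x] norm_T intro!: sum.cong)
  also have "\<dots> = real d * (\<Sum>v\<in>V. (norm (x v))\<^sup>2)"
    by (simp add: sum.cartesian_product[symmetric])
  finally show ?thesis .
qed

lemma tripotent_if_small:
  assumes x: "x \<in> u2 Js" and ann: "\<And>y. y \<in> u2 Js \<Longrightarrow> ad_poly x y = (\<lambda>u. 0)"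
    and small: "hs_inner x x < 4 * real d"
  shows "x (x (x u)) = - x u"
proof (rule ccontr)
  assume ne: "x (x (x u)) \<noteq> - x u"
  \<comment> \<open>\<open>p(x) u = (x^2 + 4) w\<close>, so a nonzero \<open>w\<close> is an
    eigenvector of \<open>x^2\<close> for -4. Normalized, it is mapped to a vector of norm 2, which
    already uses up \<open>4 d\<close>.\<close>
  define w where "w = x (x (x u)) + x u"
  have w0: "w \<noteq> 0" using ne by (auto simp: w_def add_eq_0_iff2)
  have five: "5 *\<^sub>R a = a + 4 *\<^sub>R a" for a :: 'h
    using scaleR_left_distrib[of 1 4 a] by simp
  have "x (x w) + 4 *\<^sub>R w = 0"
    using annihilating_poly[OF x ann, of u]
    by (simp add: w_def u2_simps[OF x] scaleR_add_right five add_ac)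
  then have xw: "x (x w) = - (4 *\<^sub>R w)" by (simp add: add_eq_0_iff2)
  let ?v = "w /\<^sub>R norm w"
  have "x (x ?v) = - (4 *\<^sub>R ?v)" by (simp add: u2_simps[OF x] xw)
  then have "(norm (x ?v))\<^sup>2 = 4 * (norm ?v)\<^sup>2"
    using u2_inner[OF x, of ?v "x ?v"] by (simp only: power2_norm_eq_inner) simp
  then have "(norm (x ?v))\<^sup>2 = 4" using w0 by simp
  moreover have "real d * (\<Sum>v\<in>{?v}. (norm (x v))\<^sup>2) \<le> hs_inner x x"
    by (rule hs_lower_bound[OF x]) (use w0 in auto)
  ultimately show False using small by simp
qed

lemma norm_eigenvector:
  assumes "x \<in> u2 Js" "norm v = 1" "x (x v) = - v"
  shows "norm (x v) = 1"
proof -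
  have "inner (x v) (x v) = 1" using u2_inner[OF assms(1), of v "x v"] assms(2,3) by (simp add: norm_eq_1)
  then show ?thesis by (simp add: norm_eq_1)
qed

text \<open>Stands in for spectral theory: any nonzero value of \<open>x\<close> already lies in the
  eigenspace of \<open>x^2\<close> for -1.\<close>

lemma tripotent_eigenvector:
  assumes x: "x \<in> u2 Js" and tri: "\<And>u. x (x (x u)) = - x u" and "x u \<noteq> 0"
  shows "norm (x u /\<^sub>R norm (x u)) = 1" "x (x (x u /\<^sub>R norm (x u))) = - (x u /\<^sub>R norm (x u))"
  using assms(3) by (simp_all add: u2_simps[OF x] tri)

text \<open>The line of \<open>v\<close> alone accounts for all of \<open>hs_inner x x\<close>,
  which leaves nothing for a line orthogonal to it.\<close>

lemma minimal_support:
  assumes x: "x \<in> u2 Js" and hs: "hs_inner x x = real d" and v: "norm v = 1" "x (x v) = - v"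
    and z: "korth v z"
  shows "x z = 0"
proof (cases "z = 0")
  case True then show ?thesis by (simp add: u2_simps[OF x])
next
  case False
  let ?z = "z /\<^sub>R norm z"
  have k: "korth v ?z" using z by (rule korth_scale)
  have "real d * (\<Sum>w\<in>{v, ?z}. (norm (x w))\<^sup>2) \<le> hs_inner x x"
    by (rule hs_lower_bound[OF x]) (use v False k korth_sym[OF k] in \<open>auto simp: pairwise_insert\<close>)
  moreover have "v \<noteq> ?z" using korth_inner[OF k] v(1) by (metis inner_eq_zero_iff norm_zero zero_neq_one)
  ultimately have "real d * (1 + (norm (x ?z))\<^sup>2) \<le> real d"
    using norm_eigenvector[OF x v] hs by simp
  then have "x ?z = 0" using d_pos by (simp add: distrib_left mult_le_0_iff)
  then show ?thesis using False by (simp add: u2_simps[OF x])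
qed

lemma line_supported:
  assumes x: "x \<in> u2 Js" and v: "norm v = 1" "x (x v) = - v" and supp: "\<And>z. korth v z \<Longrightarrow> x z = 0"
  shows "x t = kk (x v) v t" "x (x t) = - kk v v t" "x (x (x t)) = - x t" "korth v z \<Longrightarrow> inner (x t) z = 0"
proof -
  have r: "korth v (t - kk v v t)" for t by (rule korth_residual[OF v(1)])
  show 1: "x t = kk (x v) v t" for t
    using supp[OF r, of t] u2_kk[OF x, of v v t] by (simp add: u2_simps[OF x])
  show 2: "x (x t) = - kk v v t" for t
    using v(2) kk_scale(1)[of "-1" v v t] by (simp add: 1[of t] u2_kk[OF x])
  show "x (x (x t)) = - x t"
    by (simp only: 2 u2_simps[OF x] u2_kk[OF x]) (simp only: 1[symmetric])
  show "korth v z \<Longrightarrow> inner (x t) z = 0" using u2_inner[OF x, of t z] supp by simp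
qed

text \<open>\<open>(ad x)^2\<close> is -1 exactly on the blocks between \<open>K v\<close> and its
  complement: its eigenvalues are among 0 and -4 on the block of the line itself, and it vanishes on
  the block of the complement.\<close>

lemma line_eigenspace:
  assumes x: "x \<in> u2 Js" and v: "norm v = 1" "x (x v) = - v" and supp: "\<And>z. korth v z \<Longrightarrow> x z = 0"
    and c: "c \<in> u2 Js"
  shows "lie_bracket x (lie_bracket x c) = (\<lambda>u. - c u) \<longleftrightarrow> (\<exists>u. korth v u \<and> c = wedge u v)"
proof
  assume "lie_bracket x (lie_bracket x c) = (\<lambda>u. - c u)"
  from fun_cong[OF this]
  have eq: "x (x (c t)) - 2 *\<^sub>R x (c (x t)) + c (x (x t)) = - c t" for t
    by (simp add: lie_bracket_def u2_simps[OF x] u2_simps[OF c] algebra_simps scaleR_2)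
  note ls = line_supported[OF x v supp]
  \<comment> \<open>\<open>e1\<close> and \<open>e2\<close> evaluate the equation at
    \<open>v\<close> and at \<open>x v\<close>. Together they give \<open>A = 4 A\<close> for
    \<open>A = x (x (c v))\<close>, which is minus the component of \<open>c v\<close> on the
    line.\<close>
  have e1: "x (x (c v)) = 2 *\<^sub>R x (c (x v))"
    using eq[of v] by (simp add: v(2) u2_simps[OF c] u2_simps[OF x])
  have e2: "x (x (c (x v))) = - 2 *\<^sub>R x (c v)"
    using eq[of "x v"] by (simp add: v(2) ls(3) u2_simps[OF c] u2_simps[OF x] add_eq_0_iff2)
  have "x (x (x (c (x v)))) = - 2 *\<^sub>R x (x (c v))" by (simp only: e2 u2_simps[OF x])
  then have "x (c (x v)) = 2 *\<^sub>R x (x (c v))" by (simp add: ls(3))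
  with e1 have "x (x (c v)) = 4 *\<^sub>R x (x (c v))" by simp
  then have "3 *\<^sub>R x (x (c v)) = 0"
    using scaleR_left_distrib[of 1 3 "x (x (c v))"] by simp
  then have "x (x (c v)) = 0" by simp
  then have "kk v v (c v) = 0" by (simp add: ls(2))
  then have k: "korth v (c v)" using korth_residual[OF v(1), of "c v"] by simp
  have "inner (c z) r = 0" if "korth v z" "korth v r" for z r
  proof -
    \<comment> \<open>So \<open>c z\<close> lies in the range of \<open>x\<close>, which is the
      line, and is orthogonal to \<open>r\<close>.\<close>
    have "x (x (c z)) = - c z"
      using eq[of z] supp[OF that(1)] by (simp add: u2_simps[OF c] u2_simps[OF x])
    then show ?thesis using ls(4)[OF _ that(2), of "x (c z)"] by simp
  qed
  from wedge_characterization[OF c v(1) k this] k show "\<exists>u. korth v u \<and> c = wedge u v" by blast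
next
  assume "\<exists>u. korth v u \<and> c = wedge u v"
  then obtain u where u: "korth v u" "c = wedge u v" by blast
  have 1: "lie_bracket x (wedge u w) = wedge u (x w)" for w
    by (simp add: bracket_wedge[OF x] supp[OF u(1)] wedge_0)
  have "wedge u (- v) = (\<lambda>z. - wedge u v z)" using wedge_scale(2)[of u "-1" v] by simp
  then show "lie_bracket x (lie_bracket x c) = (\<lambda>u. - c u)"
    by (simp add: u(2) 1 v(2))
qed

section \<open>From the wedges with one vector to the implementing operator\<close>

lemma agree_on_wedges:
  assumes \<phi>: "\<phi> \<in> Aut Js" and g: "twisted s g" and v: "norm v = 1"
    and eq: "\<And>u. \<phi> (wedge u v) = Ad g (wedge u v)" and x: "x \<in> u2 Js"
  shows "\<phi> x = Ad g x"
proof -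
  let ?\<chi> = "Ad g"
  note \<chi> = Ad_Aut[OF g]
  have perp: "\<phi> (wedge w a) = ?\<chi> (wedge w a)" if "korth v a" "korth v w" for a w
  proof -
    let ?k = "kk v a w"
    have "wedge a v w = - ?k" "wedge a v v = a"
      using that korth_sym by (simp_all add: wedge_def kk_korth kk_self v)
    \<comment> \<open>The bracket of two wedges with \<open>v\<close> is the wedge of their other
      factors, up to a wedge with \<open>v\<close> that \<open>eq\<close> already covers.\<close>
    then have br: "lie_bracket (wedge a v) (wedge w v) = (\<lambda>z. wedge (- ?k) v z + wedge w a z)"
      by (simp add: bracket_wedge[OF wedge_in_u2])
    have eq1: "wedge w a = (\<lambda>z. lie_bracket (wedge a v) (wedge w v) z + wedge ?k v z)"
      using wedge_scale(1)[of "-1" ?k v] by (simp add: br)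
    have "\<phi> (wedge w a) = (\<lambda>z. lie_bracket (\<phi> (wedge a v)) (\<phi> (wedge w v)) z + \<phi> (wedge ?k v) z)"
      unfolding eq1 by (simp add: Aut_add[OF \<phi>] Aut_bracket[OF \<phi>] u2_bracket wedge_in_u2)
    also have "\<dots> = (\<lambda>z. lie_bracket (?\<chi> (wedge a v)) (?\<chi> (wedge w v)) z + ?\<chi> (wedge ?k v) z)"
      by (simp add: eq)
    also have "\<dots> = ?\<chi> (wedge w a)"
      unfolding eq1 by (simp add: Aut_add[OF \<chi>] Aut_bracket[OF \<chi>] u2_bracket wedge_in_u2)
    finally show ?thesis .
  qed
  have all_vperp: "\<phi> (wedge w a) = ?\<chi> (wedge w a)" if "korth v a" for a w
  proof -
    let ?p = "kk v v w" and ?r = "w - kk v v w"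
    \<comment> \<open>A scalar attached to \<open>v\<close> moves to the other factor, so the
      component along the line again yields a wedge with \<open>v\<close>.\<close>
    have "\<exists>c. wedge ?p a = wedge c v"
    proof -
      have "wedge (T i v) a = wedge ((- sg i) *\<^sub>R T i a) v" if "i < d" for i
        unfolding wedge_scale(1)
        by (rule ext) (use that wedge_T_right[OF that, of a v] in
          \<open>simp add: wedge_minus_swap[of "T i v"]\<close>)
      then have "wedge (\<Sum>i<n. inner (T i v) w *\<^sub>R T i v) a = wedge (\<Sum>i<n. - (inner (T i v) w * sg i) *\<^sub>R T i a) v"
        if "n \<le> d" for n
        using that by (induction n) (auto simp: wedge_0 wedge_add(1) wedge_scale(1) scaleR_minus_left[symmetric] simp del: scaleR_minus_left)
      from this[of d] show ?thesis unfolding kk_def by auto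
    qed
    then have p: "\<phi> (wedge ?p a) = ?\<chi> (wedge ?p a)" using eq by metis
    have r: "\<phi> (wedge ?r a) = ?\<chi> (wedge ?r a)" by (rule perp[OF that korth_residual[OF v]])
    have eq2: "wedge w a = (\<lambda>z. wedge ?p a z + wedge ?r a z)" using wedge_add(1)[of ?p ?r a] by simp
    show ?thesis unfolding eq2 by (simp add: Aut_add[OF \<phi>] Aut_add[OF \<chi>] wedge_in_u2 p r)
  qed
  have all: "\<phi> (wedge w a) = ?\<chi> (wedge w a)" for a w
  proof -
    let ?p = "kk v v a" and ?r = "a - kk v v a"
    have "\<exists>c. wedge w ?p = wedge c v"
    proof -
      have "wedge w (\<Sum>i<n. inner (T i v) a *\<^sub>R T i v) = wedge (\<Sum>i<n. (inner (T i v) a * sg i) *\<^sub>R T i w) v"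
        if "n \<le> d" for n
        using that by (induction n) (auto simp: wedge_0 wedge_add wedge_scale wedge_T_right)
      from this[of d] show ?thesis unfolding kk_def by auto
    qed
    then have p: "\<phi> (wedge w ?p) = ?\<chi> (wedge w ?p)" using eq by metis
    have r: "\<phi> (wedge w ?r) = ?\<chi> (wedge w ?r)" by (rule all_vperp[OF korth_residual[OF v]])
    have eq2: "wedge w a = (\<lambda>z. wedge w ?p z + wedge w ?r z)" using wedge_add(2)[of w ?p ?r] by simp
    show ?thesis unfolding eq2 by (simp add: Aut_add[OF \<phi>] Aut_add[OF \<chi>] wedge_in_u2 p r)
  qed
  \<comment> \<open>Both maps are isometric and agree on wedges, and every wedge is
    \<open>Ad g\<close> of a wedge; hence the difference of their values is orthogonal to all
    wedges.\<close>
  let ?y = "\<lambda>u. \<phi> x u - ?\<chi> x u"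
  have y: "?y \<in> u2 Js" by (rule u2_diff) (simp_all add: Aut_u2 \<phi> \<chi> x)
  have "hs_inner ?y (wedge u w) = 0" for u w
  proof -
    let ?w = "wedge (inv g u) (inv g w)"
    have w: "wedge u w = ?\<chi> ?w" by (simp add: Ad_wedge[OF g] twisted_simps[OF g])
    have "hs_inner ?y (wedge u w) = hs_inner (\<phi> x) (\<phi> ?w) - hs_inner (?\<chi> x) (?\<chi> ?w)"
      by (simp add: hs_inner_diff_left Aut_u2 \<phi> \<chi> x wedge_in_u2 w all)
    then show ?thesis by (simp add: Aut_hs \<phi> \<chi> x wedge_in_u2)
  qed
  from eq_0_if_orthogonal_wedges[OF y this] show ?thesis by (simp add: fun_eq_iff)
qed

lemma norm_sum_T:
  assumes "norm v = 1"
  shows "(norm (\<Sum>i<d. c i *\<^sub>R T i v))\<^sup>2 = (\<Sum>i<d. (c i)\<^sup>2)"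
proof -
  have "inner (\<Sum>i<d. c i *\<^sub>R T i v) (\<Sum>j<d. c j *\<^sub>R T j v) = (\<Sum>i<d. \<Sum>j<d. if i = j then c i * c j else 0)"
    unfolding inner_sum_left inner_sum_right by (intro sum.cong) (auto simp: inner_T_T assms)
  also have "\<dots> = (\<Sum>i<d. (c i)\<^sup>2)" by (simp add: power2_eq_square)
  finally show ?thesis by (simp add: power2_norm_eq_inner)
qed

lemma linear_decomposition:
  assumes L: "linear L"
  shows "L z = (\<Sum>i<d. inner (T i v) z *\<^sub>R L (T i v)) + L (z - kk v v z)"
proof -
  have "L z = L (kk v v z) + L (z - kk v v z)" by (simp add: linear_add[OF L, symmetric])
  also have "L (kk v v z) = (\<Sum>i<d. inner (T i v) z *\<^sub>R L (T i v))"
    by (simp add: kk_def linear_sum[OF L] linear_scale[OF L])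
  finally show ?thesis .
qed

text \<open>Makes the scalars visible in the Lie algebra: this bracket multiplies \<open>u\<close>
  by \<open>T i\<close>, up to the factor -2. As \<phi> respects brackets, the map it induces on the
  complement of the line must respect scalars up to the twist.\<close>

lemma bracket_line_wedge:
  assumes "0 < i" "i < d" "norm v = 1" "korth v u"
  shows "lie_bracket (wedge (T i v) v) (wedge u v) = (\<lambda>z. - 2 *\<^sub>R wedge (T i u) v z)"
proof -
  have 1: "wedge (T i v) v u = 0"
    using assms korth_T[OF assms(4,2)] by (simp add: wedge_def kk_korth)
  have 2: "wedge (T i v) v v = 2 *\<^sub>R T i v"
    using kk_T_left[OF assms(2), of v v v] assms by (simp add: wedge_def kk_self sg_def scaleR_2)
  show ?thesis
    using assms by (simp add: bracket_wedge[OF wedge_in_u2] 1 2 wedge_0 wedge_scale wedge_T_right sg_def)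
qed

text \<open>\<open>line\<close> prescribes \<phi> inside the algebra of the line of
  \<open>v\<close>, \<open>fwd\<close> and \<open>bwd\<close> match the off-diagonal parts at
  \<open>v\<close> and \<open>v'\<close>, and the operator is assembled from these two pieces.
  \<open>s_mult\<close> makes the signs compatible with products of basis scalars.\<close>

lemma implemented_by_twisted:
  assumes \<phi>: "\<phi> \<in> Aut Js" and v: "norm v = 1" and v': "norm v' = 1"
    and s0: "s 0 = 1" and ss: "\<And>i. i < d \<Longrightarrow> s i * s i = 1"
    and s_mult: "\<And>i j. i < d \<Longrightarrow> j < d \<Longrightarrow> \<exists>k<d. \<exists>\<epsilon>. (\<forall>u. T i (T j u) = \<epsilon> *\<^sub>R T k u) \<and> s i * s j = s k"
    and line: "\<And>i. 0 < i \<Longrightarrow> i < d \<Longrightarrow> \<phi> (wedge (T i v) v) = (\<lambda>z. s i *\<^sub>R wedge (T i v') v' z)"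
    and fwd: "\<And>u. korth v u \<Longrightarrow> \<exists>u'. korth v' u' \<and> \<phi> (wedge u v) = wedge u' v'"
    and bwd: "\<And>u'. korth v' u' \<Longrightarrow> \<exists>u. korth v u \<and> \<phi> (wedge u v) = wedge u' v'"
  shows "\<exists>g. twisted s g \<and> (\<forall>x\<in>u2 Js. \<phi> x = Ad g x)"
proof -
  \<comment> \<open>Evaluation at \<open>v'\<close> recovers \<open>u'\<close> from
    \<open>wedge u' v'\<close>. Defined for all \<open>u\<close>, it is linear before anything is
    known about its values on the complement.\<close>
  define h where "h u = \<phi> (wedge u v) v'" for u
  have h_lin: "linear h"
    unfolding h_def
    by (rule linearI) (simp_all add: wedge_add wedge_scale Aut_add[OF \<phi>] Aut_scale[OF \<phi>] wedge_in_u2)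
  have h: "korth v' (h u)" "\<phi> (wedge u v) = wedge (h u) v'" if "korth v u" for u
  proof -
    obtain u' where u': "korth v' u'" "\<phi> (wedge u v) = wedge u' v'" using fwd[OF \<open>korth v u\<close>] by blast
    moreover have "h u = u'" unfolding h_def u'(2) by (rule wedge_at[OF v' korth_sym[OF u'(1)]])
    ultimately show "korth v' (h u)" "\<phi> (wedge u v) = wedge (h u) v'" by auto
  qed
  have h_norm: "norm (h u) = norm u" if u: "korth v u" for u
  proof -
    have "hs_inner (wedge (h u) v') (wedge (h u) v') = hs_inner (wedge u v) (wedge u v)"
      using Aut_hs[OF \<phi> wedge_in_u2 wedge_in_u2, of u v u v] by (simp add: h(2)[OF u])
    then show ?thesis
      using u h(1)[OF u] v v' d_pos
      by (simp add: hs_inner_wedge wedge_in_u2 wedge_at korth_sym norm_eq_sqrt_inner)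
  qed
  have h_surj: "\<exists>u. korth v u \<and> h u = u'" if "korth v' u'" for u'
  proof -
    obtain u where u: "korth v u" "\<phi> (wedge u v) = wedge u' v'" using bwd[OF \<open>korth v' u'\<close>] by blast
    moreover have "h u = u'" unfolding h_def u(2) by (rule wedge_at[OF v' korth_sym[OF that]])
    ultimately show ?thesis by blast
  qed
  have h_T: "h (T i u) = s i *\<^sub>R T i (h u)" if u: "korth v u" and i: "i < d" for i u
  proof (cases "i = 0")
    case True then show ?thesis by (simp add: T_0 s0)
  next
    case False
    then have i0: "0 < i" by simp
    have "\<phi> (lie_bracket (wedge (T i v) v) (wedge u v)) = (\<lambda>z. -2 *\<^sub>R wedge (h (T i u)) v' z)"
      using Aut_scale[OF \<phi> wedge_in_u2, of "-2" "T i u" v]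
      by (simp add: bracket_line_wedge[OF i0 i v u] h(2)[OF korth_T2[OF u i]])
    moreover have "\<phi> (lie_bracket (wedge (T i v) v) (wedge u v))
        = lie_bracket (\<lambda>z. s i *\<^sub>R wedge (T i v') v' z) (wedge (h u) v')"
      by (simp add: Aut_bracket[OF \<phi>] wedge_in_u2 line[OF i0 i] h(2)[OF u])
    moreover have "\<dots> = (\<lambda>z. s i *\<^sub>R lie_bracket (wedge (T i v') v') (wedge (h u) v') z)"
      by (simp add: lie_bracket_def u2_simps[OF wedge_in_u2] scaleR_diff_right)
    ultimately have "(\<lambda>z. -2 *\<^sub>R wedge (h (T i u)) v' z) = (\<lambda>z. s i *\<^sub>R (-2 *\<^sub>R wedge (T i (h u)) v' z))"
      by (simp only: bracket_line_wedge[OF i0 i v' h(1)[OF u]])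
    from fun_cong[OF this, of v'] have "2 *\<^sub>R h (T i u) = 2 *\<^sub>R (s i *\<^sub>R T i (h u))"
      using h(1)[OF u] h(1)[OF korth_T2[OF u i]] i
      by (simp add: wedge_at[OF v'] korth_sym korth_T scaleR_left_commute[of _ 2])
    then show ?thesis by (simp only: scaleR_cancel_left) simp
  qed
  \<comment> \<open>The twist and \<open>g v = v'\<close> leave no choice on the line; on the
    complement \<open>h\<close> is the only candidate.\<close>
  define g where "g z = (\<Sum>i<d. inner (T i v) z *\<^sub>R s i *\<^sub>R T i v') + h (z - kk v v z)" for z
  have g_lin: "linear g"
    unfolding g_def
    by (rule linearI)
      (simp_all add: inner_add_right scaleR_add_left algebra_simps sum.distrib kk_add kk_scale linear_add[OF h_lin]
        linear_diff[OF h_lin] linear_scale[OF h_lin] scaleR_diff_right scaleR_add_right scaleR_sum_right)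
  have g_line: "g (T j v) = s j *\<^sub>R T j v'" if j: "j < d" for j
  proof -
    have "kk v v (T j v) = T j v" by (simp add: kk_T j kk_self v)
    moreover have "(\<Sum>i<d. inner (T i v) (T j v) *\<^sub>R s i *\<^sub>R T i v') = (\<Sum>i<d. if i = j then s j *\<^sub>R T j v' else 0)"
      using j v by (intro sum.cong) (auto simp: inner_T_T)
    ultimately show ?thesis using j by (simp add: g_def linear_0[OF h_lin])
  qed
  have g_perp: "g u = h u" if "korth v u" for u
  proof -
    have "(\<Sum>i<d. inner (T i v) u *\<^sub>R s i *\<^sub>R T i v') = 0"
      using that by (intro sum.neutral) (auto simp: korth_def)
    then show ?thesis by (simp add: g_def kk_korth that)
  qed
  have g_norm: "norm (g z) = norm z" for z
  proof -
    let ?r = "z - kk v v z"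
    let ?q = "\<Sum>i<d. (inner (T i v) z * s i) *\<^sub>R T i v'"
    have r: "korth v ?r" by (rule korth_residual[OF v])
    have sq: "(s i)\<^sup>2 = 1" if "i < d" for i using ss[OF that] by (simp add: power2_eq_square)
    have "inner ?q (h ?r) = 0" 
      unfolding inner_sum_left using korthD[OF h(1)[OF r]] by simp
    then have "(norm (g z))\<^sup>2 = (norm ?q)\<^sup>2 + (norm ?r)\<^sup>2"
      using h_norm[OF r] by (simp add: g_def norm_add_Pythagorean orthogonal_def)
    also have "(norm ?q)\<^sup>2 = (\<Sum>i<d. (inner (T i v) z)\<^sup>2)"
      by (simp add: norm_sum_T[OF v'] power_mult_distrib sq)
    also have "\<dots> = (norm (kk v v z))\<^sup>2"
      unfolding kk_def by (rule norm_sum_T[OF v, symmetric])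
    also have "(norm (kk v v z))\<^sup>2 + (norm ?r)\<^sup>2 = (norm (kk v v z + ?r))\<^sup>2"
      by (rule norm_add_Pythagorean[symmetric]) (simp add: orthogonal_def kk_range[OF r])
    finally show ?thesis by simp
  qed
  have g_inner: "inner (g a) (g b) = inner a b" for a b
    by (simp add: inner_polarization[of "g a"] inner_polarization[of a] linear_add[OF g_lin, symmetric] g_norm)
  have g_surj: "\<exists>z. g z = y" for y
  proof -
    obtain u where u: "korth v u" "h u = y - kk v' v' y" using h_surj[OF korth_residual[OF v']] by blast
    have "g (\<Sum>i<d. inner (T i v') y *\<^sub>R s i *\<^sub>R T i v) = (\<Sum>i<d. inner (T i v') y *\<^sub>R s i *\<^sub>R s i *\<^sub>R T i v')"
      by (simp add: linear_sum[OF g_lin] linear_scale[OF g_lin] g_line mult.assoc)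
    also have "\<dots> = kk v' v' y" unfolding kk_def by (rule sum.cong) (simp_all add: ss mult.assoc)
    finally have "g ((\<Sum>i<d. inner (T i v') y *\<^sub>R s i *\<^sub>R T i v) + u) = y"
      by (simp add: linear_add[OF g_lin] g_perp[OF u(1)] u(2))
    then show ?thesis by blast
  qed
  have g_inj: "inj g"
    by (rule linear_injective_0[OF g_lin, THEN iffD2]) (metis g_norm norm_eq_zero)
  have g_T: "g (T j z) = s j *\<^sub>R T j (g z)" if j: "j < d" for j z
  proof -
    \<comment> \<open>On the line the twisting rule is the multiplicativity of \<open>s\<close>; on
      the complement it is \<open>h_T\<close>.\<close>
    have lines: "g (T j (T i v)) = s j *\<^sub>R T j (g (T i v))" if i: "i < d" for i
    proof -
      obtain k \<epsilon> where k: "k < d" "\<And>u. T j (T i u) = \<epsilon> *\<^sub>R T k u" "s j * s i = s k"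
        using s_mult[OF j i] by blast
      have "g (T j (T i v)) = (s j * s i) *\<^sub>R T j (T i v')"
        by (simp add: k linear_scale[OF g_lin] g_line[OF k(1)])
      also have "\<dots> = s j *\<^sub>R T j (g (T i v))" by (simp add: g_line[OF i] T_simps j)
      finally show ?thesis .
    qed
    have "linear (\<lambda>z. g (T j z))" "linear (\<lambda>z. s j *\<^sub>R T j (g z))"
      using j by (auto intro!: linearI simp: T_simps linear_add[OF g_lin] linear_scale[OF g_lin] scaleR_add_right)
    moreover have "g (T j r) = s j *\<^sub>R T j (g r)" if "korth v r" for r
      using that by (simp add: g_perp korth_T2 j h_T)
    ultimately show ?thesis
      using linear_decomposition[of "\<lambda>z. g (T j z)" z v] linear_decomposition[of "\<lambda>z. s j *\<^sub>R T j (g z)" z v]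
        korth_residual[OF v, of z] by (simp add: lines)
  qed
  have tw: "twisted s g"
    unfolding twisted_def orth_op_def bij_def surj_def
    using g_inj g_surj g_lin g_inner ss g_T by metis
  have gv: "g v = v'" using g_line[OF d_pos] by (simp add: T_0 s0)
  have agree: "\<phi> (wedge u v) = Ad g (wedge u v)" for u
  proof
    fix t
    have lin: "linear (\<lambda>u. \<phi> (wedge u v) t)" "linear (\<lambda>u. wedge (g u) v' t)"
      by (auto intro!: linearI simp: wedge_add wedge_scale Aut_add[OF \<phi>] Aut_scale[OF \<phi>] wedge_in_u2
          linear_add[OF g_lin] linear_scale[OF g_lin])
    have lines: "\<phi> (wedge (T i v) v) t = wedge (g (T i v)) v' t" if i: "i < d" for i
    proof (cases "i = 0")
      case True
      have "wedge v v = (\<lambda>z. 0)" "wedge v' v' = (\<lambda>z. 0)" by (auto simp: wedge_def)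
      then show ?thesis using True by (simp add: T_0 gv Aut_zero[OF \<phi>])
    next
      case False
      then show ?thesis using i by (simp add: line g_line wedge_scale)
    qed
    have "\<phi> (wedge u v) t = wedge (g u) v' t"
      using linear_decomposition[OF lin(1), of u v] linear_decomposition[OF lin(2), of u v]
        h(2)[OF korth_residual[OF v, of u]] korth_residual[OF v, of u] by (simp add: lines g_perp)
    then show "\<phi> (wedge u v) t = Ad g (wedge u v) t" by (simp add: Ad_wedge[OF tw] gv)
  qed
  show ?thesis using tw agree_on_wedges[OF \<phi> tw v agree] by blast
qed

section \<open>The commutant of the wedges\<close>

text \<open>Computes the kernel of \<open>Ad\<close> before the condition \<open>g \<in> G\<close>
  is used. For a merely real linear \<open>g\<close> all combinations of the \<open>T i\<close> do
  occur, since every \<open>T i\<close> commutes with the wedges.\<close>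

lemma commutant_of_wedges:
  assumes g: "linear g" and comm: "\<And>u w z. g (wedge u w z) = wedge u w (g z)"
  shows "\<exists>c. \<forall>u. g u = (\<Sum>i<d. c i *\<^sub>R T i u)"
proof -
  have line: "inner (g v) z = 0" if v: "norm v = 1" and z: "korth v z" for v z
  proof (cases "z = 0")
    case False
    let ?z = "z /\<^sub>R norm z"
    have k: "korth v ?z" using z by (rule korth_scale)
    have "pairwise korth {v, ?z}" using k korth_sym[OF k] by (auto simp: pairwise_insert)
    moreover have "norm w = 1" if "w \<in> {v, ?z}" for w using that v False by auto
    ultimately obtain y where y: "norm y = 1" "\<And>w. w \<in> {v, ?z} \<Longrightarrow> korth w y"
      using exists_unit_korth[of "{v, ?z}"] by blast
    have y2: "korth v y" "korth ?z y" using y(2) by simp_all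
    \<comment> \<open>\<open>v\<close> is the value of \<open>wedge v y\<close> at \<open>y\<close>,
      so \<open>g v\<close> lies in the sum of the lines of \<open>v\<close> and \<open>y\<close>,
      both orthogonal to \<open>z\<close>.\<close>
    have "g v = kk v y (g y) - kk y v (g y)"
      using comm[of v y y] y(1) y2 by (simp add: wedge_at wedge_def[of v y "g y"])
    then have "inner (g v) ?z = 0"
      using kk_range[OF k, of y "g y"] kk_range[OF korth_sym[OF y2(2)], of v "g y"]
      by (simp only: inner_diff_left diff_self)
    then show ?thesis using False by simp
  qed simp
  have gv: "kk v v (g v) = g v" if "norm v = 1" for v
    by (rule kk_fixed_range[OF that line[OF that]])
  have perp: "g u = (\<Sum>i<d. inner (T i v) (g v) *\<^sub>R T i u)" if v: "norm v = 1" and u: "korth v u" for u v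
  proof -
    have "g u = kk u v (g v) - kk v u (g v)"
      using comm[of u v v] v u by (simp add: wedge_at korth_sym wedge_def[of u v "g v"])
    also have "kk v u (g v) = 0"
      using kk_korth[OF kk_range_korth[OF u, of v "g v"]] by (simp add: gv[OF v])
    finally show ?thesis by (simp add: kk_def)
  qed
  obtain v :: 'h where v: "norm v = 1"
    by (rule exists_unit_korth[of "{}"]) auto
  obtain e where e: "norm e = 1" "korth v e"
    using exists_unit_korth[of "{v}"] v
    by (metis finite.emptyI finite.insertI pairwise_singleton singletonD singletonI)
  let ?c = "\<lambda>i. inner (T i v) (g v)"
  \<comment> \<open>The coefficients found at \<open>v\<close> are valid on its complement. A unit
    vector \<open>e\<close> there has the same coefficients, and its complement contains the line of
    \<open>v\<close>.\<close>
  have ce: "inner (T i e) (g e) = ?c i" if i: "i < d" for i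
  proof -
    have "inner (T i e) (g e) = (\<Sum>j<d. ?c j * inner (T i e) (T j e))"
      by (subst perp[OF v e(2)]) (simp add: inner_sum_right)
    also have "\<dots> = (\<Sum>j<d. if j = i then ?c i else 0)"
      using i e(1) by (intro sum.cong) (auto simp: inner_T_T)
    finally show ?thesis using i by simp
  qed
  have "g u = (\<Sum>i<d. ?c i *\<^sub>R T i u)" for u
  proof -
    have lin: "linear (\<lambda>u. \<Sum>i<d. ?c i *\<^sub>R T i u)"
      by (rule linearI) (simp_all add: T_simps scaleR_add_right sum.distrib scaleR_sum_right mult.commute)
    have "g (T j v) = (\<Sum>i<d. ?c i *\<^sub>R T i (T j v))" if "j < d" for j
      using perp[OF e(1), of "T j v"] korth_T2[OF korth_sym[OF e(2)] that] by (simp add: ce)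
    then show ?thesis
      using linear_decomposition[OF g, of u v] linear_decomposition[OF lin, of u v]
        perp[OF v korth_residual[OF v, of u]] by simp
  qed
  then show ?thesis by (intro exI[of _ ?c]) blast
qed

end

section \<open>Double brackets with a tripotent\<close>

lemma real_inner_eqI:
  fixes a b :: "'a::real_inner"
  shows "(\<And>w. inner a w = inner b w) \<Longrightarrow> a = b"
  using vector_eq_rdot by blast

text \<open>Left and right multiplication by \<open>x\<close> have eigenvalues among 0,
  \<open>i\<close> and \<open>-i\<close>; their difference is \<open>2 i\<close> or
  \<open>-2 i\<close> only if they are opposite and nonzero.\<close>

lemma tripotent_ad4:
  fixes x y :: "'a::real_inner \<Rightarrow> 'a"
  assumes x: "linear x" and y: "linear y" and tri: "\<And>u. x (x (x u)) = - x u"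
    and ad: "lie_bracket x (lie_bracket x y) = (\<lambda>u. - 4 *\<^sub>R y u)"
  shows "x (x (y u)) = - y u" "x (y u) = - y (x u)"
proof -
  note l = linear_add[OF x] linear_diff[OF x] linear_scale[OF x] linear_neg[OF x] linear_neg[OF y]
  have E: "x (x (y t)) - 2 *\<^sub>R x (y (x t)) + y (x (x t)) = - 4 *\<^sub>R y t" for t
    using fun_cong[OF ad, of t] by (simp add: lie_bracket_def l algebra_simps scaleR_2)
  have 1: "x (y (x t)) = x (x (y (x (x t))))" for t
  \<comment> \<open>Testing against \<open>w\<close> turns vector equations into real ones, whose
    coefficients linear arithmetic can cancel.\<close>
  proof (rule real_inner_eqI)
    fix w
    have "x (x (x (y (x t))) - 2 *\<^sub>R x (y (x (x t))) + y (x (x (x t)))) = x (- 4 *\<^sub>R y (x t))"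
      by (simp only: E)
    from arg_cong[OF this, of "\<lambda>a. inner a w"]
    show "inner (x (y (x t))) w = inner (x (x (y (x (x t))))) w"
      by (simp add: l tri inner_add_left inner_diff_left)
  qed
  have 2: "x (x (y t)) = - x (y (x t))" for t
  proof (rule real_inner_eqI)
    fix w
    have "x (x (x (x (y t)) - 2 *\<^sub>R x (y (x t)) + y (x (x t)))) = x (x (- 4 *\<^sub>R y t))"
      by (simp only: E)
    from arg_cong[OF this, of "\<lambda>a. inner a w"]
    show "inner (x (x (y t))) w = inner (- x (y (x t))) w"
      by (simp add: l tri inner_add_left inner_diff_left 1[symmetric])
  qed
  have 3: "y (x (x t)) = - x (y (x t))" for t
  proof (rule real_inner_eqI)
    fix w
    from arg_cong[OF E[of "x (x t)"], of "\<lambda>a. inner a w"]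
    show "inner (y (x (x t))) w = inner (- x (y (x t))) w"
      by (simp add: l tri inner_add_left inner_diff_left 1[symmetric])
  qed
  have 4: "x (y (x t)) = y t" for t
  proof (rule real_inner_eqI)
    fix w
    from arg_cong[OF E[of t], of "\<lambda>a. inner a w"]
    show "inner (x (y (x t))) w = inner (y t) w"
      by (simp add: 2 3 inner_add_left inner_diff_left)
  qed
  show "x (x (y u)) = - y u" by (simp add: 2 4)
  have "x (y u) = x (x (y (x u)))" by (simp add: 4)
  also have "\<dots> = - y (x u)" by (rule trans[OF 2[of "x u"]]) (simp only: 4)
  finally show "x (y u) = - y (x u)" .
qed

text \<open>A difference \<open>i\<close> or \<open>-i\<close> forces exactly one of the two
  eigenvalues to vanish: hence their product is 0 and their squares add up to -1.\<close>

lemma tripotent_ad1: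
  fixes x y :: "'a::real_inner \<Rightarrow> 'a"
  assumes x: "linear x" and y: "linear y" and tri: "\<And>u. x (x (x u)) = - x u"
    and ad: "lie_bracket x (lie_bracket x y) = (\<lambda>u. - y u)"
  shows "x (y (x u)) = 0" "x (x (y u)) + y (x (x u)) = - y u"
proof -
  note l = linear_add[OF x] linear_diff[OF x] linear_scale[OF x] linear_neg[OF x] linear_neg[OF y]
  have E: "x (x (y t)) - 2 *\<^sub>R x (y (x t)) + y (x (x t)) = - y t" for t
    using fun_cong[OF ad, of t] by (simp add: lie_bracket_def l algebra_simps scaleR_2)
  have 1: "x (x (y (x t))) = 0" for t
  proof (rule real_inner_eqI)
    fix w
    have "x (x (x (y t)) - 2 *\<^sub>R x (y (x t)) + y (x (x t))) = x (- y t)" by (simp only: E)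
    from arg_cong[OF this, of "\<lambda>a. inner a w"] arg_cong[OF E[of "x t"], of "\<lambda>a. inner a w"]
    show "inner (x (x (y (x t)))) w = inner 0 w"
      by (simp add: l tri inner_add_left inner_diff_left)
  qed
  have 2: "x (y (x t)) = 0" for t
    using tri[of "y (x t)"] linear_0[OF x] by (simp add: 1)
  show "x (y (x u)) = 0" by (rule 2)
  show "x (x (y u)) + y (x (x u)) = - y u" using E[of u] by (simp add: 2)
qed

section \<open>Images of minimal solutions under an automorphism\<close>

context K_structure
begin

lemma Aut_ad_funpow:
  assumes \<phi>: "\<phi> \<in> Aut Js" and x: "x \<in> u2 Js" and y: "y \<in> u2 Js"
  shows "(lie_bracket x ^^ n) y \<in> u2 Js \<and> \<phi> ((lie_bracket x ^^ n) y) = (lie_bracket (\<phi> x) ^^ n) (\<phi> y)"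
  by (induction n) (auto simp: y u2_bracket[OF x] Aut_bracket[OF \<phi> x])

text \<open>Surjectivity carries the vanishing of \<open>ad_poly\<close> over to
  \<open>\<phi> x\<close>, and isometry carries the bound. The bound admits the value
  \<open>d\<close> of a single line and, for \<open>d = 1\<close>, the value 2 of a real
  wedge.\<close>

lemma Aut_tripotent:
  assumes \<phi>: "\<phi> \<in> Aut Js" and x: "x \<in> u2 Js" and tri: "\<And>u. x (x (x u)) = - x u"
    and small: "hs_inner x x < 4 * real d"
  shows "\<phi> x (\<phi> x (\<phi> x u)) = - \<phi> x u"
proof (rule tripotent_if_small)
  show "\<phi> x \<in> u2 Js" by (rule Aut_u2[OF \<phi> x])
  show "hs_inner (\<phi> x) (\<phi> x) < 4 * real d" using small by (simp add: Aut_hs[OF \<phi>] x)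
  fix y assume "y \<in> u2 Js"
  then obtain y' where y': "y' \<in> u2 Js" "y = \<phi> y'" using Aut_surj[OF \<phi>] by blast
  note p = Aut_ad_funpow[OF \<phi> x y'(1), THEN conjunct1] Aut_ad_funpow[OF \<phi> x y'(1), THEN conjunct2]
  have b: "lie_bracket x y' \<in> u2 Js" by (rule u2_bracket[OF x y'(1)])
  have "ad_poly x y' = (\<lambda>u. 0)"
    using ad_poly_tripotent[OF u2_linear[OF x] u2_linear[OF y'(1)] tri] by blast
  then have "(\<lambda>u. 0) = \<phi> (ad_poly x y')" using Aut_zero[OF \<phi>] by simp
  also have "\<dots> = ad_poly (\<phi> x) y"
    unfolding ad_poly_def y'(2)
    by (simp add: Aut_add[OF \<phi>] Aut_scale[OF \<phi>] u2_add u2_scale p b Aut_bracket[OF \<phi> x y'(1)])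
  finally show "ad_poly (\<phi> x) y = (\<lambda>u. 0)" by simp
qed

lemma double_bracket_transfer:
  assumes \<phi>: "\<phi> \<in> Aut Js" and x: "x \<in> u2 Js" and c: "c \<in> u2 Js"
  shows "lie_bracket (\<phi> x) (lie_bracket (\<phi> x) (\<phi> c)) = (\<lambda>u. k *\<^sub>R \<phi> c u) \<longleftrightarrow>
    lie_bracket x (lie_bracket x c) = (\<lambda>u. k *\<^sub>R c u)"
proof -
  have "lie_bracket (\<phi> x) (lie_bracket (\<phi> x) (\<phi> c)) = \<phi> (lie_bracket x (lie_bracket x c))"
    by (simp add: Aut_bracket[OF \<phi>] u2_bracket x c)
  moreover have "(\<lambda>u. k *\<^sub>R \<phi> c u) = \<phi> (\<lambda>u. k *\<^sub>R c u)" by (simp add: Aut_scale[OF \<phi> c])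
  ultimately show ?thesis using Aut_inj[OF \<phi>] by (simp add: u2_bracket u2_scale x c)
qed

text \<open>The operator acts as an imaginary unit on the single line \<open>K v\<close> and as 0 on
  its complement. By \<open>hs_lower_bound\<close> the value \<open>d\<close> is the least one for a
  nonzero solution of \<open>x^3 = -x\<close>.\<close>

lemma kk_line:
  assumes i: "0 < i" "i < d" and v: "norm v = 1"
  shows "kk (T i v) v = (\<lambda>z. (1/2) *\<^sub>R wedge (T i v) v z)"
    and "kk (T i v) v \<in> u2 Js" and "kk (T i v) v v = T i v"
    and "kk (T i v) v (kk (T i v) v v) = - v"
    and "hs_inner (kk (T i v) v) (kk (T i v) v) = real d"
proof -
  show eq: "kk (T i v) v = (\<lambda>z. (1/2) *\<^sub>R wedge (T i v) v z)"
  proof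
    fix z
    have "wedge (T i v) v z = 2 *\<^sub>R kk (T i v) v z"
      using i kk_T_left[OF i(2), of v v z] by (simp add: wedge_def sg_def scaleR_2)
    then show "kk (T i v) v z = (1/2) *\<^sub>R wedge (T i v) v z" by simp
  qed
  show mem: "kk (T i v) v \<in> u2 Js" unfolding eq by (intro u2_scale wedge_in_u2)
  show at: "kk (T i v) v v = T i v" by (rule kk_self[OF v])
  show "kk (T i v) v (kk (T i v) v v) = - v" by (simp add: at kk_T i T_square)
  have "hs_inner (kk (T i v) v) (kk (T i v) v) = (1/2) * hs_inner (kk (T i v) v) (wedge (T i v) v)"
    by (subst (2) eq) (simp add: hs_inner_commute[of "kk (T i v) v"] hs_inner_scale_left)
  then show "hs_inner (kk (T i v) v) (kk (T i v) v) = real d"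
    using v i by (simp add: hs_inner_wedge[OF mem] at norm_T flip: power2_norm_eq_inner)
qed

lemma Aut_kk_line:
  assumes \<phi>: "\<phi> \<in> Aut Js" and i: "0 < i" "i < d" and v: "norm v = 1"
  defines "x \<equiv> \<phi> (kk (T i v) v)"
  shows "x \<in> u2 Js" and "hs_inner x x = real d" and "x (x (x u)) = - x u"
    and "norm v' = 1 \<Longrightarrow> x (x v') = - v' \<Longrightarrow> korth v' z \<Longrightarrow> x z = 0"
    and "\<exists>u. x u \<noteq> 0"
proof -
  note k = kk_line[OF i v]
  show x: "x \<in> u2 Js" unfolding x_def by (rule Aut_u2[OF \<phi> k(2)])
  show hs: "hs_inner x x = real d" unfolding x_def by (simp only: Aut_hs[OF \<phi> k(2) k(2)] k(5))
  show "x (x (x u)) = - x u"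
    unfolding x_def
    by (rule Aut_tripotent[OF \<phi> k(2)])
      (use line_supported(3)[OF k(2) v k(4)] kk_korth d_pos k(5) in auto)
  show "norm v' = 1 \<Longrightarrow> x (x v') = - v' \<Longrightarrow> korth v' z \<Longrightarrow> x z = 0"
    by (rule minimal_support[OF x hs])
  show "\<exists>u. x u \<noteq> 0"
  proof (rule ccontr)
    assume "\<nexists>u. x u \<noteq> 0"
    then have "hs_inner x x = 0" by (simp add: hs_inner_def)
    then show False using hs d_pos by simp
  qed
qed

lemma Aut_line_wedges:
  assumes \<phi>: "\<phi> \<in> Aut Js" and i: "0 < i" "i < d" and v: "norm v = 1"
    and v': "norm v' = 1" "\<phi> (kk (T i v) v) (\<phi> (kk (T i v) v) v') = - v'"
  shows "korth v u \<Longrightarrow> \<exists>u'. korth v' u' \<and> \<phi> (wedge u v) = wedge u' v'"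
    and "korth v' u' \<Longrightarrow> \<exists>u. korth v u \<and> \<phi> (wedge u v) = wedge u' v'"
proof -
  let ?x = "kk (T i v) v"
  note k = kk_line[OF i v] and a = Aut_kk_line[OF \<phi> i v]
  have eq: "lie_bracket (\<phi> ?x) (lie_bracket (\<phi> ?x) (\<phi> c)) = (\<lambda>u. - \<phi> c u) \<longleftrightarrow>
    lie_bracket ?x (lie_bracket ?x c) = (\<lambda>u. - c u)" if "c \<in> u2 Js" for c
    using double_bracket_transfer[OF \<phi> k(2) that, of "-1"] by simp
  have e0: "lie_bracket ?x (lie_bracket ?x c) = (\<lambda>u. - c u) \<longleftrightarrow> (\<exists>u. korth v u \<and> c = wedge u v)"
    if "c \<in> u2 Js" for c
    by (rule line_eigenspace[OF k(2) v k(4) kk_korth that])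
  have e1: "lie_bracket (\<phi> ?x) (lie_bracket (\<phi> ?x) c) = (\<lambda>u. - c u) \<longleftrightarrow> (\<exists>u. korth v' u \<and> c = wedge u v')"
    if "c \<in> u2 Js" for c
    by (rule line_eigenspace[OF a(1) v' a(4)[OF v'] that])
  show "\<exists>u'. korth v' u' \<and> \<phi> (wedge u v) = wedge u' v'" if "korth v u"
    using eq[OF wedge_in_u2] e0[OF wedge_in_u2] e1[OF Aut_u2[OF \<phi> wedge_in_u2]] that by blast
  show "\<exists>u. korth v u \<and> \<phi> (wedge u v) = wedge u' v'" if "korth v' u'"
  proof -
    obtain c where c: "c \<in> u2 Js" "wedge u' v' = \<phi> c" using Aut_surj[OF \<phi> wedge_in_u2] by blast
    have "\<exists>u. korth v' u \<and> \<phi> c = wedge u v'" using that c(2) by metis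
    then have "lie_bracket (\<phi> ?x) (lie_bracket (\<phi> ?x) (\<phi> c)) = (\<lambda>u. - \<phi> c u)"
      by (rule e1[OF Aut_u2[OF \<phi> c(1)], THEN iffD2])
    then obtain u where "korth v u" "c = wedge u v" using eq[OF c(1)] e0[OF c(1)] by blast
    then show ?thesis using c(2) by auto
  qed
qed

context
  notes One_nat_def [simp del]
begin

lemma exists_unit:
  obtains v :: 'h where "norm v = 1"
  by (rule exists_unit_korth[of "{}"]) auto

section \<open>The complex case\<close>

lemma complex_case:
  assumes \<phi>: "\<phi> \<in> Aut Js" and d: "d = 2"
  shows "\<exists>\<sigma> g. \<sigma>\<^sup>2 = 1 \<and> twisted (\<lambda>i. if i = 0 then 1 else \<sigma>) g \<and> (\<forall>x\<in>u2 Js. \<phi> x = Ad g x)"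
proof -
  obtain v :: 'h where v: "norm v = 1" by (rule exists_unit)
  have i: "0 < (1::nat)" "1 < d" using d by auto
  let ?x = "\<phi> (kk (T 1 v) v)"
  note k = kk_line[OF i v] and a = Aut_kk_line[OF \<phi> i v]
  obtain u where u: "?x u \<noteq> 0" using a(5) by blast
  define v' where "v' = ?x u /\<^sub>R norm (?x u)"
  have v': "norm v' = 1" "?x (?x v') = - v'"
    unfolding v'_def using tripotent_eigenvector[OF a(1,3) u] by simp_all
  note ls = line_supported[OF a(1) v' a(4)[OF v']]
  \<comment> \<open>The image of \<open>v'\<close> lies on its complex line and is orthogonal to
    \<open>v'\<close>, so it is a real multiple of \<open>T 1 v'\<close>. The factor is a sign, with
    -1 for the antiunitary case.\<close>
  define \<sigma> where "\<sigma> = inner (T 1 v') (?x v')"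
  have "?x v' = kk v' v' (?x v')"
    by (rule kk_fixed_range[OF v'(1), symmetric]) (use ls(4) in blast)
  also have "\<dots> = \<sigma> *\<^sub>R T 1 v'"
  proof -
    have "kk v' v' t = inner v' t *\<^sub>R v' + inner (T 1 v') t *\<^sub>R T 1 v'" for t
      unfolding kk_def unfolding d by (simp add: numeral_2_eq_2 T_0 One_nat_def)
    then show ?thesis using u2_inner_self[OF a(1), of v'] by (simp add: \<sigma>_def inner_commute)
  qed
  finally have xv': "?x v' = \<sigma> *\<^sub>R T 1 v'" .
  have "\<bar>\<sigma>\<bar> = 1"
    using norm_eigenvector[OF a(1) v'] by (simp add: xv' norm_T i v')
  then have \<sigma>: "\<sigma>\<^sup>2 = 1" by (metis one_power2 power2_abs)
  let ?s = "\<lambda>i. if i = 0 then 1 else \<sigma>"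
  have xk: "?x z = \<sigma> *\<^sub>R kk (T 1 v') v' z" for z
    using ls(1)[of z] by (simp add: xv' kk_scale)
  have "\<exists>g. twisted ?s g \<and> (\<forall>x\<in>u2 Js. \<phi> x = Ad g x)"
  proof (rule implemented_by_twisted[OF \<phi> v v'(1)])
    show "?s i * ?s i = 1" for i using \<sigma> by (simp add: power2_eq_square)
    show "\<exists>k<d. \<exists>\<epsilon>. (\<forall>u. T i (T j u) = \<epsilon> *\<^sub>R T k u) \<and> ?s i * ?s j = ?s k"
      if ij: "i < d" "j < d" for i j
    proof -
      consider "i = 0" | "j = 0" | "i = 1" "j = 1" using ij d by linarith
      then show ?thesis
      proof cases
        case 1 then show ?thesis using ij by (intro exI[of _ j]) (auto simp: T_0 intro!: exI[of _ 1])
      next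
        case 2 then show ?thesis using ij by (intro exI[of _ i]) (auto simp: T_0 intro!: exI[of _ 1])
      next
        case 3 then show ?thesis
          using i \<sigma> by (intro exI[of _ 0]) (auto simp: T_0 T_square power2_eq_square intro!: exI[of _ "-1"])
      qed
    qed
    show "\<phi> (wedge (T i v) v) = (\<lambda>z. ?s i *\<^sub>R wedge (T i v') v' z)" if "0 < i" "i < d" for i
    proof -
      have i1: "i = 1" using that d by simp
      have "wedge (T 1 v) v = (\<lambda>z. 2 *\<^sub>R kk (T 1 v) v z)" by (simp add: k(1))
      then have "\<phi> (wedge (T 1 v) v) = (\<lambda>z. 2 *\<^sub>R ?x z)" by (simp only: Aut_scale[OF \<phi> k(2)])
      then show ?thesis by (simp add: i1 xk kk_line(1)[OF i v'(1)])
    qed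
  qed (use Aut_line_wedges[OF \<phi> i v v'] in auto)
  then show ?thesis using \<sigma> by blast
qed

section \<open>The quaternionic case\<close>

text \<open>Elements of \<open>u2 Js\<close> commute with \<open>T j\<close>, so the imaginary units
  compose in reverse order.\<close>

lemma bracket_kk_line:
  assumes i: "0 < i" "i < d" and j: "0 < j" "j < d" and v: "norm v = 1"
  shows "lie_bracket (kk (T i v) v) (wedge (T j v) v) = (\<lambda>z. wedge (T j (T i v) - T i (T j v)) v z)"
proof -
  note k = kk_line[OF i v]
  have "wedge (T j v) (T i v) z = - wedge (T i (T j v)) v z" for z
    using i by (simp add: wedge_T_right sg_def)
  moreover have "wedge (- T i (T j v)) v z = - wedge (T i (T j v)) v z" for z
    using wedge_scale(1)[of "-1" "T i (T j v)" v] by simp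
  ultimately show ?thesis
    using wedge_add(1)[of "T j (T i v)" "- T i (T j v)" v]
    by (simp add: bracket_wedge[OF k(2)] k(3) kk_T j)
qed

text \<open>The imaginary units of a quaternionic line form a 2-sphere, so one image does not fix
  the frame. With two anticommuting images, \<open>v'\<close> can be chosen within its line so that
  they send it to \<open>T 1 v'\<close> and \<open>T 2 v'\<close>; this is why the signs are all
  1.\<close>

lemma quaternionic_case:
  assumes \<phi>: "\<phi> \<in> Aut Js" and d: "d = 4"
    and T12: "\<And>u. T 1 (T 2 u) = T 3 u" and T21: "\<And>u. T 2 (T 1 u) = - T 3 u"
  shows "\<exists>g. twisted (\<lambda>i. 1) g \<and> (\<forall>x\<in>u2 Js. \<phi> x = Ad g x)"
proof -
  have i: "0 < (1::nat)" "1 < d" "0 < (2::nat)" "2 < d" "0 < (3::nat)" "3 < d" using d by auto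
  have T11: "T 1 (T 1 u) = - u" and T22: "T 2 (T 2 u) = - u" for u using i T_square by auto
  have Tm: "T 1 (- u) = - T 1 u" "T 2 (- u) = - T 2 u" for u using i T_simps by auto
  have T13: "T 1 (T 3 u) = - T 2 u" "T 3 (T 1 u) = T 2 u" "T 3 (T 2 u) = - T 1 u" "T 2 (T 3 u) = T 1 u" for u
    by (simp_all only: T12[symmetric] T11 T22 Tm) 
       (simp_all only: T21 T12[symmetric] T11 T22 Tm minus_minus)
  have brackets: "lie_bracket (kk (T 1 v) v) (kk (T 2 v) v) = (\<lambda>z. - wedge (T 3 v) v z)"
    "lie_bracket (kk (T 1 v) v) (lie_bracket (kk (T 1 v) v) (kk (T 2 v) v)) = (\<lambda>u. - 4 *\<^sub>R kk (T 2 v) v u)"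
    "lie_bracket (kk (T 2 v) v) (lie_bracket (kk (T 2 v) v) (kk (T 1 v) v)) = (\<lambda>u. - 4 *\<^sub>R kk (T 1 v) v u)"
    if v: "norm v = 1" for v
  proof -
    note k1 = kk_line[OF i(1,2) v] and k2 = kk_line[OF i(3,4) v]
    have sc: "lie_bracket x (\<lambda>z. c *\<^sub>R y z) = (\<lambda>z. c *\<^sub>R lie_bracket x y z)" if "x \<in> u2 Js" for x y c
      by (simp add: lie_bracket_def u2_simps[OF that] scaleR_diff_right)
    have w2: "wedge (- T i u - T i u) v z = - 2 *\<^sub>R wedge (T i u) v z"
      "wedge (T i u + T i u) v z = 2 *\<^sub>R wedge (T i u) v z" for i u z
      using wedge_scale(1)[of "-2" "T i u" v] wedge_scale(1)[of "2" "T i u" v] by (simp_all add: scaleR_2)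
    show 1: "lie_bracket (kk (T 1 v) v) (kk (T 2 v) v) = (\<lambda>z. - wedge (T 3 v) v z)"
      by (subst k2(1)) (simp add: sc k1(2) bracket_kk_line[OF i(1,2,3,4) v] T12 T21 w2)
    have 2: "lie_bracket (kk (T 2 v) v) (kk (T 1 v) v) = (\<lambda>z. wedge (T 3 v) v z)"
      by (subst k1(1)) (simp add: sc k2(2) bracket_kk_line[OF i(3,4,1,2) v] T12 T21 w2)
    have 3: "lie_bracket (kk (T 1 v) v) (\<lambda>z. - wedge (T 3 v) v z) = (\<lambda>z. - 2 *\<^sub>R wedge (T 2 v) v z)"
      using sc[OF k1(2), of "-1" "wedge (T 3 v) v"] by (simp add: bracket_kk_line[OF i(1,2,5,6) v] T13 w2)
    show "lie_bracket (kk (T 1 v) v) (lie_bracket (kk (T 1 v) v) (kk (T 2 v) v)) = (\<lambda>u. - 4 *\<^sub>R kk (T 2 v) v u)"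
      unfolding 1 3 by (simp add: k2(1))
    have 4: "lie_bracket (kk (T 2 v) v) (wedge (T 3 v) v) = (\<lambda>z. - 2 *\<^sub>R wedge (T 1 v) v z)"
      by (simp add: bracket_kk_line[OF i(3,4,5,6) v] T13 w2)
    show "lie_bracket (kk (T 2 v) v) (lie_bracket (kk (T 2 v) v) (kk (T 1 v) v)) = (\<lambda>u. - 4 *\<^sub>R kk (T 1 v) v u)"
      unfolding 2 4 by (simp add: k1(1))
  qed
  obtain v :: 'h where v: "norm v = 1" by (rule exists_unit)
  note k1 = kk_line[OF i(1,2) v] and k2 = kk_line[OF i(3,4) v]
  define x where "x = \<phi> (kk (T 1 v) v)"
  define y where "y = \<phi> (kk (T 2 v) v)"
  note x = Aut_kk_line[OF \<phi> i(1,2) v, folded x_def] and y = Aut_kk_line[OF \<phi> i(3,4) v, folded y_def]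
  \<comment> \<open>The eigenvalue -4 survives \<phi>, and through \<open>tripotent_ad4\<close> it
    encodes that \<open>x\<close> and \<open>y\<close> anticommute and have the same range.\<close>
  have xy: "lie_bracket x (lie_bracket x y) = (\<lambda>u. - 4 *\<^sub>R y u)"
    unfolding x_def y_def by (rule double_bracket_transfer[OF \<phi> k1(2) k2(2), THEN iffD2, OF brackets(2)[OF v]])
  have yx: "lie_bracket y (lie_bracket y x) = (\<lambda>u. - 4 *\<^sub>R x u)"
    unfolding x_def y_def by (rule double_bracket_transfer[OF \<phi> k2(2) k1(2), THEN iffD2, OF brackets(3)[OF v]])
  note r = tripotent_ad4[OF u2_linear[OF x(1)] u2_linear[OF y(1)] x(3) xy]
    tripotent_ad4(1)[OF u2_linear[OF y(1)] u2_linear[OF x(1)] y(3) yx]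
  note lx = u2_simps[OF x(1)] u2_T[OF x(1)] and ly = u2_simps[OF y(1)] u2_T[OF y(1)]
  obtain t where t: "x t \<noteq> 0" using x(5) by blast
  define u where "u = x t"
  have u: "u \<noteq> 0" "x (x u) = - u" "y (y u) = - u" unfolding u_def using t x(3) r(3) by auto
  \<comment> \<open>\<open>- T 1 \<circ> x\<close> and \<open>- T 2 \<circ> y\<close> are commuting involutions of the range of \<open>x\<close>; averaging over them
    gives a common fixed vector, unless the average of the chosen vector vanishes.\<close>
  obtain z where z: "z \<noteq> 0" "x z = T 1 z" "y (y z) = - z"
  proof (cases "x u = - T 1 u")
    \<comment> \<open>\<open>T 2\<close> commutes with \<open>x\<close> and anticommutes with
      \<open>T 1\<close>, so it turns the eigenvalue -1 of the first involution into 1.\<close>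
    case True
    show ?thesis
    proof (rule that[of "T 2 u"])
      show "T 2 u \<noteq> 0" using u(1) i norm_T by (metis norm_eq_zero)
      show "x (T 2 u) = T 1 (T 2 u)" using i by (simp add: lx True T12 T21 Tm)
      show "y (y (T 2 u)) = - T 2 u" using i by (simp add: ly u Tm)
    qed
  next
    case False
    show ?thesis
    proof (rule that[of "u - T 1 (x u)"])
      show "u - T 1 (x u) \<noteq> 0"
      proof
        assume "u - T 1 (x u) = 0"
        then have "T 1 u = T 1 (T 1 (x u))" by simp
        then show False using False by (simp add: T11)
      qed
      show "x (u - T 1 (x u)) = T 1 (u - T 1 (x u))" using i by (simp add: lx u T_simps T11)
      show "y (y (u - T 1 (x u))) = - (u - T 1 (x u))" using i by (simp add: ly u r T_simps)
    qed
  qed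
  obtain w where w: "w \<noteq> 0" "x w = T 1 w" "y w = T 2 w"
  proof (cases "y z = - T 2 z")
    \<comment> \<open>In the same way \<open>T 1\<close> corrects the sign for \<open>y\<close>, and
      it keeps the relation \<open>x z = T 1 z\<close>.\<close>
    case True
    show ?thesis
    proof (rule that[of "T 1 z"])
      show "T 1 z \<noteq> 0" using z(1) i norm_T by (metis norm_eq_zero)
      show "x (T 1 z) = T 1 (T 1 z)" using i by (simp add: lx z)
      show "y (T 1 z) = T 2 (T 1 z)" using i by (simp add: ly True T12 T21 Tm)
    qed
  next
    case False
    show ?thesis
    proof (rule that[of "z - T 2 (y z)"])
      show "z - T 2 (y z) \<noteq> 0"
      proof
        assume "z - T 2 (y z) = 0"
        then have "T 2 z = T 2 (T 2 (y z))" by simp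
        then show False using False by (simp add: T22)
      qed
      show "x (z - T 2 (y z)) = T 1 (z - T 2 (y z))" using i by (simp add: lx ly z r(2) T_simps T12 T21)
      show "y (z - T 2 (y z)) = T 2 (z - T 2 (y z))" using i by (simp add: ly z T_simps T22)
    qed
  qed
  define v' where "v' = w /\<^sub>R norm w"
  have v': "norm v' = 1" "x v' = T 1 v'" "y v' = T 2 v'"
    using w i by (simp_all add: v'_def lx ly T_simps)
  have xx: "x (x v') = - v'" and yy: "y (y v') = - v'" using i by (simp_all add: lx ly v' T11 T22)
  have xk: "x = kk (T 1 v') v'"
    using line_supported(1)[OF x(1) v'(1) xx x(4)[OF v'(1) xx]] v'(2) by auto
  have yk: "y = kk (T 2 v') v'"
    using line_supported(1)[OF y(1) v'(1) yy y(4)[OF v'(1) yy]] v'(3) by auto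
  show ?thesis
  proof (rule implemented_by_twisted[OF \<phi> v v'(1)])
    show "\<exists>k<d. \<exists>\<epsilon>. (\<forall>u. T i (T j u) = \<epsilon> *\<^sub>R T k u) \<and> (1::real) * 1 = 1" if "i < d" "j < d" for i j
      using T_closed[OF that] by auto
    show "\<phi> (wedge (T i v) v) = (\<lambda>z. 1 *\<^sub>R wedge (T i v') v' z)" if "0 < i" "i < d" for i
    proof -
      have 1: "\<phi> (wedge (T 1 v) v) = wedge (T 1 v') v'"
      proof -
        have "wedge (T 1 v) v = (\<lambda>z. 2 *\<^sub>R kk (T 1 v) v z)" by (simp add: k1(1))
        then have "\<phi> (wedge (T 1 v) v) = (\<lambda>z. 2 *\<^sub>R x z)" by (simp only: Aut_scale[OF \<phi> k1(2)] x_def)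
        then show ?thesis by (simp add: xk kk_line(1)[OF i(1,2) v'(1)])
      qed
      have 2: "\<phi> (wedge (T 2 v) v) = wedge (T 2 v') v'"
      proof -
        have "wedge (T 2 v) v = (\<lambda>z. 2 *\<^sub>R kk (T 2 v) v z)" by (simp add: k2(1))
        then have "\<phi> (wedge (T 2 v) v) = (\<lambda>z. 2 *\<^sub>R y z)" by (simp only: Aut_scale[OF \<phi> k2(2)] y_def)
        then show ?thesis by (simp add: yk kk_line(1)[OF i(3,4) v'(1)])
      qed
      \<comment> \<open>Up to sign, this wedge is the bracket of the two preceding units.\<close>
      have 3: "\<phi> (wedge (T 3 v) v) = wedge (T 3 v') v'"
      proof -
        have "wedge (T 3 v) v = (\<lambda>z. - lie_bracket (kk (T 1 v) v) (kk (T 2 v) v) z)"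
          by (simp add: brackets(1)[OF v])
        then have "\<phi> (wedge (T 3 v) v) = (\<lambda>z. - lie_bracket x y z)"
          by (simp only: Aut_uminus[OF \<phi> u2_bracket[OF k1(2) k2(2)]] Aut_bracket[OF \<phi> k1(2) k2(2)] x_def y_def)
        then show ?thesis by (simp add: xk yk brackets(1)[OF v'(1)])
      qed
      have "i = 1 \<or> i = 2 \<or> i = 3" using that d by linarith
      then show ?thesis using 1 2 3 by auto
    qed
  qed (use Aut_line_wedges[OF \<phi> i(1,2) v v'(1)] xx in \<open>auto simp: x_def\<close>)
qed

section \<open>The real case\<close>

lemma real_simps:
  assumes d: "d = 1"
  shows "korth u v \<longleftrightarrow> inner u v = 0" "wedge u w z = inner w z *\<^sub>R u - inner u z *\<^sub>R w"
  unfolding korth_def wedge_def kk_def unfolding d by (simp_all add: T_0 One_nat_def)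

lemma real_hs_wedge: "d = 1 \<Longrightarrow> x \<in> u2 Js \<Longrightarrow> hs_inner x (wedge u w) = 2 * inner (x w) u"
  using hs_inner_wedge[of x u w] by (metis mult.right_neutral of_nat_1)

definition orthotriple :: "'h \<Rightarrow> 'h \<Rightarrow> 'h \<Rightarrow> bool" where
  "orthotriple p q v \<longleftrightarrow> norm p = 1 \<and> norm q = 1 \<and> norm v = 1
     \<and> inner p q = 0 \<and> inner p v = 0 \<and> inner q v = 0"

lemma orthotriple_inner:
  assumes "orthotriple p q v"
  shows "inner p p = 1" "inner q q = 1" "inner v v = 1" "inner p q = 0" "inner q p = 0"
    "inner p v = 0" "inner v p = 0" "inner q v = 0" "inner v q = 0"
  using assms by (auto simp: orthotriple_def norm_eq_1 inner_commute)

text \<open>The wedges of an orthotriple span a copy of \<open>so(3)\<close>, whose relations can be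
  carried through \<phi>.\<close>

lemma real_brackets:
  assumes d: "d = 1" and o: "orthotriple p q v"
  shows "lie_bracket (wedge p v) (wedge q v) = wedge q p"
    and "lie_bracket (wedge p v) (lie_bracket (wedge p v) (wedge q v)) = (\<lambda>u. - wedge q v u)"
    and "lie_bracket (wedge q v) (lie_bracket (wedge q v) (wedge p v)) = (\<lambda>u. - wedge p v u)"
  by (rule ext, simp add: lie_bracket_def real_simps[OF d] inner_diff_left inner_diff_right orthotriple_inner[OF o] algebra_simps)+

lemma real_wedge_facts:
  assumes d: "d = 1" and "norm p = 1" "norm v = 1" "inner p v = 0"
  shows "hs_inner (wedge p v) (wedge p v) = 2" "wedge p v (wedge p v (wedge p v u)) = - wedge p v u"
proof -
  have "inner p p = 1" "inner v v = 1" "inner p v = 0" "inner v p = 0"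
    using assms(2-4) by (simp_all add: norm_eq_1 inner_commute)
  then show "hs_inner (wedge p v) (wedge p v) = 2" "wedge p v (wedge p v (wedge p v u)) = - wedge p v u"
    by (simp_all add: real_hs_wedge[OF d wedge_in_u2] real_simps[OF d] inner_diff_right)
qed

text \<open>For \<open>x = wedge p v\<close> the solutions of \<open>(ad x)^2 c = -c\<close> are
  sums of a wedge with \<open>v\<close> and a wedge with \<open>p\<close>, the other factors being
  orthogonal to both. Commuting with \<open>wedge q p\<close> leaves \<open>wedge u v\<close> with
  \<open>u\<close> orthogonal also to \<open>q\<close>, plus a multiple of \<open>wedge q p\<close>,
  which the orthogonality removes.\<close>

lemma real_characterization:
  assumes d: "d = 1" and o: "orthotriple p q v" and c: "c \<in> u2 Js"
  shows "lie_bracket (wedge p v) (lie_bracket (wedge p v) c) = (\<lambda>u. - c u)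
      \<and> lie_bracket (wedge q p) c = (\<lambda>u. 0) \<and> hs_inner c (wedge q p) = 0
    \<longleftrightarrow> (\<exists>u. inner u p = 0 \<and> inner u q = 0 \<and> inner u v = 0 \<and> c = wedge u v)"
proof safe
  note oi = orthotriple_inner[OF o]
  assume 1: "lie_bracket (wedge p v) (lie_bracket (wedge p v) c) = (\<lambda>u. - c u)"
    and 2: "lie_bracket (wedge q p) c = (\<lambda>u. 0)" and 3: "hs_inner c (wedge q p) = 0"
  have 3: "inner (c p) q = 0" using 3 d_pos by (simp add: hs_inner_wedge[OF c])
  have 2: "wedge q p (c t) = c (wedge q p t)" for t
    using fun_cong[OF 2, of t] by (simp add: lie_bracket_def)
  have cq: "c q = 0"
    using 2[of p] 3 u2_inner_self[OF c, of p]
    by (simp add: real_simps[OF d] oi inner_commute u2_simps[OF c])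
  have cp: "c p = 0"
    using 2[of q] cq by (simp add: real_simps[OF d] oi u2_simps[OF c])
  have "inner (c z) r = 0" if "korth v z" "korth v r" for z r
  proof -
    have vz: "inner v z = 0" "inner v r = 0" using that by (simp_all add: real_simps[OF d])
    have "inner (c z) p = 0" using u2_inner[OF c, of z p] cp by simp
    then have a: "wedge p v (c z) = inner v (c z) *\<^sub>R p" 
      by (simp add: real_simps[OF d] inner_commute)
    have b: "wedge p v z = - inner p z *\<^sub>R v" by (simp add: real_simps[OF d] vz)
    \<comment> \<open>The double bracket equation at \<open>z\<close> puts \<open>c z\<close> on the
      line of \<open>v\<close>, so the block of \<open>c\<close> on the complement of
      \<open>v\<close> vanishes.\<close>
    have "c z = inner v (c z) *\<^sub>R v"
    proof -
      have cb: "c (wedge p v z) = - inner p z *\<^sub>R c v" by (simp add: b u2_simps[OF c])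
      have "- c z = wedge p v (wedge p v (c z)) - wedge p v (c (wedge p v z))
          - (wedge p v (c (wedge p v z)) - c (wedge p v (wedge p v z)))"
        using fun_cong[OF 1, of z] by (simp add: lie_bracket_def u2_simps[OF wedge_in_u2])
      also have "wedge p v (wedge p v (c z)) = - inner v (c z) *\<^sub>R v"
        by (simp add: a u2_simps[OF wedge_in_u2]) (simp add: real_simps[OF d] oi)
      also have "c (wedge p v (wedge p v z)) = 0"
        by (simp add: b u2_simps[OF wedge_in_u2]) (simp add: real_simps[OF d] oi u2_simps[OF c] cp)
      also have "wedge p v (c (wedge p v z)) = 0"
        using u2_inner_self[OF c, of v] u2_inner[OF c, of v p] cp
        by (simp add: cb u2_simps[OF wedge_in_u2]) (simp add: real_simps[OF d] inner_commute)
      finally show ?thesis by simp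
    qed
    then have "inner (c z) r = inner v (c z) * inner v r" by (metis inner_scaleR_left)
    then show ?thesis by (simp add: vz)
  qed
  moreover have "norm v = 1" using o by (simp add: orthotriple_def)
  moreover have vc: "inner v (c v) = 0" using u2_inner_self[OF c, of v] by (simp add: inner_commute)
  ultimately have "c = wedge (c v) v"
    using wedge_characterization[OF c] by (simp add: real_simps(1)[OF d])
  moreover have "inner (c v) p = 0" "inner (c v) q = 0" "inner (c v) v = 0"
    using u2_inner[OF c, of v p] u2_inner[OF c, of v q] cp cq vc by (simp_all add: inner_commute)
  ultimately show "\<exists>u. inner u p = 0 \<and> inner u q = 0 \<and> inner u v = 0 \<and> c = wedge u v" by blast
next
  note oi = orthotriple_inner[OF o]
  fix u assume u: "inner u p = 0" "inner u q = 0" "inner u v = 0"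
  have u': "inner p u = 0" "inner q u = 0" "inner v u = 0" using u by (simp_all add: inner_commute)
  show "lie_bracket (wedge p v) (lie_bracket (wedge p v) (wedge u v)) = (\<lambda>t. - wedge u v t)"
    "lie_bracket (wedge q p) (wedge u v) = (\<lambda>u. 0)"
    by (rule ext, simp add: lie_bracket_def real_simps[OF d] inner_diff_left inner_diff_right oi u u' algebra_simps)+
  show "hs_inner (wedge u v) (wedge q p) = 0"
    unfolding hs_inner_wedge[OF wedge_in_u2] by (simp add: real_simps[OF d] u oi u')
qed

lemma real_case:
  assumes \<phi>: "\<phi> \<in> Aut Js" and d: "d = 1"
  shows "\<exists>g. twisted (\<lambda>i. 1) g \<and> (\<forall>x\<in>u2 Js. \<phi> x = Ad g x)"
proof -
  have rd: "real d = 1" using d by simp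
  obtain v :: 'h where v: "norm v = 1" by (rule exists_unit)
  obtain p0 where p0: "norm p0 = 1" "korth v p0"
    by (rule exists_unit_korth[of "{v}"]) (use v in auto)
  have "pairwise korth {v, p0}" using p0 korth_sym by (auto simp: pairwise_insert)
  then obtain q0 where q0: "norm q0 = 1" "\<And>w. w \<in> {v, p0} \<Longrightarrow> korth w q0"
    using exists_unit_korth[of "{v, p0}"] v p0(1) by (metis finite.emptyI finite.insertI insertE singletonD)
  have o: "orthotriple p0 q0 v"
    using v p0 q0(1) q0(2)[of v] q0(2)[of p0] by (simp add: orthotriple_def real_simps[OF d] inner_commute)
  have o': "norm p0 = 1" "norm q0 = 1" "inner p0 v = 0" "inner q0 v = 0" using o by (auto simp: orthotriple_def)
  define x where "x = \<phi> (wedge p0 v)"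
  define y where "y = \<phi> (wedge q0 v)"
  have x: "x \<in> u2 Js" and y: "y \<in> u2 Js" by (simp_all add: x_def y_def Aut_u2[OF \<phi> wedge_in_u2])
  have hx: "hs_inner x x = 2" and hy: "hs_inner y y = 2"
    unfolding x_def y_def using o' v by (simp_all add: Aut_hs[OF \<phi>] wedge_in_u2 real_wedge_facts[OF d])
  have tx: "x (x (x t)) = - x t" for t
    unfolding x_def by (rule Aut_tripotent[OF \<phi> wedge_in_u2])
      (unfold rd, use o' v in \<open>simp_all add: real_wedge_facts[OF d]\<close>)
  have ty: "y (y (y t)) = - y t" for t
    unfolding y_def by (rule Aut_tripotent[OF \<phi> wedge_in_u2])
      (unfold rd, use o' v in \<open>simp_all add: real_wedge_facts[OF d]\<close>)
  have xy: "lie_bracket x (lie_bracket x y) = (\<lambda>u. - y u)"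
    using double_bracket_transfer[OF \<phi> wedge_in_u2 wedge_in_u2, of p0 v q0 v "-1"] real_brackets(2)[OF d o]
    by (simp add: x_def y_def)
  have yx: "lie_bracket y (lie_bracket y x) = (\<lambda>u. - x u)"
    using double_bracket_transfer[OF \<phi> wedge_in_u2 wedge_in_u2, of q0 v p0 v "-1"] real_brackets(3)[OF d o]
    by (simp add: x_def y_def)
  note rx = tripotent_ad1[OF u2_linear[OF x] u2_linear[OF y] tx xy]
    and ry = tripotent_ad1[OF u2_linear[OF y] u2_linear[OF x] ty yx]
  \<comment> \<open>If \<open>x^2 y\<close> vanished, so would \<open>y x^2\<close>, which is minus
    its adjoint, and then \<open>y = - x^2 y - y x^2\<close> would be 0.\<close>
  have "\<exists>z. x (x (y z)) \<noteq> 0"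
  proof (rule ccontr)
    assume "\<nexists>z. x (x (y z)) \<noteq> 0"
    then have 0: "x (x (y z)) = 0" for z by simp
    have "inner (y (x (x u))) w = 0" for u w
      using 0[of w] by (simp add: u2_inner[OF x] u2_inner[OF y])
    then have "y (x (x u)) = 0" for u by (metis inner_eq_zero_iff)
    then have "y u = 0" for u using rx(2)[of u] 0 by simp
    then have "hs_inner y y = 0" by (simp add: hs_inner_def)
    then show False using hy by simp
  qed
  then obtain z where z: "x (x (y z)) \<noteq> 0" by blast
  \<comment> \<open>The planes on which \<open>x\<close> and \<open>y\<close> live meet in one line.
    As \<open>x^2\<close> is minus the projection onto the plane of \<open>x\<close>, applying it to
    a value of \<open>y\<close> lands on that line.\<close>
  let ?w = "x (x (y z))"
  have w: "x (x ?w) = - ?w" "x (y ?w) = 0" "y (x ?w) = 0" "y (y ?w) = - ?w"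
  proof -
    show "x (x ?w) = - ?w" by (simp add: tx u2_simps[OF x])
    show "x (y ?w) = 0" by (rule rx(1))
    show "y (x ?w) = 0" using ry(1)[of z] by (simp add: tx u2_simps[OF y])
    show "y (y ?w) = - ?w"
      using ry(2)[of "x (y z)"] ry(1)[of z] by (simp add: u2_simps[OF x] u2_simps[OF y])
  qed
  define v' where "v' = ?w /\<^sub>R norm ?w"
  have v': "norm v' = 1" "x (x v') = - v'" "x (y v') = 0" "y (x v') = 0" "y (y v') = - v'"
    using z w by (simp_all add: v'_def u2_simps[OF x] u2_simps[OF y])
  define p where "p = x v'"
  define q where "q = y v'"
  have o1: "orthotriple p q v'"
    using norm_eigenvector[OF x v'(1,2)] norm_eigenvector[OF y v'(1,5)] v'(1)
      u2_inner_self[OF x, of v'] u2_inner_self[OF y, of v'] u2_inner[OF x, of v' q] v'(3)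
    by (simp add: orthotriple_def p_def q_def)
  \<comment> \<open>Both operators have square norm 2, that of a wedge of orthonormal vectors, and
    their scalar product is 2 as well, so they coincide.\<close>
  have eq_wedge: "x = wedge (x v') v'" if x: "x \<in> u2 Js" "hs_inner x x = 2" "norm (x v') = 1" for x
  proof (rule u2_eq_if_hs[OF x(1) wedge_in_u2])
    have "inner (x v') v' = 0" by (rule u2_inner_self[OF x(1)])
    then show "hs_inner (wedge (x v') v') (wedge (x v') v') = hs_inner x (wedge (x v') v')"
      using x v'(1) by (simp add: real_wedge_facts[OF d] real_hs_wedge[OF d] norm_eq_1)
    show "hs_inner x x = hs_inner x (wedge (x v') v')"
      using x by (simp add: real_hs_wedge[OF d] norm_eq_1)
  qed
  have xp: "x = wedge p v'" and yq: "y = wedge q v'"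
    using eq_wedge[OF x hx] eq_wedge[OF y hy] o1 by (simp_all add: p_def q_def orthotriple_def)
  \<comment> \<open>\<open>real_characterization\<close> leaves out the directions of the first two
    vectors of the triple; for these \<phi> is known from \<open>x\<close> and \<open>y\<close>
    themselves.\<close>
  have decomp: "\<exists>\<alpha> \<beta> r. u = \<alpha> *\<^sub>R a + \<beta> *\<^sub>R b + r \<and> inner r a = 0 \<and> inner r b = 0 \<and> inner r c = 0"
    if "orthotriple a b c" "inner u c = 0" for u a b c :: 'h
    by (rule exI[of _ "inner u a"], rule exI[of _ "inner u b"],
        rule exI[of _ "u - (inner u a *\<^sub>R a + inner u b *\<^sub>R b)"])
      (use orthotriple_inner[OF that(1)] that(2) in \<open>simp add: inner_diff_left inner_add_left\<close>)
  have bq: "\<phi> (wedge q0 p0) = wedge q p"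
    using Aut_bracket[OF \<phi> wedge_in_u2 wedge_in_u2, of p0 v q0 v]
    by (simp add: real_brackets(1)[OF d o] real_brackets(1)[OF d o1] x_def[symmetric] y_def[symmetric] xp[symmetric] yq[symmetric])
      (simp add: xp yq real_brackets(1)[OF d o1])
  have trans: "(\<exists>u'. inner u' p = 0 \<and> inner u' q = 0 \<and> inner u' v' = 0 \<and> \<phi> c = wedge u' v') \<longleftrightarrow>
    (\<exists>u. inner u p0 = 0 \<and> inner u q0 = 0 \<and> inner u v = 0 \<and> c = wedge u v)" if c: "c \<in> u2 Js" for c
  proof -
    have 1: "lie_bracket (wedge p v') (lie_bracket (wedge p v') (\<phi> c)) = (\<lambda>u. - \<phi> c u) \<longleftrightarrow>
      lie_bracket (wedge p0 v) (lie_bracket (wedge p0 v) c) = (\<lambda>u. - c u)"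
      using double_bracket_transfer[OF \<phi> wedge_in_u2 c, of p0 v "-1"] by (simp add: x_def[symmetric] xp)
    have 2: "lie_bracket (wedge q p) (\<phi> c) = (\<lambda>u. 0) \<longleftrightarrow> lie_bracket (wedge q0 p0) c = (\<lambda>u. 0)"
    proof -
      have "lie_bracket (wedge q p) (\<phi> c) = \<phi> (lie_bracket (wedge q0 p0) c)"
        by (simp add: Aut_bracket[OF \<phi> wedge_in_u2 c] bq)
      moreover have "(\<lambda>u. 0) \<in> u2 Js" using u2_scale[OF c, of 0] by simp
      ultimately show ?thesis
        using Aut_inj[OF \<phi> u2_bracket[OF wedge_in_u2 c], of "\<lambda>u. 0"] Aut_zero[OF \<phi>] by simp
    qed
    have 3: "hs_inner (\<phi> c) (wedge q p) = hs_inner c (wedge q0 p0)"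
      using Aut_hs[OF \<phi> c wedge_in_u2, of q0 p0] by (simp add: bq)
    show ?thesis
      unfolding real_characterization[OF d o c, symmetric] 
        real_characterization[OF d o1 Aut_u2[OF \<phi> c], symmetric]
      by (simp only: 1 2 3)
  qed
  have lin: "\<phi> (wedge (\<alpha> *\<^sub>R p0 + \<beta> *\<^sub>R q0 + r) v) = wedge (\<alpha> *\<^sub>R p + \<beta> *\<^sub>R q + r') v'"
    if "\<phi> (wedge r v) = wedge r' v'" for \<alpha> \<beta> r r'
  proof -
    have "\<phi> (wedge (\<alpha> *\<^sub>R p0 + \<beta> *\<^sub>R q0 + r) v) = (\<lambda>t. (\<alpha> *\<^sub>R x t + \<beta> *\<^sub>R y t) + wedge r' v' t)"
      by (simp add: wedge_add wedge_scale Aut_add[OF \<phi>] Aut_scale[OF \<phi>] u2_add u2_scale wedge_in_u2 that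
          x_def[symmetric] y_def[symmetric])
    then show ?thesis by (simp add: wedge_add wedge_scale xp yq)
  qed
  show ?thesis
  proof (rule implemented_by_twisted[OF \<phi> v v'(1)])
    show "\<exists>k<d. \<exists>\<epsilon>. (\<forall>u. T i (T j u) = \<epsilon> *\<^sub>R T k u) \<and> (1::real) * 1 = 1" if "i < d" "j < d" for i j
      using T_closed[OF that] by auto
    show "\<exists>u'. korth v' u' \<and> \<phi> (wedge u v) = wedge u' v'" if "korth v u" for u
    proof -
      obtain \<alpha> \<beta> r where r: "u = \<alpha> *\<^sub>R p0 + \<beta> *\<^sub>R q0 + r" "inner r p0 = 0" "inner r q0 = 0" "inner r v = 0"
        using decomp[OF o, of u] \<open>korth v u\<close> by (auto simp: real_simps[OF d] inner_commute)
      then obtain r' where r': "inner r' v' = 0" "\<phi> (wedge r v) = wedge r' v'"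
        using trans[OF wedge_in_u2, of r v] by blast
      have "korth v' (\<alpha> *\<^sub>R p + \<beta> *\<^sub>R q + r')"
        using r'(1) orthotriple_inner[OF o1] by (simp add: real_simps[OF d] inner_add_right inner_commute)
      then show ?thesis using lin[OF r'(2)] unfolding r(1) by blast
    qed
    show "\<exists>u. korth v u \<and> \<phi> (wedge u v) = wedge u' v'" if "korth v' u'" for u'
    proof -
      obtain \<alpha> \<beta> r' where r': "u' = \<alpha> *\<^sub>R p + \<beta> *\<^sub>R q + r'" "inner r' p = 0" "inner r' q = 0" "inner r' v' = 0"
        using decomp[OF o1, of u'] \<open>korth v' u'\<close> by (auto simp: real_simps[OF d] inner_commute)
      obtain c where c: "c \<in> u2 Js" "wedge r' v' = \<phi> c" using Aut_surj[OF \<phi> wedge_in_u2] by blast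
      obtain r where r: "inner r v = 0" "c = wedge r v"
        using trans[OF c(1)] r'(2-4) c(2) by metis
      have "korth v (\<alpha> *\<^sub>R p0 + \<beta> *\<^sub>R q0 + r)"
        using r(1) orthotriple_inner[OF o] by (simp add: real_simps[OF d] inner_add_right inner_commute)
      moreover have "\<phi> (wedge r v) = wedge r' v'" using c(2) r(2) by simp
      ultimately show ?thesis using lin unfolding r'(1) by blast
    qed
  qed (use d in simp_all)
qed

end

end

section \<open>Unitary groups and the kernel of \<open>Ad\<close>\<close>

context K_structure
begin

lemma unitary_group_iff: "g \<in> unitary_group Js \<longleftrightarrow> twisted (\<lambda>i. 1) g"
  unfolding unitary_group_def twisted_def using K_linear_iff by (auto simp: orth_op_def)

text \<open>By \<open>commutant_of_wedges\<close> a kernel element is a real combination of the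
  \<open>T i\<close>; which combinations lie in \<open>G\<close> depends on the scalars and is left
  to \<open>ker1\<close>.\<close>

lemma induces_isoI:
  assumes G: "\<And>g. g \<in> G \<Longrightarrow> \<exists>s. twisted s g"
    and surj: "\<And>\<phi>. \<phi> \<in> Aut Js \<Longrightarrow> \<exists>g\<in>G. \<forall>x\<in>u2 Js. \<phi> x = Ad g x"
    and ker1: "\<And>g c. g \<in> G \<Longrightarrow> (\<And>u. g u = (\<Sum>i<d. c i *\<^sub>R T i u)) \<Longrightarrow> g \<in> N"
    and ker2: "\<And>g x u. g \<in> G \<Longrightarrow> g \<in> N \<Longrightarrow> x \<in> u2 Js \<Longrightarrow> g (x u) = x (g u)"
  shows "induces_iso Js G N"
  unfolding induces_iso_def
proof (intro conjI ballI)
  show "Ad (g \<circ> h) x = Ad g (Ad h x)" if "g \<in> G" "h \<in> G" for g h x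
  proof -
    have "bij g" "bij h" using G[OF that(1)] G[OF that(2)] twisted_simps(9) by blast+
    then show ?thesis by (simp add: Ad_def o_inv_distrib o_assoc)
  qed
  show "Ad g \<in> Aut Js" if "g \<in> G" for g using G[OF that] Ad_Aut by blast
  show "\<exists>g\<in>G. \<forall>x\<in>u2 Js. \<phi> x = Ad g x" if "\<phi> \<in> Aut Js" for \<phi> by (rule surj[OF that])
  show "(\<forall>x\<in>u2 Js. Ad g x = x) \<longleftrightarrow> g \<in> N" if g_G: "g \<in> G" for g
  proof -
    obtain s where g: "twisted s g" using G[OF g_G] by blast
    have comm: "Ad g x = x \<longleftrightarrow> (\<forall>u. g (x u) = x (g u))" for x
      unfolding fun_eq_iff Ad_apply using twisted_simps(5,6)[OF g] by metis
    show ?thesis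
    proof
      assume "\<forall>x\<in>u2 Js. Ad g x = x"
      then have "g (wedge u w z) = wedge u w (g z)" for u w z using comm wedge_in_u2 by blast
      from commutant_of_wedges[OF twisted_simps(8)[OF g] this]
      show "g \<in> N" using ker1[OF g_G] by blast
    next
      assume "g \<in> N"
      then show "\<forall>x\<in>u2 Js. Ad g x = x" using ker2[OF g_G] comm by blast
    qed
  qed
qed

end

section \<open>The three kinds of scalars\<close>

lemma complex_structure_simps:
  assumes "complex_structure J"
  shows "J (J u) = - u" "J (u + v) = J u + J v" "J (c *\<^sub>R u) = c *\<^sub>R J u" "J (- u) = - J u" "linear J" "orth_op J"
    "inner u (J v) = - inner (J u) v" "inner (J u) u = 0" "inner u (J u) = 0"
    "J (u - v) = J u - J v"
proof -
  have lin: "linear J" and J: "orth_op J" and JJ: "\<And>u. J (J u) = - u"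
    and inn: "\<And>u v. inner (J u) (J v) = inner u v"
    using assms by (auto simp: complex_structure_def orth_op_def)
  show "J (J u) = - u" "J (u + v) = J u + J v" "J (c *\<^sub>R u) = c *\<^sub>R J u" "J (- u) = - J u" "linear J" "orth_op J"
    "J (u - v) = J u - J v"
    using lin J JJ by (simp_all add: linear_diff linear_add linear_scale linear_neg)
  show sk: "inner u (J v) = - inner (J u) v" for u v using inn[of u "J v"] inn[of "J u" v] JJ by simp
  show "inner (J u) u = 0" "inner u (J u) = 0" using sk[of u u] by (simp_all add: inner_commute)
qed

lemma orth_op_ident: "orth_op (\<lambda>u. u)"
  by (simp add: orth_op_def linear_ident bij_def inj_def surj_def)

lemma real_K_structure:
  assumes "infinite_dimensional TYPE('h::{real_inner,complete_space})"
  shows "K_structure ([] :: ('h \<Rightarrow> 'h) list) (\<lambda>i u. u) 1"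
  using assms by unfold_locales (auto simp: orth_op_ident K_linear_def intro!: exI[of _ "1::real"])

lemma complex_K_structure:
  assumes "infinite_dimensional TYPE('h::{real_inner,complete_space})"
    and J: "complex_structure (J :: 'h \<Rightarrow> 'h)"
  shows "K_structure [J] (\<lambda>i. if i = 0 then (\<lambda>u. u) else J) 2"
proof -
  note Js = complex_structure_simps[OF J]
  have two: "i < 2 \<longleftrightarrow> i = 0 \<or> i = 1" for i :: nat by auto
  show ?thesis
  proof
    fix i j :: nat assume ij: "i < 2" "j < 2"
    then show "\<exists>k<2::nat. \<exists>\<epsilon>. \<forall>u. (if i = 0 then (\<lambda>u. u) else J) ((if j = 0 then (\<lambda>u. u) else J) u)
        = \<epsilon> *\<^sub>R (if k = 0 then (\<lambda>u. u) else J) u"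
      by (intro exI[of _ "if i = j then 0 else 1"] conjI exI[of _ "if i = 1 \<and> j = 1 then -1 else 1"])
        (auto simp: two Js)
  next
    fix x :: "'h \<Rightarrow> 'h"
    show "K_linear [J] x \<longleftrightarrow> (\<forall>i<2::nat. \<forall>u. x ((if i = 0 then (\<lambda>u. u) else J) u) = (if i = 0 then (\<lambda>u. u) else J) (x u))"
      by (auto simp: K_linear_def two fun_eq_iff)
  qed (use assms in \<open>auto simp: two orth_op_ident Js numeral_2_eq_2\<close>)
qed

text \<open>The third imaginary unit is the product \<open>I J\<close>; anticommutation makes it
  skew with square -1.\<close>

lemma quaternionic_K_structure:
  assumes "infinite_dimensional TYPE('h::{real_inner,complete_space})"
    and q: "quaternionic_structure (I :: 'h \<Rightarrow> 'h) J"
  shows "K_structure [I, J] (\<lambda>i. if i = 0 then (\<lambda>u. u) else if i = 1 then I else if i = 2 then J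
    else (\<lambda>u. I (J u))) 4"
proof -
  have cI: "complex_structure I" and cJ: "complex_structure J" and JI: "\<And>u. J (I u) = - I (J u)"
    using q by (auto simp: quaternionic_structure_def)
  note Is = complex_structure_simps[OF cI] and Js = complex_structure_simps[OF cJ]
  have IJ: "inner (I (J u)) u = 0" for u
  proof -
    have "inner (I (J u)) u = - inner (J u) (I u)" using Is(7)[of "J u" u] by simp
    also have "\<dots> = inner u (J (I u))" using Js(7)[of u "I u"] by simp
    also have "\<dots> = - inner (I (J u)) u" by (simp add: JI inner_commute)
    finally show ?thesis by simp
  qed
  have oIJ: "orth_op (\<lambda>u. I (J u))"
    using Is(6) Js(6) unfolding orth_op_def by (auto intro: bij_comp[unfolded o_def] linear_compose[unfolded o_def])
  have four: "i < 4 \<longleftrightarrow> i = 0 \<or> i = 1 \<or> i = 2 \<or> i = 3" for i :: nat by auto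
  let ?T = "\<lambda>i::nat. if i = 0 then (\<lambda>u. u) else if i = 1 then I else if i = 2 then J else (\<lambda>u. I (J u))"
  have sum4: "(\<Sum>i<4. f i) = f 0 + f 1 + f 2 + f 3" for f :: "nat \<Rightarrow> 'h"
    by (simp add: eval_nat_numeral)
  show ?thesis
  proof
    fix i j :: nat assume ij: "i < 4" "j < 4"
    have w: "\<exists>k<4. \<exists>\<epsilon>. \<forall>u. ?T i (?T j u) = \<epsilon> *\<^sub>R ?T k u" 
      if "k < 4" "\<And>u. ?T i (?T j u) = \<epsilon> *\<^sub>R ?T k u" for k \<epsilon>
      using that by blast
    show "\<exists>k<4. \<exists>\<epsilon>. \<forall>u. ?T i (?T j u) = \<epsilon> *\<^sub>R ?T k u"
    proof -
      consider "i = 0" | "j = 0" | "i = j" "i > 0" | "i = 1" "j = 2" | "i = 2" "j = 1" | "i = 1" "j = 3"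
        | "i = 3" "j = 1" | "i = 2" "j = 3" | "i = 3" "j = 2"
        using ij unfolding four by (elim disjE; simp)
      then show ?thesis
      proof cases
        case 1 then show ?thesis using ij by (intro w[of j 1]) auto
      next
        case 2 then show ?thesis using ij by (intro w[of i 1]) auto
      next
        case 3 then show ?thesis using ij by (intro w[of 0 "-1"]) (auto simp: four Is Js JI)
      next
        case 4 then show ?thesis by (intro w[of 3 1]) auto
      next
        case 5 then show ?thesis by (intro w[of 3 "-1"]) (auto simp: JI)
      next
        case 6 then show ?thesis by (intro w[of 2 "-1"]) (auto simp: Is)
      next
        case 7 then show ?thesis by (intro w[of 2 1]) (auto simp: JI Is)
      next
        case 8 then show ?thesis by (intro w[of 1 1]) (auto simp: JI Js Is)
      next
        case 9 then show ?thesis by (intro w[of 1 "-1"]) (auto simp: Js Is)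
      qed
    qed
  next
    fix x :: "'h \<Rightarrow> 'h"
    show "K_linear [I, J] x \<longleftrightarrow> (\<forall>i<4. \<forall>u. x (?T i u) = ?T i (x u))"
      by (auto simp: K_linear_def four fun_eq_iff)
  next
    fix i :: nat and w z u assume "i < 4"
    then show "(\<Sum>j<4. inner (?T j w) (?T i z) *\<^sub>R ?T j u) = ?T i (\<Sum>j<4. inner (?T j w) z *\<^sub>R ?T j u)"
      "(\<Sum>j<4. inner (?T j (?T i w)) z *\<^sub>R ?T j (?T i u)) = (\<Sum>j<4. inner (?T j w) z *\<^sub>R ?T j u)"
      unfolding sum4 by (auto simp: four Is Js JI)
  next
    fix i j :: nat and u assume "i < 4" "j < 4" "i \<noteq> j"
    then show "inner (?T i u) (?T j u) = 0"
      by (auto simp: four Is Js JI IJ)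
  qed (use assms in \<open>auto simp: four orth_op_ident oIJ Is Js JI\<close>)
qed

theorem theorem1p13:
  fixes H :: "'h::{real_inner, complete_space} itself"
  assumes "infinite_dimensional H"
  shows "(\<forall>J::'h \<Rightarrow> 'h. complex_structure J \<longrightarrow>
            induces_iso [J] (AU J)
              {g. \<exists>a b::real. a\<^sup>2 + b\<^sup>2 = 1 \<and> g = (\<lambda>u. a *\<^sub>R u + b *\<^sub>R J u)})
       \<and> induces_iso ([] :: ('h \<Rightarrow> 'h) list) (unitary_group []) {id, uminus}
       \<and> (\<forall>I J::'h \<Rightarrow> 'h. quaternionic_structure I J \<longrightarrow>
            induces_iso [I, J] (unitary_group [I, J]) {id, uminus})"
proof (intro conjI allI impI)
  have inf: "infinite_dimensional TYPE('h)"
    using assms by (simp add: infinite_dimensional_def)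
  have unit_scalar: "g \<in> {id, uminus}" if g: "\<And>u. norm (g u) = norm u" "\<And>u. g u = c *\<^sub>R u"
    and v: "norm v = 1" for g :: "'h \<Rightarrow> 'h" and c :: real and v :: 'h
  proof -
    have "\<bar>c\<bar> = 1" using g(1)[of v] v by (simp add: g(2))
    then have "c = 1 \<or> c = -1" by linarith
    then show ?thesis by (auto simp: g(2) fun_eq_iff)
  qed
  show "induces_iso [J] (AU J) {g. \<exists>a b::real. a\<^sup>2 + b\<^sup>2 = 1 \<and> g = (\<lambda>u. a *\<^sub>R u + b *\<^sub>R J u)}"
    if J: "complex_structure J" for J :: "'h \<Rightarrow> 'h"
  proof -
    let ?T = "\<lambda>i::nat. if i = 0 then (\<lambda>u. u) else J"
    let ?s = "\<lambda>\<sigma> i::nat. if i = 0 then 1 else \<sigma> :: real"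
    interpret K: K_structure "[J]" ?T 2 by (rule complex_K_structure[OF inf J])
    have two: "i < 2 \<longleftrightarrow> i = 0 \<or> i = 1" for i :: nat by auto
    have tw: "K.twisted (?s \<sigma>) g \<longleftrightarrow> orth_op g \<and> \<sigma> * \<sigma> = 1 \<and> (\<forall>u. g (J u) = \<sigma> *\<^sub>R J (g u))" for \<sigma> g
      by (auto simp: K.twisted_def two)
    have AU_iff: "g \<in> AU J \<longleftrightarrow> (\<exists>\<sigma>. K.twisted (?s \<sigma>) g)" for g
    proof
      assume "g \<in> AU J"
      then show "\<exists>\<sigma>. K.twisted (?s \<sigma>) g"
        unfolding tw AU_def fun_eq_iff o_def mem_Collect_eq
        by (elim conjE disjE) (force intro: exI[of _ 1], force intro: exI[of _ "-1"])
    next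
      assume "\<exists>\<sigma>. K.twisted (?s \<sigma>) g"
      then obtain \<sigma> where \<sigma>: "orth_op g" "\<sigma> * \<sigma> = 1" "\<And>u. g (J u) = \<sigma> *\<^sub>R J (g u)" unfolding tw by blast
      then have "\<sigma> = 1 \<or> \<sigma> = -1" using square_eq_1_iff by blast
      then show "g \<in> AU J" using \<sigma> by (auto simp: AU_def fun_eq_iff)
    qed
    show ?thesis
    proof (rule K.induces_isoI)
      show "\<exists>s. K.twisted s g" if "g \<in> AU J" for g using that AU_iff by blast
      show "\<exists>g\<in>AU J. \<forall>x\<in>u2 [J]. \<phi> x = Ad g x" if "\<phi> \<in> Aut [J]" for \<phi>
        using K.complex_case[OF that refl] AU_iff by blast
    next
      fix g c assume "g \<in> AU J" and "\<And>u. g u = (\<Sum>i<2. c i *\<^sub>R ?T i u)"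
      then have g: "g u = c 0 *\<^sub>R u + c 1 *\<^sub>R J u" for u by (simp add: numeral_2_eq_2)
      obtain v :: 'h where v: "norm v = 1" by (rule K.exists_unit)
      have "norm (g v) = 1" using \<open>g \<in> AU J\<close> AU_iff K.twisted_inv_norm(2) v by metis
      \<comment> \<open>\<open>v\<close> and \<open>J v\<close> are orthonormal, so the norm of
        \<open>g v\<close> is the modulus of the complex number with coordinates \<open>c 0\<close>
        and \<open>c 1\<close>.\<close>
      then have "(c 0)\<^sup>2 + (c 1)\<^sup>2 = 1"
        using v complex_structure_simps(9)[OF J, of v] complex_structure_simps(8)[OF J, of v] K.T_inner[of 1 v v]
        by (simp add: g norm_eq_1 inner_add_left inner_add_right power2_eq_square)
      then show "g \<in> {g. \<exists>a b::real. a\<^sup>2 + b\<^sup>2 = 1 \<and> g = (\<lambda>u. a *\<^sub>R u + b *\<^sub>R J u)}" using g by blast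
    next
      fix g x u assume "g \<in> {g. \<exists>a b::real. a\<^sup>2 + b\<^sup>2 = 1 \<and> g = (\<lambda>u. a *\<^sub>R u + b *\<^sub>R J u)}" "x \<in> u2 [J]"
      then show "g (x u) = x (g u)" using K.u2_T[of x 1] by (auto simp: K.u2_simps)
    qed
  qed
  show "induces_iso ([] :: ('h \<Rightarrow> 'h) list) (unitary_group []) {id, uminus}"
  proof -
    interpret K: K_structure "[] :: ('h \<Rightarrow> 'h) list" "\<lambda>i u. u" 1 by (rule real_K_structure[OF inf])
    show ?thesis
    proof (rule K.induces_isoI)
      show "\<exists>s. K.twisted s g" if "g \<in> unitary_group []" for g using that K.unitary_group_iff by blast
      show "\<exists>g\<in>unitary_group []. \<forall>x\<in>u2 []. \<phi> x = Ad g x" if "\<phi> \<in> Aut []" for \<phi> :: "('h \<Rightarrow> 'h) \<Rightarrow> 'h \<Rightarrow> 'h"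
        using K.real_case[OF that refl] K.unitary_group_iff by blast
    next
      fix g :: "'h \<Rightarrow> 'h" and c :: "nat \<Rightarrow> real" assume g: "g \<in> unitary_group []" "\<And>u. g u = (\<Sum>i<1. c i *\<^sub>R u)"
      obtain v :: 'h where v: "norm v = 1" by (rule K.exists_unit)
      show "g \<in> {id, uminus}"
      proof (rule unit_scalar[OF _ _ v])
        show "norm (g u) = norm u" for u
          using g(1) K.unitary_group_iff K.twisted_inv_norm(2) by blast
        show "g u = c 0 *\<^sub>R u" for u using g(2)[of u] by simp
      qed
    next
      fix g x :: "'h \<Rightarrow> 'h" and u assume "g \<in> {id, uminus}" "x \<in> u2 []"
      then show "g (x u) = x (g u)" by (auto simp: K.u2_simps)
    qed
  qed
  show "induces_iso [I, J] (unitary_group [I, J]) {id, uminus}"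
    if q: "quaternionic_structure I J" for I J :: "'h \<Rightarrow> 'h"
  proof -
    let ?T = "\<lambda>i::nat. if i = 0 then (\<lambda>u. u) else if i = 1 then I else if i = 2 then J else (\<lambda>u. I (J u))"
    interpret K: K_structure "[I, J]" ?T 4 by (rule quaternionic_K_structure[OF inf q])
    have cI: "complex_structure I" and cJ: "complex_structure J" and JI: "\<And>u. J (I u) = - I (J u)"
      using q by (auto simp: quaternionic_structure_def)
    note Is = complex_structure_simps[OF cI] and Js = complex_structure_simps[OF cJ]
    show ?thesis
    proof (rule K.induces_isoI)
      show "\<exists>s. K.twisted s g" if "g \<in> unitary_group [I, J]" for g using that K.unitary_group_iff by blast
      show "\<exists>g\<in>unitary_group [I, J]. \<forall>x\<in>u2 [I, J]. \<phi> x = Ad g x" if "\<phi> \<in> Aut [I, J]" for \<phi>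
      proof -
        have "\<exists>g. K.twisted (\<lambda>i. 1) g \<and> (\<forall>x\<in>u2 [I, J]. \<phi> x = Ad g x)"
          by (rule K.quaternionic_case[OF that refl]) (simp_all add: JI)
        then show ?thesis using K.unitary_group_iff by blast
      qed
    next
      fix g :: "'h \<Rightarrow> 'h" and c
      assume g: "g \<in> unitary_group [I, J]" and "\<And>u. g u = (\<Sum>i<4. c i *\<^sub>R ?T i u)"
      then have gc: "g u = c 0 *\<^sub>R u + c 1 *\<^sub>R I u + c 2 *\<^sub>R J u + c 3 *\<^sub>R I (J u)" for u
        by (simp add: eval_nat_numeral)
      have tw: "K.twisted (\<lambda>i. 1) g" using g K.unitary_group_iff by blast
      obtain v :: 'h where v: "norm v = 1" by (rule K.exists_unit)
      have v1: "inner v v = 1" "inner (I v) (I v) = 1" "inner (J v) (J v) = 1" "inner (I (J v)) (I (J v)) = 1"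
        using v Is(1) Js(1) by (simp_all add: norm_eq_1 Is(7) Js(4,7))
      have ort: "inner (I (J v)) (J v) = 0" "inner (J v) (I (J v)) = 0" "inner (I (J v)) (I v) = 0"
        using K.T_orthogonal[of 3 2 v] K.T_orthogonal[of 2 3 v] K.T_orthogonal[of 3 1 v] by simp_all
      have self_neg: "a = 0" if "a = - a" for a :: 'h
        using that scaleR_2[of a] by (metis add.right_inverse scaleR_eq_0_iff zero_neq_numeral)
      \<comment> \<open>Only real scalars are central in H: commuting with \<open>I\<close> kills
        the coefficients of \<open>J\<close> and \<open>I J\<close>, and commuting with
        \<open>J\<close> kills that of \<open>I\<close>.\<close>
      have gI: "g (I v) = I (g v)" using K.twisted_simps(7)[OF tw, of 1 v] by simp
      have gJ: "g (J v) = J (g v)" using K.twisted_simps(7)[OF tw, of 2 v] by simp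
      have "c 3 *\<^sub>R J v - c 2 *\<^sub>R I (J v) = - (c 3 *\<^sub>R J v - c 2 *\<^sub>R I (J v))"
        using gI by (simp add: gc Is Js JI algebra_simps)
      then have 23: "c 3 *\<^sub>R J v - c 2 *\<^sub>R I (J v) = 0" by (rule self_neg)
      have c3: "c 3 = 0" using arg_cong[OF 23, of "\<lambda>a. inner a (J v)"] by (simp add: inner_diff_left v1 ort)
      have c2: "c 2 = 0" using arg_cong[OF 23, of "\<lambda>a. inner a (I (J v))"] by (simp add: inner_diff_left v1 ort c3)
      have "c 1 *\<^sub>R I (J v) = - (c 1 *\<^sub>R I (J v))"
        using gJ by (simp add: gc c2 c3 Is Js JI eq_neg_iff_add_eq_0 algebra_simps)
      then have "c 1 *\<^sub>R I (J v) = 0" by (rule self_neg)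
      from arg_cong[OF this, of "\<lambda>a. inner a (I (J v))"] have c1: "c 1 = 0" by (simp add: v1)
      show "g \<in> {id, uminus}"
        using K.twisted_inv_norm(2)[OF tw] by (intro unit_scalar[OF _ _ v, of _ "c 0"]) (auto simp: gc c1[unfolded One_nat_def] c2 c3)
    next
      fix g x :: "'h \<Rightarrow> 'h" and u assume "g \<in> {id, uminus}" "x \<in> u2 [I, J]"
      then show "g (x u) = x (g u)" by (auto simp: K.u2_simps)
    qed
  qed
qed

end
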